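(* (a) Let $f\in\mathcal{A}$ with $v^s\widehat f(v)\in L^2(\mathbb{R})\cap C_b(\mathbb{R})$ for some $s\in\mathbb{N}$, $s\ge2$. Then $f^{(s)}$ exists as an element of $L^2(\mathbb{R})$, and for every $\sigma>0$, with $h=2\pi/\sigma$, $$|R_\sigma(f)|\le h^s\,\frac{2\zeta(s)}{(2\pi)^{s-1/2}}\,\mathrm{dist}_\infty(f^{(s)},B_\sigma^1).$$ (b) Let $\alpha>1$, $f\in\mathcal{A}$ and $|v|^\alpha\widehat f(v)\in L^2(\mathbb{R})\cap C_b(\mathbb{R})$. Then $D_{\rm s}^{\{\alpha\}}f$ exists as an element of $L^2(\mathbb{R})$, and for every $\sigma>0$, with $h=2\pi/\sigma$, $$|R_\sigma(f)|\le h^\alpha\,\frac{2\zeta(\alpha)}{(2\pi)^{\alpha-1/2}}\,\mathrm{dist}_\infty(D_{\rm s}^{\{\alpha\}}f,B_\sigma^1).$$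
   Context: Fourier transform: $\widehat f(v)=\frac{1}{\sqrt{2\pi}}\int_{\mathbb{R}} f(u)e^{-iuv}\,du$, defined as a Lebesgue integral for $f\in L^1(\mathbb{R})$ and by the usual limiting process for $f\in L^2(\mathbb{R})$. $\zeta$ is the Riemann zeta function. $C_b(\mathbb{R})$ is the class of continuous bounded functions $f:\mathbb{R}\to\mathbb{C}$. $\mathcal{A}=\{f\in L^1(\mathbb{R})\cap C_b(\mathbb{R}) : f\in \mathrm{BV}(\mathbb{R})\text{ or }\widehat f\in \mathrm{BV}(\mathbb{R})\}$, where $\mathrm{BV}(\mathbb{R})$ is the set of functions of bounded variation over $\mathbb{R}$. For $f\in\mathcal{A}$, $\sigma>0$ and $h=2\pi/\sigma$, $R_\sigma(f)$ denotes the remainder in the quadrature formula $\int_{-\infty}^\infty f(t)\,dt=h\sum_{k\in\mathbb{Z}}f(hk)+R_\sigma(f)$; by the Poisson summation formula, $R_\sigma(f)=-\sqrt{2\pi}\sum_{k\in\mathbb{Z}\setminus\{0\}}\widehat f(k\sigma)$. Bernstein space: $B_\sigma^1$ is the set of all $f\in L^1(\mathbb{R})$ whose Fourier transform vanishes outside $(-\sigma,\sigma)$. For $f\in L^2(\mathbb{R})$ with $\widehat f\in C_b(\mathbb{R})$, $\mathrm{dist}_\infty(f,B_\sigma^1):=\inf_{g\in B_\sigma^1}\sup_{v\in\mathbb{R}}|\widehat f(v)-\widehat g(v)|$. The derivative $f^{(s)}$ in $L^2(\mathbb{R})$ is understood in the sense of the Sobolev space $W^{s,2}(\mathbb{R})$: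 $f=\phi$ a.e. with $\phi,\dots,\phi^{(s-1)}$ locally absolutely continuous and $\phi^{(k)}\in L^2(\mathbb{R})$ for $0\le k\le s$; $f^{(s)}:=\phi^{(s)}$. Strong Riesz derivative: a function $f\in L^2(\mathbb{R})$ has a strong Riesz derivative of order $\alpha$, $0<\alpha<2j$, $j\in\mathbb{N}$, if there is $g\in L^2(\mathbb{R})$ with $$\lim_{\varepsilon\to0+}\Big\|\frac{1}{C_{\alpha,2j}}\int_\varepsilon^\infty\frac{\overline\Delta_u^{2j}f(\cdot)}{u^{1+\alpha}}\,du-g(\cdot)\Big\|_{L^2(\mathbb{R})}=0,$$ where $\overline\Delta_u^{2j}f(x)=\sum_{k=0}^{2j}(-1)^k\binom{2j}{k}f(x+(j-k)u)$ and $C_{\alpha,2j}=(-1)^j2^{2j-\alpha}\int_0^\infty\frac{\sin^{2j}u}{u^{1+\alpha}}\,du$; then $D_{\rm s}^{\{\alpha\}}f:=g$ (independent of $j$). It is known that $f\in L^2(\mathbb{R})$ has a strong Riesz derivative of order $\alpha$ if and only if there is $g\in L^2(\mathbb{R})$ with $\widehat g(v)=|v|^\alpha\widehat f(v)$, and then $\widehat{D_{\rm s}^{\{\alpha\}}f}(v)=|v|^\alpha\widehat f(v)$. *)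

theory Defs
  imports "HOL-Analysis.Analysis"
begin

section \<open>Function spaces on the real line\<close>

definition square_integrable :: "(real \<Rightarrow> complex) \<Rightarrow> bool" where
  "square_integrable f \<longleftrightarrow>
     f \<in> borel_measurable lebesgue \<and> integrable lebesgue (\<lambda>x. (cmod (f x))\<^sup>2)"

definition L2_norm :: "(real \<Rightarrow> complex) \<Rightarrow> real" where
  "L2_norm f = sqrt (LINT x|lebesgue. (cmod (f x))\<^sup>2)"

text \<open>The first conjunct keeps the norm from being the default value \<open>0\<close> of a divergent integral.\<close>

definition tendsto_L2 :: "('t \<Rightarrow> real \<Rightarrow> complex) \<Rightarrow> (real \<Rightarrow> complex) \<Rightarrow> 't filter \<Rightarrow> bool" where
  "tendsto_L2 f g F \<longleftrightarrow>
     (\<forall>\<^sub>F t in F. square_integrable (\<lambda>x. f t x - g x)) \<and>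
     ((\<lambda>t. L2_norm (\<lambda>x. f t x - g x)) \<longlongrightarrow> 0) F"

definition bounded_variation :: "(real \<Rightarrow> complex) \<Rightarrow> bool" where
  "bounded_variation f \<longleftrightarrow>
     (\<exists>C. \<forall>n. \<forall>x :: nat \<Rightarrow> real. (\<forall>i<n. x i \<le> x (Suc i)) \<longrightarrow>
        (\<Sum>i<n. cmod (f (x (Suc i)) - f (x i))) \<le> C)"

definition abs_continuous_on :: "real \<Rightarrow> real \<Rightarrow> (real \<Rightarrow> complex) \<Rightarrow> bool" where
  "abs_continuous_on c d f \<longleftrightarrow>
     (\<forall>\<epsilon>>0. \<exists>\<delta>>0. \<forall>n. \<forall>a b :: nat \<Rightarrow> real.
        (\<forall>i<n. c \<le> a i \<and> a i \<le> b i \<and> b i \<le> d) \<and>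
        disjoint_family_on (\<lambda>i. {a i<..<b i}) {..<n} \<and>
        (\<Sum>i<n. b i - a i) < \<delta> \<longrightarrow>
        (\<Sum>i<n. cmod (f (b i) - f (a i))) < \<epsilon>)"

definition locally_abs_continuous :: "(real \<Rightarrow> complex) \<Rightarrow> bool" where
  "locally_abs_continuous f \<longleftrightarrow> (\<forall>c d. c < d \<longrightarrow> abs_continuous_on c d f)"


section \<open>Fourier transform\<close>

definition fourier :: "(real \<Rightarrow> complex) \<Rightarrow> real \<Rightarrow> complex" where
  "fourier f v =
     complex_of_real (1 / sqrt (2 * pi)) *
       (LINT u|lebesgue. f u * exp (- (\<i> * complex_of_real u * complex_of_real v)))"

text \<open>On \<open>L\<^sup>2\<close> the transform is the limit in mean of the transforms of the truncations, hence
  determined only up to a null set.\<close>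

definition has_fourier_L2 :: "(real \<Rightarrow> complex) \<Rightarrow> (real \<Rightarrow> complex) \<Rightarrow> bool" where
  "has_fourier_L2 f F \<longleftrightarrow> square_integrable f \<and> square_integrable F \<and>
     tendsto_L2 (\<lambda>R. fourier (\<lambda>u. indicator {-R..R} u * f u)) F at_top"

text \<open>The bounded continuous representative, unique if there is one; unspecified otherwise.\<close>

definition fourier_L2_bcont :: "(real \<Rightarrow> complex) \<Rightarrow> real \<Rightarrow> complex" where
  "fourier_L2_bcont f = (THE F. has_fourier_L2 f F \<and> F \<in> bcontfun)"

definition bernstein_L1 :: "real \<Rightarrow> (real \<Rightarrow> complex) set" where
  "bernstein_L1 \<sigma> =
     {g. integrable lebesgue g \<and> (\<forall>v. v \<notin> {-\<sigma><..<\<sigma>} \<longrightarrow> fourier g v = 0)}"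

text \<open>Meaningful for square-integrable \<open>f\<close> with bounded continuous transform and
  nonempty \<open>G\<close> consisting of integrable functions.\<close>

definition dist_infty :: "(real \<Rightarrow> complex) \<Rightarrow> (real \<Rightarrow> complex) set \<Rightarrow> real" where
  "dist_infty f G = (INF g\<in>G. SUP v. cmod (fourier_L2_bcont f v - fourier g v))"


section \<open>The quadrature formula\<close>

definition quadrature_class :: "(real \<Rightarrow> complex) set" where
  "quadrature_class =
     {f. integrable lebesgue f \<and> f \<in> bcontfun \<and>
         (bounded_variation f \<or> bounded_variation (fourier f))}"

text \<open>The sum over all integers is the limit of its symmetric partial sums, as usual for the
  Poisson summation formula: if only the transform has bounded variation, then
  absolute convergence is not available.\<close>

definition quadrature_remainder :: "real \<Rightarrow> (real \<Rightarrow> complex) \<Rightarrow> complex" where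
  "quadrature_remainder \<sigma> f =
     (let h = 2 * pi / \<sigma> in
       (LINT t|lebesgue. f t) -
       complex_of_real h * lim (\<lambda>N. \<Sum>k = - int N..int N. f (h * real_of_int k)))"

text \<open>The Riemann zeta function on the half-line \<open>s > 1\<close>, by its Dirichlet series.\<close>

definition zeta :: "real \<Rightarrow> real" where
  "zeta s = (\<Sum>n. 1 / real (Suc n) powr s)"


section \<open>Derivatives in the mean-square sense\<close>

text \<open>\<open>g\<close> is a version of the Sobolev derivative of order \<open>s\<close>. The functions \<open>\<phi> k\<close> are
  the successive derivatives of \<open>\<phi> 0\<close>, the last one existing only almost everywhere.\<close>

definition has_L2_derivative :: "nat \<Rightarrow> (real \<Rightarrow> complex) \<Rightarrow> (real \<Rightarrow> complex) \<Rightarrow> bool" where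
  "has_L2_derivative s f g \<longleftrightarrow>
     (\<exists>\<phi> :: nat \<Rightarrow> real \<Rightarrow> complex.
        (AE x in lebesgue. f x = \<phi> 0 x) \<and>
        (\<forall>k<s. locally_abs_continuous (\<phi> k)) \<and>
        (\<forall>k. Suc k < s \<longrightarrow> (\<forall>x. (\<phi> k has_vector_derivative \<phi> (Suc k) x) (at x))) \<and>
        (\<forall>k. Suc k = s \<longrightarrow>
           (AE x in lebesgue. (\<phi> k has_vector_derivative \<phi> (Suc k) x) (at x))) \<and>
        (\<forall>k\<le>s. square_integrable (\<phi> k)) \<and>
        square_integrable g \<and> (AE x in lebesgue. g x = \<phi> s x))"

definition central_difference ::
    "nat \<Rightarrow> real \<Rightarrow> (real \<Rightarrow> complex) \<Rightarrow> real \<Rightarrow> complex" where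
  "central_difference j u f x =
     (\<Sum>k = 0..2 * j. (-1) ^ k * of_nat ((2 * j) choose k) * f (x + (real j - real k) * u))"

definition riesz_constant :: "real \<Rightarrow> nat \<Rightarrow> real" where
  "riesz_constant \<alpha> j =
     (-1) ^ j * 2 powr (2 * real j - \<alpha>) *
       (LINT u:{0<..}|lebesgue. sin u ^ (2 * j) / u powr (1 + \<alpha>))"

text \<open>\<open>g\<close> is a version of the strong Riesz derivative of order \<open>\<alpha>\<close>, formed with central
  differences of order \<open>2 * j\<close>.\<close>

definition has_strong_riesz_derivative ::
    "nat \<Rightarrow> real \<Rightarrow> (real \<Rightarrow> complex) \<Rightarrow> (real \<Rightarrow> complex) \<Rightarrow> bool" where
  "has_strong_riesz_derivative j \<alpha> f g \<longleftrightarrow>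
     0 < \<alpha> \<and> \<alpha> < 2 * real j \<and> square_integrable f \<and> square_integrable g \<and>
     tendsto_L2
       (\<lambda>\<epsilon> x. complex_of_real (1 / riesz_constant \<alpha> j) *
          (LINT u:{\<epsilon><..}|lebesgue. central_difference j u f x / complex_of_real (u powr (1 + \<alpha>))))
       g (at_right 0)"

end

theory Submission
  imports Defs "HOL-Probability.Characteristic_Functions"
begin

text \<open>Write \<open>F\<close> for the transform of \<open>f\<close>. Since \<open>\<bar>v\<bar>\<^sup>\<alpha> F(v)\<close> is bounded and \<open>\<alpha> > 1\<close>, \<open>F\<close> is
  integrable and \<open>\<Sum>F(k\<sigma>)\<close> converges absolutely. Summing the inversion formula against Fejer's kernel
  shows that the arithmetic means of the quadrature sums converge to the Poisson value; if \<open>f\<close> has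
  bounded variation then \<open>\<Sum>f(hk)\<close> converges absolutely, and if \<open>F\<close> does then \<open>f(hk) = O(1/k)\<close>, so in
  both cases a Tauberian argument gives convergence of the sums themselves. Hence the remainder is
  \<open>-\<surd>(2\<pi>) \<Sum>F(k\<sigma>)\<close> over \<open>k \<noteq> 0\<close>. The transform \<open>H\<close> of the derivative satisfies
  \<open>\<bar>H(v)\<bar> = \<bar>v\<bar>\<^sup>\<alpha> \<bar>F(v)\<bar>\<close>, and functions in the Bernstein space have transforms vanishing at
  \<open>k\<sigma>\<close>, so \<open>\<bar>F(k\<sigma>)\<bar>\<close> is at most the distance divided by \<open>(\<bar>k\<bar>\<sigma>)\<^sup>\<alpha>\<close>.

  The derivatives are built on the frequency side, as mean-square limits of the inverse transforms
  of \<open>H(v) exp (-v\<^sup>2/2(n+1)\<^sup>2)\<close>. For continuous bounded integrable functions Plancherel's identity follows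
  from Gaussian summation and dominated convergence alone.\<close>

section \<open>The Fourier integral\<close>

text \<open>Three obstacles shape the proof. Next, the distance refers to
  \<open>fourier_L2_bcont\<close>, a definite description, and the bounds quantify over every
  version \<open>g\<close> of the derivative: each version must be shown to have the one explicit
  function H as its transform, so uniqueness up to null sets is needed as well as existence.
  Finally, H is square integrable but possibly not integrable, so its inverse transform need not
  converge absolutely; Gaussian cutoffs are used because they restore integrability without
  destroying continuity, which Plancherel's identity needs here. The constant is \<surd>(2\<pi>) * 2
  * zeta(\<alpha>) / \<sigma>^\<alpha>, rewritten with \<sigma> = 2\<pi>/h; its factor 2 counts the
  nodes k\<sigma> and -k\<sigma>.\<close>

lemma borel_measurable_cis [measurable]: "cis \<in> borel_measurable borel"
  by (intro borel_measurable_continuous_onI continuous_intros)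

lemma fourier_lborel:
  assumes "f \<in> borel_measurable borel"
  shows "fourier f v = complex_of_real (1 / sqrt (2 * pi)) * (LINT u|lborel. f u * cis (- (u * v)))"
proof -
  have [measurable]: "f \<in> borel_measurable borel" by fact
  have "exp (- (\<i> * complex_of_real u * complex_of_real v)) = cis (- (u * v))" for u
    by (simp add: cis_conv_exp mult_ac)
  then show ?thesis
    unfolding fourier_def by (simp add: integral_completion)
qed

lemma integrable_mult_cis:
  assumes "integrable lborel f" and [measurable]: "\<phi> \<in> borel_measurable borel"
  shows "integrable lborel (\<lambda>u. f u * cis (\<phi> u))"
proof -
  have [measurable]: "f \<in> borel_measurable borel" using assms(1) by auto
  show ?thesis
    by (rule Bochner_Integration.integrable_bound[OF assms(1)]) (auto simp: norm_mult)
qed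

lemma norm_fourier_le:
  assumes "integrable lebesgue f"
  shows "cmod (fourier f v) \<le> 1 / sqrt (2 * pi) * (LINT u|lebesgue. cmod (f u))"
proof -
  have "cmod (LINT u|lebesgue. f u * exp (- (\<i> * complex_of_real u * complex_of_real v)))
      \<le> (LINT u|lebesgue. cmod (f u * exp (- (\<i> * complex_of_real u * complex_of_real v))))"
    by (rule integral_norm_bound)
  also have "\<dots> = (LINT u|lebesgue. cmod (f u))"
    by (simp add: norm_mult)
  finally show ?thesis
    unfolding fourier_def by (simp add: norm_mult norm_divide divide_right_mono)
qed

lemma integrable_lborel_lebesgue:
  fixes f :: "real \<Rightarrow> 'b::{banach, second_countable_topology}"
  assumes "integrable lborel f"
  shows "integrable lebesgue f" "integral\<^sup>L lebesgue f = integral\<^sup>L lborel f"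
  using assms integrable_completion[of f lborel] integral_completion[of f lborel] by auto

lemma continuous_fourier:
  assumes "integrable lborel f"
  shows "continuous_on UNIV (fourier f)"
proof -
  have [measurable]: "f \<in> borel_measurable borel" using assms by auto
  have "isCont (fourier f) v" for v
    unfolding continuous_at_sequentially
  proof (intro allI impI)
    fix X :: "nat \<Rightarrow> real" assume X: "X \<longlonglongrightarrow> v"
    have "(\<lambda>n. LINT u|lborel. f u * cis (- (u * X n))) \<longlonglongrightarrow> (LINT u|lborel. f u * cis (- (u * v)))"
      by (rule integral_dominated_convergence[where w="\<lambda>u. cmod (f u)"])
        (auto simp: norm_mult assms intro!: tendsto_intros X isCont_tendsto_compose[of _ cis] continuous_intros)
    then show "(fourier f \<circ> X) \<longlonglongrightarrow> fourier f v"
      unfolding o_def by (subst (1 2) fourier_lborel) (auto intro: tendsto_intros)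
  qed
  then show ?thesis by (simp add: continuous_on_eq_continuous_at)
qed

lemma borel_measurable_fourier [measurable_dest]:
  assumes "integrable lborel f"
  shows "fourier f \<in> borel_measurable borel"
  using continuous_fourier[OF assms] by (rule borel_measurable_continuous_onI)

lemma bcontfun_fourier:
  assumes "integrable lborel f"
  shows "fourier f \<in> bcontfun"
  using continuous_fourier[OF assms] norm_fourier_le[OF integrable_lborel_lebesgue(1)[OF assms]]
  by (rule bcontfun_normI)

lemma bcontfunE:
  assumes "f \<in> bcontfun"
  obtains B where "0 < B" "\<And>x. cmod (f x) \<le> B"
  using assms unfolding bcontfun_def bounded_pos by auto

lemma bcontfun_borel:
  fixes f :: "real \<Rightarrow> complex"
  shows "f \<in> bcontfun \<Longrightarrow> f \<in> borel_measurable borel"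
  unfolding bcontfun_def by (auto intro: borel_measurable_continuous_onI)

lemma integrable_mult_bounded:
  fixes f g :: "real \<Rightarrow> complex"
  assumes "integrable lborel f" and [measurable]: "g \<in> borel_measurable borel" and "\<And>x. cmod (g x) \<le> B"
  shows "integrable lborel (\<lambda>x. f x * g x)"
proof -
  have [measurable]: "f \<in> borel_measurable borel" using assms(1) by auto
  have "cmod (g x) \<le> \<bar>B\<bar>" for x using assms(3)[of x] by linarith
  moreover have "integrable lborel (\<lambda>x. f x * complex_of_real \<bar>B\<bar>)"
    using assms(1) by (rule integrable_mult_left)
  ultimately show ?thesis
    by (elim Bochner_Integration.integrable_bound)
      (auto simp: norm_mult abs_mult intro!: AE_I2 mult_left_mono)
qed

text \<open>The kernels needed later (exponentials and symbols of central differences) are bounded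
  but not integrable on the plane, so the majorant on the product space must come from
  \<open>u\<close> and \<open>k\<close> alone.\<close>

lemma Fubini_bounded_kernel:
  fixes u k :: "real \<Rightarrow> complex" and c :: "real \<times> real \<Rightarrow> complex"
  assumes u: "integrable lborel u" and k: "integrable lborel k"
    and [measurable]: "c \<in> borel_measurable (lborel \<Otimes>\<^sub>M lborel)" and c: "\<And>p. cmod (c p) \<le> B"
  shows "(LINT y|lborel. k y * (LINT x|lborel. u x * c (x, y))) = (LINT x|lborel. u x * (LINT y|lborel. k y * c (x, y)))"
proof -
  have [measurable]: "u \<in> borel_measurable borel" "k \<in> borel_measurable borel" using u k by auto
  have B: "0 \<le> B" using c[of undefined] norm_ge_zero order_trans by blast
  have "integrable (lborel \<Otimes>\<^sub>M lborel) (\<lambda>(x, y). (u x * k y) * complex_of_real B)"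
  proof (rule lborel_pair.Fubini_integrable)
    have "integrable lborel (\<lambda>x. cmod (u x) * (LINT y|lborel. cmod (k y) * B))"
      using u by (intro integrable_mult_left) auto
    then show "integrable lborel (\<lambda>x. LINT y|lborel. norm (case (x, y) of (x, y) \<Rightarrow> u x * k y * complex_of_real B))"
      using B by (simp add: norm_mult mult.assoc)
  qed (use k in \<open>auto intro!: integrable_mult_left integrable_mult_right\<close>)
  then have *: "integrable (lborel \<Otimes>\<^sub>M lborel) (\<lambda>(x, y). u x * k y * c (x, y))"
    by (rule Bochner_Integration.integrable_bound)
      (use c B in \<open>auto simp: norm_mult intro!: mult_left_mono AE_I2\<close>)
  have "(LINT y|lborel. k y * (LINT x|lborel. u x * c (x, y))) = (LINT y|lborel. LINT x|lborel. u x * k y * c (x, y))"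
    by (subst integral_mult_right_zero[symmetric]) (simp add: mult_ac)
  also have "\<dots> = (LINT x|lborel. LINT y|lborel. u x * k y * c (x, y))"
    using lborel_pair.Fubini_integral[OF *] .
  also have "\<dots> = (LINT x|lborel. u x * (LINT y|lborel. k y * c (x, y)))"
    by (subst integral_mult_right_zero[symmetric]) (simp add: mult_ac)
  finally show ?thesis .
qed

text \<open>The bridge between the two sides: Gaussian summation, the Plancherel identity and the
  cross term of the mean-square comparison each arise from a suitable choice of
  \<open>k\<close>.\<close>

lemma fourier_multiplication:
  assumes u: "integrable lborel u" and k: "integrable lborel k"
  shows "(LINT v|lborel. fourier u v * k v) = (LINT x|lborel. u x * fourier k x)"
proof -
  have [measurable]: "u \<in> borel_measurable borel" "k \<in> borel_measurable borel" using u k by auto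
  have "(LINT y|lborel. k y * (LINT x|lborel. u x * cis (- (fst (x, y) * snd (x, y)))))
      = (LINT x|lborel. u x * (LINT y|lborel. k y * cis (- (fst (x, y) * snd (x, y)))))"
    by (rule Fubini_bounded_kernel[OF u k, where B=1 and c="\<lambda>p. cis (- (fst p * snd p))"]) auto
  then show ?thesis
    by (simp add: fourier_lborel mult_ac)
qed

subsection \<open>Gaussian summation\<close>

text \<open>Normalised by its value 1 at the origin and not by its mass, since it acts as a cutoff
  in frequency. As \<epsilon> tends to 0 the cutoff widens, while its transform is a normal density
  with standard deviation \<epsilon>.\<close>

definition gauss :: "real \<Rightarrow> real \<Rightarrow> real" where
  "gauss \<epsilon> v = exp (- (\<epsilon> * v)\<^sup>2 / 2)"

lemma gauss_pos: "0 < gauss \<epsilon> v" and gauss_le_1: "gauss \<epsilon> v \<le> 1"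
  by (auto simp: gauss_def)

lemma gauss_measurable [measurable]: "gauss \<epsilon> \<in> borel_measurable borel"
  unfolding gauss_def[abs_def] by measurable

lemma continuous_gauss: "continuous_on UNIV (gauss \<epsilon>)"
  unfolding gauss_def[abs_def] by (intro continuous_intros) auto

lemma gauss_tendsto: "(\<lambda>n. gauss (1 / real (Suc n)) v) \<longlonglongrightarrow> 1"
proof -
  have "(\<lambda>n. exp (- (1 / real (Suc n) * v)\<^sup>2 / 2)) \<longlonglongrightarrow> exp (- (0 * v)\<^sup>2 / 2)"
    by (intro tendsto_intros LIMSEQ_Suc[OF lim_1_over_n]) auto
  then show ?thesis by (simp add: gauss_def)
qed

lemma gauss_eq_normal_density:
  "0 < \<epsilon> \<Longrightarrow> gauss \<epsilon> v = sqrt (2 * pi) / \<epsilon> * normal_density 0 (1 / \<epsilon>) v"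
  by (simp add: gauss_def normal_density_def power_divide real_sqrt_divide real_sqrt_mult power_mult_distrib)

lemma integrable_gauss: "0 < \<epsilon> \<Longrightarrow> integrable lborel (gauss \<epsilon>)"
  by (simp add: gauss_eq_normal_density cong: Bochner_Integration.integrable_cong)

text \<open>Rescaling by 1/\<epsilon> turns the integral into the characteristic function of the
  standard normal law at t/\<epsilon>, which is known in closed form.\<close>

lemma integral_gauss_cis:
  assumes "0 < \<epsilon>"
  shows "(LINT v|lborel. complex_of_real (gauss \<epsilon> v) * cis (v * t))
    = complex_of_real (2 * pi * normal_density 0 \<epsilon> t)"
proof -
  have "(LINT v|lborel. complex_of_real (gauss \<epsilon> v) * cis (v * t))
     = \<bar>1/\<epsilon>\<bar> *\<^sub>R (LINT v|lborel. complex_of_real (gauss \<epsilon> (0 + 1/\<epsilon> * v)) * cis ((0 + 1/\<epsilon> * v) * t))"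
    using assms by (intro lborel_integral_real_affine) auto
  also have "(\<lambda>v. complex_of_real (gauss \<epsilon> (0 + 1/\<epsilon> * v)) * cis ((0 + 1/\<epsilon> * v) * t))
     = (\<lambda>v. sqrt (2 * pi) * (std_normal_density v *\<^sub>R iexp (t / \<epsilon> * v)))"
    using assms by (auto simp: gauss_def std_normal_density_def cis_conv_exp scaleR_conv_of_real mult_ac)
  also have "(LINT v|lborel. sqrt (2 * pi) * (std_normal_density v *\<^sub>R iexp (t / \<epsilon> * v)))
      = sqrt (2 * pi) * char std_normal_distribution (t / \<epsilon>)"
    unfolding char_def
    by (subst integral_density)
      (auto simp: integral_mult_right_zero[symmetric] simp del: integral_mult_right_zero mult_scaleR_right
         intro!: Bochner_Integration.integral_cong)
  also have "char std_normal_distribution (t / \<epsilon>) = exp (- ((t / \<epsilon>)\<^sup>2) / 2)"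
    by (simp add: char_std_normal_distribution)
  also have "\<bar>1/\<epsilon>\<bar> *\<^sub>R (complex_of_real (sqrt (2 * pi)) * complex_of_real (exp (- ((t / \<epsilon>)\<^sup>2) / 2))) =
     complex_of_real (2 * pi * normal_density 0 \<epsilon> t)"
  proof -
    have "1/\<epsilon> * (sqrt (2 * pi) * exp (- ((t / \<epsilon>)\<^sup>2) / 2)) = 2 * pi * normal_density 0 \<epsilon> t"
      using assms unfolding normal_density_def
      by (simp add: real_sqrt_mult power_divide field_simps)
    then show ?thesis using assms
      by (metis abs_of_pos of_real_mult scaleR_conv_of_real zero_less_divide_1_iff)
  qed
  finally show ?thesis by simp
qed

lemma normal_density_shift: "normal_density x \<epsilon> y = normal_density 0 \<epsilon> (y - x)"
  by (simp add: normal_density_def)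

lemma normal_density_sym: "normal_density x \<epsilon> y = normal_density y \<epsilon> x"
  by (simp add: normal_density_def power2_commute)

lemma fourier_gauss_cis:
  assumes "0 < \<epsilon>"
  shows "fourier (\<lambda>v. complex_of_real (gauss \<epsilon> v) * cis (v * x)) y
     = complex_of_real (sqrt (2 * pi) * normal_density x \<epsilon> y)"
proof -
  have "fourier (\<lambda>v. complex_of_real (gauss \<epsilon> v) * cis (v * x)) y
     = complex_of_real (1 / sqrt (2 * pi)) * (LINT v|lborel. complex_of_real (gauss \<epsilon> v) * cis (v * (x - y)))"
    by (subst fourier_lborel) (auto simp: cis_mult right_diff_distrib mult.assoc)
  also have "\<dots> = complex_of_real (1 / sqrt (2 * pi) * (2 * pi * normal_density x \<epsilon> y))"
    unfolding integral_gauss_cis[OF assms]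
    by (simp add: normal_density_shift[of x \<epsilon> y] normal_density_def power2_commute)
  also have "1 / sqrt (2 * pi) * (2 * pi * normal_density x \<epsilon> y) = sqrt (2 * pi) * normal_density x \<epsilon> y"
    by (simp add: field_simps)
  finally show ?thesis .
qed

text \<open>Convolution with the heat kernel. The density is centred at \<open>x\<close> because the
  factor \<open>cis (v * x)\<close> in the inversion integral moves the transform of the Gaussian
  there.\<close>

definition gauss_mean :: "real \<Rightarrow> (real \<Rightarrow> complex) \<Rightarrow> real \<Rightarrow> complex" where
  "gauss_mean \<epsilon> u x = (LINT y|lborel. u y * complex_of_real (normal_density x \<epsilon> y))"

lemma gauss_summation:
  assumes "integrable lborel u" "0 < \<epsilon>"
  shows "(LINT v|lborel. fourier u v * (complex_of_real (gauss \<epsilon> v) * cis (v * x)))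
     = complex_of_real (sqrt (2 * pi)) * gauss_mean \<epsilon> u x"
proof -
  have "integrable lborel (\<lambda>v. complex_of_real (gauss \<epsilon> v) * cis (v * x))"
    using integrable_gauss[OF assms(2)] by (intro integrable_mult_cis) auto
  from fourier_multiplication[OF assms(1) this]
  show ?thesis
    unfolding gauss_mean_def fourier_gauss_cis[OF assms(2)]
    by (simp add: integral_mult_right_zero[symmetric] mult_ac del: integral_mult_right_zero)
qed

text \<open>After the substitution y = x + \<epsilon>z the weight no longer depends on \<epsilon>:
  boundedness of \<open>u\<close> gives the majorant and continuity the limit, at every point and
  not just almost everywhere.\<close>

lemma gauss_mean_tendsto:
  assumes "u \<in> bcontfun"
  shows "(\<lambda>n. gauss_mean (1 / real (Suc n)) u x) \<longlonglongrightarrow> u x"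
proof -
  obtain B where B: "\<And>x. cmod (u x) \<le> B" using bcontfunE[OF assms] by metis
  have c: "continuous_on UNIV u" using assms by (simp add: bcontfun_def)
  have [measurable]: "u \<in> borel_measurable borel" using assms by (rule bcontfun_borel)
  have eq: "gauss_mean \<epsilon> u x = (LINT z|lborel. u (x + \<epsilon> * z) * complex_of_real (std_normal_density z))" if "0 < \<epsilon>" for \<epsilon>
  proof -
    have "gauss_mean \<epsilon> u x = \<bar>\<epsilon>\<bar> *\<^sub>R (LINT z|lborel. u (x + \<epsilon> * z) * complex_of_real (normal_density x \<epsilon> (x + \<epsilon> * z)))"
      unfolding gauss_mean_def using that by (intro lborel_integral_real_affine) auto
    also have "\<dots> = (LINT z|lborel. \<epsilon> *\<^sub>R (u (x + \<epsilon> * z) * complex_of_real (normal_density x \<epsilon> (x + \<epsilon> * z))))"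
      using that by simp
    also have "\<dots> = (LINT z|lborel. u (x + \<epsilon> * z) * complex_of_real (std_normal_density z))"
    proof (intro Bochner_Integration.integral_cong refl)
      fix z
      have "\<epsilon> * normal_density x \<epsilon> (x + \<epsilon> * z) = std_normal_density z"
        using that by (simp add: normal_density_def real_sqrt_mult power_mult_distrib field_simps)
      then show "\<epsilon> *\<^sub>R (u (x + \<epsilon> * z) * complex_of_real (normal_density x \<epsilon> (x + \<epsilon> * z)))
          = u (x + \<epsilon> * z) * complex_of_real (std_normal_density z)"
        by (metis mult_scaleR_right of_real_mult scaleR_conv_of_real)
    qed
    finally show ?thesis .
  qed
  have "(\<lambda>n. LINT z|lborel. u (x + 1 / real (Suc n) * z) * complex_of_real (std_normal_density z))
     \<longlonglongrightarrow> (LINT z|lborel. u x * complex_of_real (std_normal_density z))"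
  proof (rule integral_dominated_convergence[where w="\<lambda>z. B * std_normal_density z"])
    have "(\<lambda>n. u (x + 1 / real (Suc n) * z)) \<longlonglongrightarrow> u x" for z
    proof -
      have "(\<lambda>n. x + 1 / real (Suc n) * z) \<longlonglongrightarrow> x + 0 * z"
        by (intro tendsto_intros LIMSEQ_Suc[OF lim_1_over_n])
      then show ?thesis
        using c by (auto simp: continuous_on_eq_continuous_at intro!: isCont_tendsto_compose[of _ u])
    qed
    then show "AE z in lborel. (\<lambda>n. u (x + 1 / real (Suc n) * z) * complex_of_real (std_normal_density z))
       \<longlonglongrightarrow> u x * complex_of_real (std_normal_density z)"
      by (intro AE_I2 tendsto_intros)
  qed (use B in \<open>auto simp: norm_mult intro!: mult_right_mono AE_I2\<close>)
  moreover have "(LINT z|lborel. u x * complex_of_real (std_normal_density z)) = u x"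
    by simp
  ultimately show ?thesis by (simp add: eq)
qed

section \<open>Square integrable functions\<close>

lemma borel_measurable_cnj [measurable]: "cnj \<in> borel_measurable borel"
  by (intro borel_measurable_continuous_onI continuous_intros)

text \<open>The squared norm as an extended real, so that Fatou's lemma, comparison and limits need
  no integrability side conditions. Integrating over \<open>lborel\<close> or
  \<open>lebesgue\<close> gives the same value.\<close>

definition energy :: "(real \<Rightarrow> complex) \<Rightarrow> ennreal" where
  "energy u = (\<integral>\<^sup>+x. ennreal ((cmod (u x))\<^sup>2) \<partial>lborel)"

lemma square_integrable_iff_energy:
  "square_integrable u \<longleftrightarrow> u \<in> borel_measurable lebesgue \<and> energy u < \<infinity>"
  unfolding square_integrable_def energy_def nn_integral_completion[of lborel, symmetric]
  by (auto simp: integrable_iff_bounded)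

lemma L2_norm_energy:
  assumes "u \<in> borel_measurable lebesgue"
  shows "L2_norm u = sqrt (enn2real (energy u))"
  unfolding L2_norm_def energy_def nn_integral_completion[of lborel, symmetric]
  using assms by (subst integral_eq_nn_integral) auto

text \<open>An energy tending to 0 is eventually finite, so square integrability of the differences
  only costs measurability. That is assumed eventually, because the truncated Riesz integrals are
  controlled only for \<epsilon> > 0.\<close>

lemma tendsto_L2_iff_energy:
  assumes "\<forall>\<^sub>F t in F. (\<lambda>x. f t x - g x) \<in> borel_measurable lebesgue"
  shows "tendsto_L2 f g F \<longleftrightarrow> ((\<lambda>t. energy (\<lambda>x. f t x - g x)) \<longlongrightarrow> 0) F"
proof
  assume *: "tendsto_L2 f g F"
  then have "((\<lambda>t. ennreal ((L2_norm (\<lambda>x. f t x - g x))\<^sup>2)) \<longlongrightarrow> ennreal (0\<^sup>2)) F"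
    unfolding tendsto_L2_def by (intro tendsto_intros) auto
  moreover from * have "\<forall>\<^sub>F t in F. ennreal ((L2_norm (\<lambda>x. f t x - g x))\<^sup>2) = energy (\<lambda>x. f t x - g x)"
    unfolding tendsto_L2_def square_integrable_iff_energy
    by (auto elim!: eventually_mono simp: L2_norm_energy real_sqrt_pow2 ennreal_enn2real)
  ultimately have "((\<lambda>t. energy (\<lambda>x. f t x - g x)) \<longlongrightarrow> ennreal (0\<^sup>2)) F"
    by (rule Lim_transform_eventually)
  then show "((\<lambda>t. energy (\<lambda>x. f t x - g x)) \<longlongrightarrow> 0) F"
    unfolding power_zero_numeral ennreal_0 .
next
  assume *: "((\<lambda>t. energy (\<lambda>x. f t x - g x)) \<longlongrightarrow> 0) F"
  have "\<forall>\<^sub>F t in F. energy (\<lambda>x. f t x - g x) < \<infinity>"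
    by (rule order_tendstoD(2)[OF *]) auto
  with assms have "\<forall>\<^sub>F t in F. square_integrable (\<lambda>x. f t x - g x)"
    by eventually_elim (simp add: square_integrable_iff_energy)
  moreover have "((\<lambda>t. sqrt (enn2real (energy (\<lambda>x. f t x - g x)))) \<longlongrightarrow> sqrt 0) F"
    by (intro tendsto_real_sqrt tendsto_enn2real) (use * in simp_all)
  moreover have "\<forall>\<^sub>F t in F. sqrt (enn2real (energy (\<lambda>x. f t x - g x))) = L2_norm (\<lambda>x. f t x - g x)"
    using assms by eventually_elim (simp add: L2_norm_energy)
  ultimately show "tendsto_L2 f g F"
    unfolding tendsto_L2_def using Lim_transform_eventually by fastforce
qed

lemma energy_mono: "(\<And>x. cmod (u x) \<le> cmod (w x)) \<Longrightarrow> energy u \<le> energy w"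
  unfolding energy_def by (intro nn_integral_mono ennreal_leI power_mono) auto

lemma norm_sum_sq_le: "(cmod (a + b))\<^sup>2 \<le> 2 * (cmod a)\<^sup>2 + 2 * (cmod b)\<^sup>2"
proof -
  have "(cmod (a + b))\<^sup>2 \<le> (cmod a + cmod b)\<^sup>2" by (intro power_mono norm_triangle_ineq) auto
  also have "\<dots> \<le> 2 * (cmod a)\<^sup>2 + 2 * (cmod b)\<^sup>2"
    using sum_squares_bound[of "cmod a" "cmod b"] by (simp add: power2_sum)
  finally show ?thesis .
qed

text \<open>For squared norms the triangle inequality holds up to a factor 2, the origin of the
  factors 2 and 4 below. They do no harm, since the estimates that use them only aim at finiteness
  or at a limit 0.\<close>

lemma energy_add_le:
  assumes [measurable]: "u \<in> borel_measurable lebesgue" "w \<in> borel_measurable lebesgue"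
  shows "energy (\<lambda>x. u x + w x) \<le> 2 * energy u + 2 * energy w"
proof -
  have "energy (\<lambda>x. u x + w x) \<le> (\<integral>\<^sup>+x. 2 * ennreal ((cmod (u x))\<^sup>2) + 2 * ennreal ((cmod (w x))\<^sup>2) \<partial>lebesgue)"
    unfolding energy_def nn_integral_completion[of lborel, symmetric]
    using norm_sum_sq_le
    by (intro nn_integral_mono) (simp flip: ennreal_plus ennreal_mult'' ennreal_numeral)
  also have "\<dots> = 2 * energy u + 2 * energy w"
    unfolding energy_def nn_integral_completion[of lborel, symmetric]
    by (subst nn_integral_add) (auto simp: nn_integral_cmult)
  finally show ?thesis .
qed

lemma energy_triangle:
  assumes [measurable]: "u \<in> borel_measurable lebesgue" "w \<in> borel_measurable lebesgue" "z \<in> borel_measurable lebesgue"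
  shows "energy (\<lambda>x. u x - w x) \<le> 2 * energy (\<lambda>x. u x - z x) + 2 * energy (\<lambda>x. z x - w x)"
  using energy_add_le[of "\<lambda>x. u x - z x" "\<lambda>x. z x - w x"] by simp

lemma energy_minus_commute: "energy (\<lambda>x. u x - w x) = energy (\<lambda>x. w x - u x)"
  unfolding energy_def by (simp add: norm_minus_commute)

lemma energy_reflect:
  assumes [measurable]: "u \<in> borel_measurable borel"
  shows "energy (\<lambda>x. u (- x)) = energy u"
  unfolding energy_def
  using nn_integral_real_affine[of "\<lambda>x. ennreal ((cmod (u x))\<^sup>2)" "-1" 0] by simp

lemma energy_lborel:
  assumes [measurable]: "u \<in> borel_measurable borel" and "energy u < \<infinity>"
  shows "integrable lborel (\<lambda>x. (cmod (u x))\<^sup>2)" "energy u = ennreal (LINT x|lborel. (cmod (u x))\<^sup>2)"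
proof -
  show *: "integrable lborel (\<lambda>x. (cmod (u x))\<^sup>2)"
    using assms(2) by (auto simp: integrable_iff_bounded energy_def)
  show "energy u = ennreal (LINT x|lborel. (cmod (u x))\<^sup>2)"
    unfolding energy_def using * by (intro nn_integral_eq_integral) auto
qed

lemma energy_finite_of_bounded:
  assumes "integrable lborel u" "\<And>x. cmod (u x) \<le> B"
  shows "energy u < \<infinity>"
proof -
  have [measurable]: "u \<in> borel_measurable borel" using assms(1) by auto
  have "0 \<le> B" using assms(2)[of undefined] norm_ge_zero order_trans by blast
  have "integrable lborel (\<lambda>x. cmod (u x) * B)" using assms(1) by simp
  then have "integrable lborel (\<lambda>x. (cmod (u x))\<^sup>2)"
    by (rule Bochner_Integration.integrable_bound)
      (use assms(2) \<open>0 \<le> B\<close> in \<open>auto simp: power2_eq_square intro!: mult_left_mono AE_I2\<close>)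
  then show ?thesis by (auto simp: integrable_iff_bounded energy_def)
qed

subsection \<open>Plancherel's identity and Fourier inversion\<close>

text \<open>The multiplication formula is applied to \<open>k\<close>, the Gaussian times the
  conjugate of \<open>fourier u\<close>: then \<open>fourier u * k\<close> is the damped square, and
  the transform of \<open>k\<close> is the conjugate of the Gaussian mean. The damping makes all
  integrals absolutely convergent for merely integrable \<open>u\<close>.\<close>

lemma gauss_energy:
  assumes u: "integrable lborel u" and \<epsilon>: "0 < \<epsilon>"
  shows "integrable lborel (\<lambda>v. (cmod (fourier u v))\<^sup>2 * gauss \<epsilon> v)"
    and "complex_of_real (LINT v|lborel. (cmod (fourier u v))\<^sup>2 * gauss \<epsilon> v)
       = (LINT x|lborel. u x * cnj (gauss_mean \<epsilon> u x))"
    and "integrable lborel (\<lambda>x. u x * cnj (gauss_mean \<epsilon> u x))"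
proof -
  have [measurable]: "u \<in> borel_measurable borel" "fourier u \<in> borel_measurable borel"
    using u borel_measurable_fourier[OF u] by auto
  obtain B where B: "0 < B" "\<And>v. cmod (fourier u v) \<le> B"
    using bcontfunE[OF bcontfun_fourier[OF u]] by metis
  define k where "k v = complex_of_real (gauss \<epsilon> v) * cnj (fourier u v)" for v
  have k: "integrable lborel k"
    unfolding k_def using integrable_gauss[OF \<epsilon>] B(2) by (intro integrable_mult_bounded[where B=B]) auto
  have "integrable lborel (\<lambda>v. Re (fourier u v * k v))"
    using integrable_mult_bounded[OF k _ B(2)] by (intro integrable_Re) (simp add: mult.commute)
  moreover have eq: "fourier u v * k v = complex_of_real ((cmod (fourier u v))\<^sup>2 * gauss \<epsilon> v)" for v
    unfolding k_def of_real_mult complex_norm_square by (simp add: mult_ac)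
  ultimately show "integrable lborel (\<lambda>v. (cmod (fourier u v))\<^sup>2 * gauss \<epsilon> v)" by simp
  have fk: "fourier k x = cnj (gauss_mean \<epsilon> u x)" for x
  proof -
    have m: "k \<in> borel_measurable borel" using k by auto
    have eq: "(\<lambda>v. k v * cis (- (v * x)))
        = (\<lambda>v. cnj (fourier u v * (complex_of_real (gauss \<epsilon> v) * cis (v * x))))"
      by (auto simp: k_def cis_cnj mult_ac)
    have "fourier k x = complex_of_real (1 / sqrt (2 * pi)) *
        cnj (LINT v|lborel. fourier u v * (complex_of_real (gauss \<epsilon> v) * cis (v * x)))"
      unfolding fourier_lborel[OF m] eq Bochner_Integration.integral_cnj ..
    then show ?thesis
      unfolding gauss_summation[OF u \<epsilon>] by simp
  qed
  have "complex_of_real (LINT v|lborel. (cmod (fourier u v))\<^sup>2 * gauss \<epsilon> v) = (LINT v|lborel. fourier u v * k v)"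
    unfolding eq by (rule integral_complex_of_real[symmetric])
  also have "\<dots> = (LINT x|lborel. u x * cnj (gauss_mean \<epsilon> u x))"
    using fourier_multiplication[OF u k] by (simp add: fk)
  finally show "complex_of_real (LINT v|lborel. (cmod (fourier u v))\<^sup>2 * gauss \<epsilon> v)
       = (LINT x|lborel. u x * cnj (gauss_mean \<epsilon> u x))" .
  obtain B' where B': "\<And>v. cmod (fourier k v) \<le> B'"
    using bcontfunE[OF bcontfun_fourier[OF k]] by metis
  show "integrable lborel (\<lambda>x. u x * cnj (gauss_mean \<epsilon> u x))"
    using integrable_mult_bounded[OF u borel_measurable_fourier[OF k] B'] unfolding fk .
qed

lemma nn_integral_normal_density: "0 < \<epsilon> \<Longrightarrow> (\<integral>\<^sup>+y. ennreal (normal_density x \<epsilon> y) \<partial>lborel) = 1"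
  by (subst nn_integral_eq_integral) auto

text \<open>Averaging against a symmetric kernel of mass 1 is a contraction: bound the product of
  \<open>cmod (u x)\<close> and \<open>cmod (u y)\<close> by half the sum of their squares; by
  symmetry of the density both halves contribute equally. Neither boundedness nor finite energy of
  \<open>u\<close> is involved.\<close>

lemma gauss_energy_le:
  assumes u: "integrable lborel u" and \<epsilon>: "0 < \<epsilon>"
  shows "(\<integral>\<^sup>+v. ennreal ((cmod (fourier u v))\<^sup>2 * gauss \<epsilon> v) \<partial>lborel) \<le> energy u"
proof -
  have [measurable]: "u \<in> borel_measurable borel" using u by auto
  let ?n = "\<lambda>x y. ennreal (normal_density x \<epsilon> y)" and ?s = "\<lambda>x. ennreal ((cmod (u x))\<^sup>2 / 2)"
  have nd[measurable]: "(\<lambda>(x, y). normal_density x \<epsilon> y) \<in> borel_measurable (lborel \<Otimes>\<^sub>M lborel)"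
    unfolding normal_density_def by measurable
  have "(\<integral>\<^sup>+v. ennreal ((cmod (fourier u v))\<^sup>2 * gauss \<epsilon> v) \<partial>lborel)
      = ennreal (LINT v|lborel. (cmod (fourier u v))\<^sup>2 * gauss \<epsilon> v)"
    by (intro nn_integral_eq_integral gauss_energy assms) (simp add: gauss_pos less_imp_le)
  also have "\<dots> \<le> ennreal (cmod (LINT x|lborel. u x * cnj (gauss_mean \<epsilon> u x)))"
    unfolding gauss_energy(2)[OF assms, symmetric] by (intro ennreal_leI) simp
  also have "\<dots> \<le> (\<integral>\<^sup>+x. ennreal (cmod (u x * cnj (gauss_mean \<epsilon> u x))) \<partial>lborel)"
    by (intro integral_norm_bound_ennreal gauss_energy assms)
  also have "\<dots> \<le> (\<integral>\<^sup>+x. \<integral>\<^sup>+y. ?s x * ?n x y + ?s y * ?n x y \<partial>lborel \<partial>lborel)"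
  proof (intro nn_integral_mono)
    fix x
    have "ennreal (cmod (gauss_mean \<epsilon> u x)) \<le> (\<integral>\<^sup>+y. ennreal (cmod (u y) * normal_density x \<epsilon> y) \<partial>lborel)"
    \<comment> \<open>Without integrability the mean is 0, the default value of the integral, and
      the bound is trivial.\<close>
    proof (cases "integrable lborel (\<lambda>y. u y * complex_of_real (normal_density x \<epsilon> y))")
      case True
      then show ?thesis
        unfolding gauss_mean_def by (rule integral_norm_bound_ennreal[THEN order_trans]) (simp add: norm_mult)
    qed (auto simp: gauss_mean_def not_integrable_integral_eq)
    then have "ennreal (cmod (u x * cnj (gauss_mean \<epsilon> u x)))
        \<le> ennreal (cmod (u x)) * (\<integral>\<^sup>+y. ennreal (cmod (u y) * normal_density x \<epsilon> y) \<partial>lborel)"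
      by (auto simp: norm_mult ennreal_mult intro!: mult_left_mono)
    also have "\<dots> = (\<integral>\<^sup>+y. ennreal (cmod (u x) * cmod (u y) * normal_density x \<epsilon> y) \<partial>lborel)"
      by (subst nn_integral_cmult[symmetric]) (auto simp: ennreal_mult mult.assoc)
    also have "\<dots> \<le> (\<integral>\<^sup>+y. ?s x * ?n x y + ?s y * ?n x y \<partial>lborel)"
    proof (intro nn_integral_mono)
      fix y
      have "cmod (u x) * cmod (u y) * normal_density x \<epsilon> y
          \<le> ((cmod (u x))\<^sup>2 / 2 + (cmod (u y))\<^sup>2 / 2) * normal_density x \<epsilon> y"
        using sum_squares_bound[of "cmod (u x)" "cmod (u y)"] by (intro mult_right_mono) auto
      then show "ennreal (cmod (u x) * cmod (u y) * normal_density x \<epsilon> y) \<le> ?s x * ?n x y + ?s y * ?n x y"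
        by (simp add: ennreal_mult[symmetric] ennreal_plus[symmetric] distrib_right del: ennreal_plus)
    qed
    finally show "ennreal (cmod (u x * cnj (gauss_mean \<epsilon> u x))) \<le> \<dots>" .
  qed
  also have "\<dots> = (\<integral>\<^sup>+x. \<integral>\<^sup>+y. ?s x * ?n x y \<partial>lborel \<partial>lborel) + (\<integral>\<^sup>+x. \<integral>\<^sup>+y. ?s y * ?n x y \<partial>lborel \<partial>lborel)"
    by (subst nn_integral_add[symmetric]) (auto intro!: nn_integral_cong nn_integral_add)
  also have "(\<integral>\<^sup>+x. \<integral>\<^sup>+y. ?s y * ?n x y \<partial>lborel \<partial>lborel) = (\<integral>\<^sup>+y. \<integral>\<^sup>+x. ?s y * ?n x y \<partial>lborel \<partial>lborel)"
    by (rule lborel_pair.Fubini') measurable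
  also have "\<dots> = (\<integral>\<^sup>+x. \<integral>\<^sup>+y. ?s x * ?n x y \<partial>lborel \<partial>lborel)"
    by (simp add: normal_density_sym)
  also have "(\<integral>\<^sup>+x. \<integral>\<^sup>+y. ?s x * ?n x y \<partial>lborel \<partial>lborel) = (\<integral>\<^sup>+x. ?s x \<partial>lborel)"
    using \<epsilon> by (simp add: nn_integral_cmult nn_integral_normal_density)
  also have "(\<integral>\<^sup>+x. ?s x \<partial>lborel) + (\<integral>\<^sup>+x. ?s x \<partial>lborel) = energy u"
    unfolding energy_def by (subst nn_integral_add[symmetric]) (auto simp: ennreal_plus[symmetric] simp del: ennreal_plus)
  finally show ?thesis .
qed

text \<open>Fatou's lemma removes the damping. This half of Plancherel's identity holds for
  discontinuous \<open>u\<close> too, which matters for truncations.\<close>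

lemma energy_fourier_le:
  assumes u: "integrable lborel u"
  shows "energy (fourier u) \<le> energy u"
proof -
  have [measurable]: "fourier u \<in> borel_measurable borel" using borel_measurable_fourier[OF u] .
  let ?g = "\<lambda>n v. ennreal ((cmod (fourier u v))\<^sup>2 * gauss (1 / real (Suc n)) v)"
  have lim: "(\<lambda>n. ?g n v) \<longlonglongrightarrow> ennreal ((cmod (fourier u v))\<^sup>2 * 1)" for v
    by (intro tendsto_intros gauss_tendsto)
  have "energy (fourier u) = (\<integral>\<^sup>+v. liminf (\<lambda>n. ?g n v) \<partial>lborel)"
    unfolding energy_def using lim_imp_Liminf[OF sequentially_bot lim] by simp
  also have "\<dots> \<le> liminf (\<lambda>n. \<integral>\<^sup>+v. ?g n v \<partial>lborel)"
    by (rule nn_integral_liminf) measurable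
  also have "\<dots> \<le> limsup (\<lambda>n. \<integral>\<^sup>+v. ?g n v \<partial>lborel)"
    by (rule Liminf_le_Limsup) auto
  also have "\<dots> \<le> energy u"
    using gauss_energy_le[OF u] by (intro Limsup_bounded always_eventually) auto
  finally show ?thesis .
qed

text \<open>For the missing inequality the damped energies are computed on the other side: Gaussian
  means of a function bounded by \<open>B\<close> are again bounded by \<open>B\<close>, so
  \<open>cmod (u x) * B\<close> dominates, and continuity identifies the limit as the energy of
  \<open>u\<close>. The damping factor is at most 1, so the damped energies stay below that of the
  transform.\<close>

lemma energy_fourier:
  assumes u: "integrable lborel u" and bc: "u \<in> bcontfun"
  shows "energy (fourier u) = energy u"
proof (rule antisym[OF energy_fourier_le[OF u]])
  have [measurable]: "u \<in> borel_measurable borel" using u by auto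
  obtain B where B: "0 < B" "\<And>v. cmod (u v) \<le> B" using bcontfunE[OF bc] by metis
  have fin: "energy u < \<infinity>" using energy_finite_of_bounded[OF u B(2)] .
  let ?e = "\<lambda>n. 1 / real (Suc n)"
  have gm: "cmod (gauss_mean \<epsilon> u x) \<le> B" if "0 < \<epsilon>" for \<epsilon> x
  proof -
    have "cmod (gauss_mean \<epsilon> u x) \<le> (LINT y|lborel. cmod (u y * complex_of_real (normal_density x \<epsilon> y)))"
      unfolding gauss_mean_def by (rule integral_norm_bound)
    also have "\<dots> \<le> (LINT y|lborel. B * normal_density x \<epsilon> y)"
    proof (rule integral_mono)
      show "integrable lborel (\<lambda>y. cmod (u y * complex_of_real (normal_density x \<epsilon> y)))"
        using that by (intro integrable_norm, subst mult.commute) (intro integrable_mult_bounded[OF _ _ B(2)], auto)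
    qed (use B that in \<open>auto simp: norm_mult intro!: mult_right_mono\<close>)
    also have "\<dots> = B" using that by simp
    finally show ?thesis .
  qed
  have "(\<lambda>n. LINT x|lborel. u x * cnj (gauss_mean (?e n) u x)) \<longlonglongrightarrow> (LINT x|lborel. u x * cnj (u x))"
  proof (rule integral_dominated_convergence[where w="\<lambda>x. cmod (u x) * B"])
    show "(\<lambda>x. u x * cnj (gauss_mean (?e n) u x)) \<in> borel_measurable lborel" for n
      using gauss_energy(3)[OF u, of "?e n"] by auto
    show "AE x in lborel. (\<lambda>n. u x * cnj (gauss_mean (?e n) u x)) \<longlonglongrightarrow> u x * cnj (u x)"
      by (intro AE_I2 tendsto_intros gauss_mean_tendsto bc)
  qed (use u gm in \<open>auto simp: norm_mult intro!: mult_left_mono AE_I2\<close>)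
  also have "(LINT x|lborel. u x * cnj (u x)) = complex_of_real (LINT x|lborel. (cmod (u x))\<^sup>2)"
    unfolding complex_norm_square[symmetric] by (rule integral_complex_of_real)
  finally have "(\<lambda>n. LINT v|lborel. (cmod (fourier u v))\<^sup>2 * gauss (?e n) v) \<longlonglongrightarrow> (LINT x|lborel. (cmod (u x))\<^sup>2)"
    by (subst (asm) gauss_energy(2)[OF u, symmetric]) (auto simp: tendsto_of_real_iff)
  then have "(\<lambda>n. ennreal (LINT v|lborel. (cmod (fourier u v))\<^sup>2 * gauss (?e n) v)) \<longlonglongrightarrow> energy u"
    using energy_lborel[OF _ fin] by (auto intro: tendsto_ennrealI)
  then show "energy u \<le> energy (fourier u)"
  proof (rule LIMSEQ_le_const2, intro exI allI impI)
    fix n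
    have "ennreal (LINT v|lborel. (cmod (fourier u v))\<^sup>2 * gauss (?e n) v)
       = (\<integral>\<^sup>+v. ennreal ((cmod (fourier u v))\<^sup>2 * gauss (?e n) v) \<partial>lborel)"
      by (intro nn_integral_eq_integral[symmetric] gauss_energy u) (simp_all add: gauss_pos less_imp_le)
    also have "\<dots> \<le> energy (fourier u)"
      unfolding energy_def using gauss_le_1
      by (intro nn_integral_mono ennreal_leI) (auto intro: mult_left_le)
    finally show "ennreal (LINT v|lborel. (cmod (fourier u v))\<^sup>2 * gauss (?e n) v) \<le> energy (fourier u)" .
  qed
qed

definition ifourier :: "(real \<Rightarrow> complex) \<Rightarrow> real \<Rightarrow> complex" where
  "ifourier F x = fourier F (- x)"

lemma ifourier_lborel:
  assumes "F \<in> borel_measurable borel"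
  shows "ifourier F x = complex_of_real (1 / sqrt (2 * pi)) * (LINT v|lborel. F v * cis (v * x))"
  unfolding ifourier_def fourier_lborel[OF assms] by simp

lemma bcontfun_ifourier:
  assumes "integrable lborel f"
  shows "ifourier f \<in> bcontfun"
proof -
  obtain B where B: "\<And>v. cmod (fourier f v) \<le> B" using bcontfunE[OF bcontfun_fourier[OF assms]] by metis
  have "continuous_on UNIV (\<lambda>x. fourier f (- x))"
    by (rule continuous_on_compose2[OF continuous_fourier[OF assms]]) (auto intro: continuous_intros)
  then show ?thesis unfolding ifourier_def[abs_def] using B by (intro bcontfun_normI) auto
qed

lemma borel_measurable_ifourier [measurable_dest]:
  "integrable lborel f \<Longrightarrow> ifourier f \<in> borel_measurable borel"
  by (intro bcontfun_borel bcontfun_ifourier)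

lemma energy_ifourier:
  assumes "integrable lborel u" "u \<in> bcontfun"
  shows "energy (ifourier u) = energy u"
  unfolding ifourier_def[abs_def] using energy_reflect[OF borel_measurable_fourier] energy_fourier assms by metis

lemma fourier_diff:
  assumes "integrable lborel u" "integrable lborel w"
  shows "fourier (\<lambda>x. u x - w x) v = fourier u v - fourier w v"
proof -
  have [measurable]: "u \<in> borel_measurable borel" "w \<in> borel_measurable borel" using assms by auto
  have "(LINT x|lborel. (u x - w x) * cis (- (x * v)))
     = (LINT x|lborel. u x * cis (- (x * v))) - (LINT x|lborel. w x * cis (- (x * v)))"
    using integrable_mult_cis[OF assms(1), of "\<lambda>x. - (x * v)"] integrable_mult_cis[OF assms(2), of "\<lambda>x. - (x * v)"]
    by (subst Bochner_Integration.integral_diff[symmetric]) (auto simp: left_diff_distrib)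
  then show ?thesis by (simp add: fourier_lborel right_diff_distrib)
qed

lemma energy_ifourier_diff:
  assumes "integrable lborel u" "u \<in> bcontfun" "integrable lborel w" "w \<in> bcontfun"
  shows "energy (\<lambda>x. ifourier u x - ifourier w x) = energy (\<lambda>v. u v - w v)"
proof -
  have "(\<lambda>v. u v - w v) \<in> bcontfun" using minus_cont[OF assms(2,4)] by (simp add: fun_diff_def)
  from energy_ifourier[OF _ this] show ?thesis
    using assms(1,3) by (simp add: ifourier_def[abs_def] fourier_diff)
qed

text \<open>The damped inversion integral has two limits: the full integral, by domination with
  \<open>fourier u\<close>, and the value of \<open>u\<close> at \<open>x\<close>, by Gaussian
  summation.\<close>

theorem fourier_inversion:
  assumes u: "integrable lborel u" "u \<in> bcontfun" and F: "integrable lborel (fourier u)"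
  shows "ifourier (fourier u) = u"
proof
  fix x
  let ?e = "\<lambda>n. 1 / real (Suc n)"
  have [measurable]: "fourier u \<in> borel_measurable borel" using F by auto
  have "(\<lambda>n. LINT v|lborel. fourier u v * (complex_of_real (gauss (?e n) v) * cis (v * x)))
      \<longlonglongrightarrow> (LINT v|lborel. fourier u v * (complex_of_real 1 * cis (v * x)))"
    by (rule integral_dominated_convergence[where w="\<lambda>v. cmod (fourier u v)"])
      (use F gauss_pos gauss_le_1 in \<open>auto simp: norm_mult abs_of_pos simp del: of_nat_Suc of_real_1
      intro!: AE_I2 tendsto_intros gauss_tendsto mult_left_le\<close>)
  also have "(\<lambda>n. LINT v|lborel. fourier u v * (complex_of_real (gauss (?e n) v) * cis (v * x)))
     = (\<lambda>n. complex_of_real (sqrt (2 * pi)) * gauss_mean (?e n) u x)"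
    by (intro ext gauss_summation u) auto
  finally have "(LINT v|lborel. fourier u v * (complex_of_real 1 * cis (v * x))) = complex_of_real (sqrt (2 * pi)) * u x"
    by (rule LIMSEQ_unique) (intro tendsto_intros gauss_mean_tendsto u)
  then show "ifourier (fourier u) x = u x"
    by (subst ifourier_lborel) auto
qed

subsection \<open>Fourier inversion in the mean\<close>

lemma borel_imp_lebesgue: "f \<in> borel_measurable borel \<Longrightarrow> f \<in> borel_measurable lebesgue"
  by (intro measurable_completion) simp

lemma energy_diff:
  assumes [measurable]: "a \<in> borel_measurable borel" "b \<in> borel_measurable borel"
    and fin: "energy a < \<infinity>" "energy b < \<infinity>" and ab: "integrable lborel (\<lambda>x. a x * cnj (b x))"
  shows "energy (\<lambda>x. a x - b x) = ennreal ((LINT x|lborel. (cmod (a x))\<^sup>2) + (LINT x|lborel. (cmod (b x))\<^sup>2)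
      - 2 * Re (LINT x|lborel. a x * cnj (b x)))"
proof -
  have eq: "(cmod (x - y))\<^sup>2 = (cmod x)\<^sup>2 + (cmod y)\<^sup>2 - 2 * Re (x * cnj y)" for x y
    by (simp add: cmod_power2 power2_diff algebra_simps)
  note i = energy_lborel(1)[OF _ fin(1)] energy_lborel(1)[OF _ fin(2)] integrable_Re[OF ab]
  have "integrable lborel (\<lambda>x. (cmod (a x - b x))\<^sup>2)"
    unfolding eq by (intro Bochner_Integration.integrable_diff Bochner_Integration.integrable_add integrable_mult_right i) auto
  then have "energy (\<lambda>x. a x - b x) = ennreal (LINT x|lborel. (cmod (a x - b x))\<^sup>2)"
    unfolding energy_def by (intro nn_integral_eq_integral) auto
  also have "(LINT x|lborel. (cmod (a x - b x))\<^sup>2) = (LINT x|lborel. (cmod (a x))\<^sup>2) + (LINT x|lborel. (cmod (b x))\<^sup>2)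
      - 2 * Re (LINT x|lborel. a x * cnj (b x))"
    unfolding eq integral_Re[OF ab, symmetric] using i by (simp del: Re_complex_of_real complex_mult_cnj times_complex.sel)
  finally show ?thesis .
qed

text \<open>Expanding the squares, this reduces to Plancherel's identity for \<open>K\<close>, the inequality
  \<open>energy_fourier_le\<close> for \<open>u\<close> and the multiplication formula.\<close>

lemma energy_fourier_diff_le:
  assumes u: "integrable lborel u" "energy u < \<infinity>" and K: "integrable lborel K" "K \<in> bcontfun"
  shows "energy (\<lambda>v. fourier u v - K v) \<le> energy (\<lambda>x. u x - ifourier K x)"
proof -
  have [measurable]: "u \<in> borel_measurable borel" "K \<in> borel_measurable borel"
    "fourier u \<in> borel_measurable borel" "ifourier K \<in> borel_measurable borel"
    using u K borel_measurable_fourier[OF u(1)] borel_measurable_ifourier[OF K(1)] by auto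
  obtain B1 where B1: "\<And>v. cmod (fourier u v) \<le> B1"
    using bcontfunE[OF bcontfun_fourier[OF u(1)]] by metis
  obtain B2 where B2: "\<And>v. cmod (ifourier K v) \<le> B2"
    using bcontfunE[OF bcontfun_ifourier[OF K(1)]] by metis
  obtain B3 where B3: "\<And>v. cmod (K v) \<le> B3"
    using bcontfunE[OF K(2)] by metis
  have finK: "energy K < \<infinity>" using energy_finite_of_bounded[OF K(1) B3] .
  have eqK: "energy (ifourier K) = energy K" by (rule energy_ifourier[OF K])
  have leu: "energy (fourier u) \<le> energy u" by (rule energy_fourier_le[OF u(1)])
  have i1: "integrable lborel (\<lambda>v. fourier u v * cnj (K v))"
    using K(1) B1 by (subst mult.commute) (intro integrable_mult_bounded[where B=B1], auto)
  have i2: "integrable lborel (\<lambda>x. u x * cnj (ifourier K x))"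
    using u(1) B2 by (intro integrable_mult_bounded[where B=B2]) auto
  have cnjK: "fourier (\<lambda>v. cnj (K v)) x = cnj (ifourier K x)" for x
  proof -
    have m: "(\<lambda>v. cnj (K v)) \<in> borel_measurable borel" by measurable
    have eq: "(\<lambda>v. cnj (K v) * cis (- (v * x))) = (\<lambda>v. cnj (K v * cis (v * x)))"
      by (auto simp: cis_cnj)
    show ?thesis unfolding fourier_lborel[OF m] eq Bochner_Integration.integral_cnj by (subst ifourier_lborel) auto
  qed
  have cross: "(LINT v|lborel. fourier u v * cnj (K v)) = (LINT x|lborel. u x * cnj (ifourier K x))"
    using fourier_multiplication[OF u(1), of "\<lambda>v. cnj (K v)"] K(1) by (simp add: cnjK)
  have "(LINT x|lborel. (cmod (fourier u x))\<^sup>2) \<le> (LINT x|lborel. (cmod (u x))\<^sup>2)"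
    using leu energy_lborel(2)[of u] energy_lborel(2)[OF _ order_le_less_trans[OF leu u(2)]] u(2)
    by (simp add: ennreal_le_iff)
  moreover have "(LINT x|lborel. (cmod (ifourier K x))\<^sup>2) = (LINT x|lborel. (cmod (K x))\<^sup>2)"
    using eqK finK energy_lborel(2)[of K] energy_lborel(2)[of "ifourier K"] by simp
  ultimately show ?thesis
    using leu u(2) eqK finK
    by (subst (1 2) energy_diff) (auto intro!: ennreal_leI simp: i1 i2 cross)
qed

section \<open>Completeness in the mean-square sense\<close>

lemma AE_tendsto_of_energy:
  assumes [measurable]: "\<And>k. X k \<in> borel_measurable borel" and "\<And>k. energy (X k) \<le> ennreal (C / 4 ^ k)" "0 \<le> C"
  shows "AE x in lborel. \<exists>D. \<forall>k. (cmod (X k x))\<^sup>2 \<le> D / 2 ^ k"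
proof -
  \<comment> \<open>Decay 4^(-k) of the energies leaves a factor 2^k to spare: the weighted series
    has a finite integral, hence is finite almost everywhere, and its value at \<open>x\<close> is
    the constant \<open>D\<close>.\<close>
  have "(\<integral>\<^sup>+x. (\<Sum>k. ennreal (2 ^ k * (cmod (X k x))\<^sup>2)) \<partial>lborel) = (\<Sum>k. (\<integral>\<^sup>+x. ennreal (2 ^ k * (cmod (X k x))\<^sup>2) \<partial>lborel))"
    by (rule nn_integral_suminf) measurable
  also have "\<dots> = (\<Sum>k. ennreal (2 ^ k) * energy (X k))"
    unfolding energy_def by (simp add: ennreal_mult nn_integral_cmult)
  also have "\<dots> \<le> (\<Sum>k. ennreal (C * (1 / 2) ^ k))"
  proof (rule suminf_le[OF _ summableI summableI])
    fix k
    have "ennreal (2 ^ k) * energy (X k) \<le> ennreal (2 ^ k) * ennreal (C / 4 ^ k)"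
      by (intro mult_left_mono assms) auto
    also have "\<dots> = ennreal (2 ^ k * (C / 4 ^ k))" by (rule ennreal_mult'[symmetric]) simp
    also have "2 ^ k * (C / 4 ^ k) = C * (1 / 2) ^ k"
    proof -
      have "(4::real) ^ k = 2 ^ k * 2 ^ k" by (simp flip: power_mult_distrib)
      then show ?thesis by (simp add: power_one_over)
    qed
    finally show "ennreal (2 ^ k) * energy (X k) \<le> ennreal (C * (1 / 2) ^ k)" .
  qed
  also have "\<dots> < \<infinity>"
    using assms(3) by (subst suminf_ennreal2) (auto intro: summable_mult summable_geometric)
  finally have "AE x in lborel. (\<Sum>k. ennreal (2 ^ k * (cmod (X k x))\<^sup>2)) \<noteq> \<infinity>"
    by (intro nn_integral_PInf_AE) auto
  then show ?thesis
  proof eventually_elim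
    case (elim x)
    define S where "S = (\<Sum>k. ennreal (2 ^ k * (cmod (X k x))\<^sup>2))"
    have "S \<noteq> \<infinity>" using elim by (simp only: S_def not_False_eq_True)
    then obtain D where "0 \<le> D" "S = ennreal D" by (cases S) auto
    note D = this[unfolded S_def]
    have "(cmod (X k x))\<^sup>2 \<le> D / 2 ^ k" for k
    proof -
      have "(\<Sum>i\<in>{k}. ennreal (2 ^ i * (cmod (X i x))\<^sup>2)) \<le> (\<Sum>i. ennreal (2 ^ i * (cmod (X i x))\<^sup>2))"
        by (rule sum_le_suminf) auto
      then have "ennreal (2 ^ k * (cmod (X k x))\<^sup>2) \<le> ennreal D"
        unfolding D(2) by (simp only: sum.insert finite.emptyI empty_iff not_False_eq_True sum.empty add_0_right)
      then have "2 ^ k * (cmod (X k x))\<^sup>2 \<le> D" using D(1) by (simp only: ennreal_le_iff)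
      then show ?thesis by (simp add: pos_le_divide_eq mult.commute)
    qed
    then show ?case by blast
  qed
qed

lemma energy_subseq:
  assumes "e \<longlonglongrightarrow> (0::ennreal)"
  obtains r :: "nat \<Rightarrow> nat" where "strict_mono r" "\<And>k n. r k \<le> n \<Longrightarrow> e n \<le> ennreal (1 / 4 ^ k)"
proof -
  have "\<exists>N. \<forall>n\<ge>N. e n \<le> ennreal (1 / 4 ^ k)" for k :: nat
    using order_tendstoD(2)[OF assms, of "ennreal (1 / 4 ^ k)"]
    by (auto simp: eventually_sequentially ennreal_zero_less_divide intro: less_imp_le)
  then obtain N where N: "\<And>k n. N k \<le> n \<Longrightarrow> e n \<le> ennreal (1 / 4 ^ k)" by metis
  \<comment> \<open>Summing the thresholds makes \<open>r\<close> strictly increasing and keeps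
    \<open>r k\<close> above \<open>N k\<close>.\<close>
  define r where "r k = (\<Sum>i\<le>k. Suc (N i))" for k
  have "strict_mono r" unfolding strict_mono_Suc_iff r_def by simp
  moreover have "N k \<le> r k" for k
    unfolding r_def using member_le_sum[of k "{..k}" "\<lambda>i. Suc (N i)"] by simp
  ultimately show ?thesis using that[of r] N order_trans by blast
qed

text \<open>Riesz-Fischer. The Cauchy condition is phrased with a null sequence \<open>e\<close>, as
  it arises when \<open>X n\<close> and \<open>X m\<close> are compared through a common limit;
  Fatou's lemma along a fast subsequence then bounds the error of \<open>X n\<close> by
  \<open>e n\<close> itself.\<close>

theorem energy_complete:
  assumes [measurable]: "\<And>n. X n \<in> borel_measurable borel"
    and cauchy: "\<And>n m. energy (\<lambda>x. X n x - X m x) \<le> e n + e m" and e: "e \<longlonglongrightarrow> 0"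
  obtains Y where "Y \<in> borel_measurable borel" "(\<lambda>n. energy (\<lambda>x. X n x - Y x)) \<longlonglongrightarrow> 0"
proof -
  obtain r :: "nat \<Rightarrow> nat" where r: "strict_mono r" "\<And>k n. r k \<le> n \<Longrightarrow> e n \<le> ennreal (1 / 4 ^ k)"
    using energy_subseq[OF e] by metis
  define Y where "Y x = lim (\<lambda>k. X (r k) x)" for x
  have [measurable]: "Y \<in> borel_measurable borel"
    unfolding Y_def[abs_def] by (rule borel_measurable_lim_metric) measurable
  have le: "energy (\<lambda>x. X (r (Suc k)) x - X (r k) x) \<le> ennreal (2 / 4 ^ k)" for k
  proof -
    have "energy (\<lambda>x. X (r (Suc k)) x - X (r k) x) \<le> e (r (Suc k)) + e (r k)" by (rule cauchy)
    also have "\<dots> \<le> ennreal (1 / 4 ^ k) + ennreal (1 / 4 ^ k)"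
      using r(1) by (intro add_mono r(2)) (auto simp: strict_mono_less_eq)
    finally show ?thesis by (simp flip: ennreal_plus)
  qed
  have "AE x in lborel. \<exists>D. \<forall>k. (cmod (X (r (Suc k)) x - X (r k) x))\<^sup>2 \<le> D / 2 ^ k"
    by (rule AE_tendsto_of_energy[OF _ le]) auto
  then have conv: "AE x in lborel. (\<lambda>k. X (r k) x) \<longlonglongrightarrow> Y x"
  proof eventually_elim
    case (elim x)
    then obtain D where D: "\<And>k. (cmod (X (r (Suc k)) x - X (r k) x))\<^sup>2 \<le> D / 2 ^ k" by auto
    \<comment> \<open>Increments bounded by a geometric series of ratio 1/\<surd>2 telescope to a
      convergent sequence.\<close>
    have le: "cmod (X (r (Suc k)) x - X (r k) x) \<le> sqrt D * (1 / sqrt 2) ^ k" for k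
      using real_le_rsqrt[OF D[of k]] by (simp add: real_sqrt_divide real_sqrt_power power_divide)
    have "summable (\<lambda>k. sqrt D * (1 / sqrt 2) ^ k)"
      by (intro summable_mult summable_geometric) (auto simp: real_less_rsqrt)
    then have "summable (\<lambda>k. X (r (Suc k)) x - X (r k) x)"
      using le by (rule summable_comparison_test')
    then have "convergent (\<lambda>n. \<Sum>k<n. X (r (Suc k)) x - X (r k) x)"
      by (simp add: summable_iff_convergent)
    then have "convergent (\<lambda>n. X (r n) x - X (r 0) x)"
      by (simp only: sum_lessThan_telescope[where f="\<lambda>k. X (r k) x"])
    then have "convergent (\<lambda>n. X (r n) x)"
      using convergent_add[OF _ convergent_const[of "X (r 0) x"], of "\<lambda>n. X (r n) x - X (r 0) x"] by simp
    then show ?case unfolding Y_def by (simp add: convergent_LIMSEQ_iff)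
  qed
  have "energy (\<lambda>x. X n x - Y x) \<le> e n" for n
  proof -
    have "energy (\<lambda>x. X n x - Y x) = (\<integral>\<^sup>+x. liminf (\<lambda>k. ennreal ((cmod (X n x - X (r k) x))\<^sup>2)) \<partial>lborel)"
      unfolding energy_def
    proof (intro nn_integral_cong_AE)
      show "AE x in lborel. ennreal ((cmod (X n x - Y x))\<^sup>2) = liminf (\<lambda>k. ennreal ((cmod (X n x - X (r k) x))\<^sup>2))"
        using conv
      proof eventually_elim
        case (elim x)
        have "(\<lambda>k. ennreal ((cmod (X n x - X (r k) x))\<^sup>2)) \<longlonglongrightarrow> ennreal ((cmod (X n x - Y x))\<^sup>2)"
          by (intro tendsto_intros elim)
        then show ?case by (rule lim_imp_Liminf[OF sequentially_bot, symmetric])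
      qed
    qed
    also have "\<dots> \<le> liminf (\<lambda>k. energy (\<lambda>x. X n x - X (r k) x))"
      unfolding energy_def by (rule nn_integral_liminf) measurable
    also have "\<dots> \<le> liminf (\<lambda>k. e n + e (r k))"
      by (intro Liminf_mono always_eventually allI cauchy)
    also have "\<dots> = e n + 0"
      by (intro lim_imp_Liminf tendsto_intros LIMSEQ_subseq_LIMSEQ[OF e r(1), unfolded o_def]) auto
    finally show ?thesis by simp
  qed
  then have "(\<lambda>n. energy (\<lambda>x. X n x - Y x)) \<longlonglongrightarrow> 0"
    using e by (intro tendsto_sandwich[OF _ _ tendsto_const e]) auto
  then show ?thesis using that[of Y] by simp
qed

text \<open>The index is shifted so that the width parameter 1/(n+1) is positive for every
  \<open>n\<close>. A sharp cutoff would also make a bounded \<open>H\<close> integrable, but would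
  in general destroy the continuity that \<open>energy_fourier\<close> requires.\<close>

definition gauss_cutoff :: "(real \<Rightarrow> complex) \<Rightarrow> nat \<Rightarrow> real \<Rightarrow> complex" where
  "gauss_cutoff H n v = complex_of_real (gauss (1 / real (Suc n)) v) * H v"

lemma norm_gauss_cutoff_le: "cmod (gauss_cutoff H n v) \<le> cmod (H v)"
  unfolding gauss_cutoff_def using gauss_pos[of "1 / real (Suc n)" v] gauss_le_1[of "1 / real (Suc n)" v]
  by (auto simp: norm_mult intro!: mult_left_le_one_le)

lemma gauss_cutoff_tendsto: "(\<lambda>n. gauss_cutoff H n v) \<longlonglongrightarrow> H v"
proof -
  have "(\<lambda>n. gauss_cutoff H n v) \<longlonglongrightarrow> complex_of_real 1 * H v"
    unfolding gauss_cutoff_def by (intro tendsto_intros gauss_tendsto)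
  then show ?thesis by simp
qed

lemma gauss_cutoff_measurable [measurable]:
  assumes [measurable]: "H \<in> borel_measurable borel"
  shows "gauss_cutoff H n \<in> borel_measurable borel"
  unfolding gauss_cutoff_def[abs_def] by measurable

lemma gauss_cutoff_bcontfun:
  assumes "H \<in> bcontfun"
  shows "gauss_cutoff H n \<in> bcontfun"
proof -
  obtain B where B: "\<And>v. cmod (H v) \<le> B" using bcontfunE[OF assms] by metis
  have "continuous_on UNIV (gauss_cutoff H n)"
    unfolding gauss_cutoff_def[abs_def] using assms continuous_gauss by (intro continuous_intros) (auto simp: bcontfun_def)
  then show ?thesis using B norm_gauss_cutoff_le order_trans by (intro bcontfun_normI) blast+
qed

lemma integrable_gauss_cutoff:
  assumes "H \<in> bcontfun"
  shows "integrable lborel (gauss_cutoff H n)"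
proof -
  obtain B where B: "\<And>v. cmod (H v) \<le> B" using bcontfunE[OF assms] by metis
  show ?thesis
    unfolding gauss_cutoff_def[abs_def]
    by (rule integrable_mult_bounded[OF _ bcontfun_borel[OF assms] B]) (use integrable_gauss[of "1 / real (Suc n)"] in auto)
qed

text \<open>Serves three approximations: Gaussian cutoffs, truncations to [-R, R], and truncated
  Riesz symbols. In each the approximant is pointwise smaller than its limit, so four times the
  square of the limit is a majorant.\<close>

lemma energy_dominated_convergence:
  assumes [measurable]: "\<And>n. K n \<in> borel_measurable borel" "H \<in> borel_measurable borel"
    and H: "energy H < \<infinity>" and le: "\<And>n v. cmod (K n v) \<le> cmod (H v)"
    and lim: "\<And>v. (\<lambda>n. K n v) \<longlonglongrightarrow> H v"
  shows "(\<lambda>n. energy (\<lambda>v. K n v - H v)) \<longlonglongrightarrow> 0"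
proof -
  have "(\<lambda>n. \<integral>\<^sup>+v. ennreal ((cmod (K n v - H v))\<^sup>2) \<partial>lborel) \<longlonglongrightarrow> (\<integral>\<^sup>+v. ennreal 0 \<partial>(lborel::real measure))"
  proof (rule nn_integral_dominated_convergence[where w="\<lambda>v. 4 * ennreal ((cmod (H v))\<^sup>2)"])
    show "(\<integral>\<^sup>+v. 4 * ennreal ((cmod (H v))\<^sup>2) \<partial>lborel) < \<infinity>"
      using H by (simp add: nn_integral_cmult energy_def ennreal_mult_less_top)
    have "(\<lambda>n. ennreal ((cmod (K n v - H v))\<^sup>2)) \<longlonglongrightarrow> ennreal ((cmod (H v - H v))\<^sup>2)" for v
      by (intro tendsto_intros lim)
    then show "AE v in lborel. (\<lambda>n. ennreal ((cmod (K n v - H v))\<^sup>2)) \<longlonglongrightarrow> ennreal 0" by simp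
    have "ennreal ((cmod (K n v - H v))\<^sup>2) \<le> 4 * ennreal ((cmod (H v))\<^sup>2)" for n v
    proof -
      have "cmod (K n v - H v) \<le> 2 * cmod (H v)"
        using norm_triangle_ineq4[of "K n v" "H v"] le[of n v] by linarith
      then have "(cmod (K n v - H v))\<^sup>2 \<le> (2 * cmod (H v))\<^sup>2" by (intro power_mono) auto
      then show ?thesis by (simp add: power_mult_distrib flip: ennreal_mult'' ennreal_numeral)
    qed
    then show "AE v in lborel. ennreal ((cmod (K n v - H v))\<^sup>2) \<le> 4 * ennreal ((cmod (H v))\<^sup>2)" for n by simp
  qed measurable
  then show ?thesis unfolding energy_def by simp
qed

lemma energy_gauss_cutoff_tendsto:
  assumes [measurable]: "H \<in> borel_measurable borel" and "energy H < \<infinity>"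
  shows "(\<lambda>n. energy (\<lambda>v. gauss_cutoff H n v - H v)) \<longlonglongrightarrow> 0"
  using assms(2) by (intro energy_dominated_convergence norm_gauss_cutoff_le gauss_cutoff_tendsto) measurable

lemma integrable_indicator_energy:
  assumes [measurable]: "f \<in> borel_measurable borel" and "energy f < \<infinity>"
  shows "integrable lborel (\<lambda>x. indicator {a..b} x * f x :: complex)"
proof -
  have "integrable lborel (\<lambda>x. indicator {a..b} x + (cmod (f x))\<^sup>2)"
    using energy_lborel(1)[OF assms] by (intro Bochner_Integration.integrable_add integrable_real_indicator) (auto simp: emeasure_lborel_Icc_eq)
  then show ?thesis
  proof (rule Bochner_Integration.integrable_bound)
    have "cmod (f x) \<le> 1 + (cmod (f x))\<^sup>2" for x
      using sum_squares_bound[of "cmod (f x)" 1] norm_ge_zero[of "f x"]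
      by (simp del: norm_ge_zero)
    then show "AE x in lborel. norm (indicator {a..b} x * f x) \<le> norm (indicator {a..b} x + (cmod (f x))\<^sup>2)"
      by (auto split: split_indicator)
  qed measurable
qed

lemma energy_truncation_tendsto:
  assumes [measurable]: "f \<in> borel_measurable borel" and "energy f < \<infinity>"
  shows "((\<lambda>R. energy (\<lambda>x. indicator {-R..R} x * f x - f x)) \<longlongrightarrow> 0) at_top"
proof (rule tendsto_at_topI_sequentially)
  fix R :: "nat \<Rightarrow> real" assume R: "filterlim R at_top sequentially"
  show "(\<lambda>n. energy (\<lambda>x. indicator {-R n..R n} x * f x - f x)) \<longlonglongrightarrow> 0"
  proof (rule energy_dominated_convergence[OF _ _ assms(2)])
    show "(\<lambda>n. indicator {-R n..R n} x * f x) \<longlonglongrightarrow> f x" for x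
    proof (rule tendsto_eventually)
      show "\<forall>\<^sub>F n in sequentially. indicator {-R n..R n} x * f x = f x"
        using R[unfolded filterlim_at_top, rule_format, of "\<bar>x\<bar>"]
        by eventually_elim (auto simp: abs_le_iff split: split_indicator)
    qed
  qed (auto split: split_indicator)
qed

lemma ennreal_tendsto_0_le:
  assumes "(f \<longlongrightarrow> (0::ennreal)) F" "\<And>x. g x \<le> f x"
  shows "(g \<longlongrightarrow> 0) F"
  by (rule tendsto_sandwich[OF _ _ tendsto_const assms(1)]) (use assms(2) in auto)

lemma ennreal_mult_tendsto_0:
  assumes "(f \<longlongrightarrow> (0::ennreal)) F"
  shows "((\<lambda>x. numeral c * f x) \<longlongrightarrow> 0) F"
  using ennreal_tendsto_cmult[OF _ assms, of "numeral c"] by simp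

text \<open>Inverse transform in the mean: the inverse transforms of the cutoffs are Cauchy by
  Plancherel's identity, and \<psi> is their limit. Truncations of \<psi> may be discontinuous, so
  their transforms are compared with the cutoffs by \<open>energy_fourier_diff_le\<close> and not by
  Plancherel's identity. The approximating sequence is exported because the derivatives are analysed
  through it.\<close>

theorem has_fourier_L2_exists:
  assumes bc: "H \<in> bcontfun" and fin: "energy H < \<infinity>"
  obtains \<psi> where "\<psi> \<in> borel_measurable borel" "energy \<psi> < \<infinity>" "has_fourier_L2 \<psi> H"
    "(\<lambda>n. energy (\<lambda>x. ifourier (gauss_cutoff H n) x - \<psi> x)) \<longlonglongrightarrow> 0"
proof -
  have [measurable]: "H \<in> borel_measurable borel" using bcontfun_borel[OF bc] .
  define X where "X n = ifourier (gauss_cutoff H n)" for n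
  note ig = integrable_gauss_cutoff[OF bc] and bg = gauss_cutoff_bcontfun[OF bc]
  have [measurable]: "X n \<in> borel_measurable borel" for n
    unfolding X_def using borel_measurable_ifourier[OF ig] .
  define e where "e n = 2 * energy (\<lambda>v. gauss_cutoff H n v - H v)" for n
  have elim: "(\<lambda>n. energy (\<lambda>v. gauss_cutoff H n v - H v)) \<longlonglongrightarrow> 0"
    using energy_gauss_cutoff_tendsto[OF _ fin] by simp
  then have e: "e \<longlonglongrightarrow> 0"
    unfolding e_def[abs_def] by (rule ennreal_mult_tendsto_0)
  have "energy (\<lambda>x. X n x - X m x) \<le> e n + e m" for n m
  proof -
    have "energy (\<lambda>x. X n x - X m x) = energy (\<lambda>v. gauss_cutoff H n v - gauss_cutoff H m v)"
      unfolding X_def using energy_ifourier_diff[OF ig bg ig bg] .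
    also have "\<dots> \<le> 2 * energy (\<lambda>v. gauss_cutoff H n v - H v) + 2 * energy (\<lambda>v. H v - gauss_cutoff H m v)"
      by (rule energy_triangle) (auto intro!: borel_imp_lebesgue)
    finally show ?thesis unfolding e_def energy_minus_commute[of H] .
  qed
  then obtain \<psi> where [measurable]: "\<psi> \<in> borel_measurable borel" and lim: "(\<lambda>n. energy (\<lambda>x. X n x - \<psi> x)) \<longlonglongrightarrow> 0"
    using energy_complete[OF _ _ e, of X] by auto
  have fin_chi: "energy \<psi> < \<infinity>"
  proof -
    obtain n where n: "energy (\<lambda>x. X n x - \<psi> x) < 1"
      using order_tendstoD(2)[OF lim, of 1] by (auto simp: eventually_sequentially)
    have "energy (X n) \<le> energy H"
      unfolding X_def energy_ifourier[OF ig bg] by (rule energy_mono[OF norm_gauss_cutoff_le])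
    then have Xn: "energy (X n) < \<infinity>" using fin by (rule order_le_less_trans)
    have "energy \<psi> = energy (\<lambda>x. X n x + (\<psi> x - X n x))" by simp
    also have "\<dots> \<le> 2 * energy (X n) + 2 * energy (\<lambda>x. \<psi> x - X n x)"
      by (rule energy_add_le) (auto intro!: borel_imp_lebesgue)
    also have "\<dots> < \<infinity>"
      using Xn n unfolding energy_minus_commute[of \<psi>] by (auto simp: ennreal_mult_eq_top_iff less_top[symmetric])
    finally show ?thesis .
  qed
  let ?T = "\<lambda>R x. indicator {-R..R} x * \<psi> x"
  have iT: "integrable lborel (?T R)" for R by (rule integrable_indicator_energy[OF _ fin_chi]) measurable
  have eT: "energy (?T R) < \<infinity>" for R
    by (rule order_le_less_trans[OF energy_mono fin_chi]) (auto split: split_indicator)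
  have [measurable]: "fourier (?T R) \<in> borel_measurable borel" for R
    using borel_measurable_fourier[OF iT] .
  have bound: "energy (\<lambda>v. fourier (?T R) v - H v) \<le> 4 * energy (\<lambda>x. ?T R x - \<psi> x)" for R
  proof -
    \<comment> \<open>Here \<open>n\<close> is a free parameter; the bracket tends to 0 as it grows,
      leaving a bound in \<open>R\<close> alone.\<close>
    have "energy (\<lambda>v. fourier (?T R) v - H v) \<le> 4 * energy (\<lambda>x. ?T R x - \<psi> x) +
       (4 * energy (\<lambda>x. X n x - \<psi> x) + 2 * energy (\<lambda>v. gauss_cutoff H n v - H v))" for n
    proof -
      have "energy (\<lambda>v. fourier (?T R) v - H v)
          \<le> 2 * energy (\<lambda>v. fourier (?T R) v - gauss_cutoff H n v) + 2 * energy (\<lambda>v. gauss_cutoff H n v - H v)"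
        by (rule energy_triangle) (auto intro!: borel_imp_lebesgue)
      also have "energy (\<lambda>v. fourier (?T R) v - gauss_cutoff H n v) \<le> energy (\<lambda>x. ?T R x - X n x)"
        unfolding X_def by (rule energy_fourier_diff_le[OF iT eT ig bg])
      also have "\<dots> \<le> 2 * energy (\<lambda>x. ?T R x - \<psi> x) + 2 * energy (\<lambda>x. \<psi> x - X n x)"
        by (rule energy_triangle) (auto intro!: borel_imp_lebesgue)
      finally show ?thesis
        unfolding energy_minus_commute[of \<psi>] by (simp add: distrib_left mult.assoc[symmetric] add_ac mult_left_mono add_mono)
    qed
    moreover have "(\<lambda>n. 4 * energy (\<lambda>x. ?T R x - \<psi> x) +
       (4 * energy (\<lambda>x. X n x - \<psi> x) + 2 * energy (\<lambda>v. gauss_cutoff H n v - H v)))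
       \<longlonglongrightarrow> 4 * energy (\<lambda>x. ?T R x - \<psi> x) + (0 + 0)"
      by (intro tendsto_intros ennreal_mult_tendsto_0 elim lim) auto
    ultimately show ?thesis
      using LIMSEQ_le_const[where a="energy (\<lambda>v. fourier (?T R) v - H v)"] by fastforce
  qed
  have "((\<lambda>R. energy (\<lambda>v. fourier (?T R) v - H v)) \<longlongrightarrow> 0) at_top"
    by (rule ennreal_tendsto_0_le[OF ennreal_mult_tendsto_0 bound])
      (rule energy_truncation_tendsto[OF _ fin_chi], measurable)
  then have "has_fourier_L2 \<psi> H"
    unfolding has_fourier_L2_def square_integrable_iff_energy using fin fin_chi
    by (subst tendsto_L2_iff_energy) (auto intro!: borel_imp_lebesgue always_eventually)
  then show ?thesis using that[of \<psi>] fin_chi lim unfolding X_def by simp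
qed

text \<open>Lets one explicit derivative speak for all versions: a change on a null set alters none
  of the truncated transforms.\<close>

lemma has_fourier_L2_cong_AE:
  assumes "has_fourier_L2 \<psi> H" "square_integrable g" "AE x in lebesgue. g x = \<psi> x"
  shows "has_fourier_L2 g H"
proof -
  have [measurable]: "g \<in> borel_measurable lebesgue" "\<psi> \<in> borel_measurable lebesgue"
    using assms(1,2) by (auto simp: has_fourier_L2_def square_integrable_def)
  have e[measurable]: "(\<lambda>u. exp (- (\<i> * complex_of_real u * complex_of_real v))) \<in> borel_measurable lebesgue" for v
  proof -
    have "(\<lambda>u. exp (- (\<i> * complex_of_real u * complex_of_real v))) \<in> borel_measurable borel"
      by (intro borel_measurable_continuous_onI continuous_intros)
    then show ?thesis by (rule borel_imp_lebesgue)
  qed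
  have i: "(\<lambda>u. indicator {-R..R} u :: complex) \<in> borel_measurable lebesgue" for R :: real
    by (rule borel_imp_lebesgue) measurable
  have "fourier (\<lambda>u. indicator {-R..R} u * g u) = fourier (\<lambda>u. indicator {-R..R} u * \<psi> u)" for R
    unfolding fourier_def
  proof (intro ext arg_cong2[where f="(*)"] refl integral_cong_AE)
    show "AE x in lebesgue. indicator {-R..R} x * g x * exp (- (\<i> * complex_of_real x * complex_of_real v))
       = indicator {-R..R} x * \<psi> x * exp (- (\<i> * complex_of_real x * complex_of_real v))" for v
      using assms(3) by eventually_elim simp
  qed (intro borel_measurable_times i e; fact)+
  then show ?thesis using assms by (simp add: has_fourier_L2_def)
qed

lemma tendsto_L2_unique:
  assumes f: "tendsto_L2 f g F" "tendsto_L2 f k F" and "F \<noteq> bot"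
    and [measurable]: "g \<in> borel_measurable lebesgue" "k \<in> borel_measurable lebesgue"
  shows "AE x in lebesgue. g x = k x"
proof -
  have m: "\<forall>\<^sub>F t in F. (\<lambda>x. f t x - g x) \<in> borel_measurable lebesgue"
    "\<forall>\<^sub>F t in F. (\<lambda>x. f t x - k x) \<in> borel_measurable lebesgue"
    using f unfolding tendsto_L2_def square_integrable_def by (auto elim: eventually_mono)
  have "((\<lambda>t. energy (\<lambda>x. f t x - g x)) \<longlongrightarrow> 0) F" "((\<lambda>t. energy (\<lambda>x. f t x - k x)) \<longlongrightarrow> 0) F"
    using f m tendsto_L2_iff_energy by blast+
  then have "((\<lambda>t. 2 * energy (\<lambda>x. f t x - g x) + 2 * energy (\<lambda>x. f t x - k x)) \<longlongrightarrow> 0 + 0) F"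
    by (intro tendsto_add ennreal_mult_tendsto_0) auto
  moreover have "\<forall>\<^sub>F t in F. energy (\<lambda>x. g x - k x) \<le> 2 * energy (\<lambda>x. f t x - g x) + 2 * energy (\<lambda>x. f t x - k x)"
    using m
  proof eventually_elim
    case (elim t)
    then have [measurable]: "f t \<in> borel_measurable lebesgue"
      using borel_measurable_add[of "\<lambda>x. f t x - g x" lebesgue g] by simp
    show ?case
      using energy_triangle[of g k "f t"] unfolding energy_minus_commute[of g] by simp
  qed
  ultimately have "energy (\<lambda>x. g x - k x) \<le> 0"
    using tendsto_lowerbound[OF _ _ \<open>F \<noteq> bot\<close>] by fastforce
  then have "(\<integral>\<^sup>+x. ennreal ((cmod (g x - k x))\<^sup>2) \<partial>lebesgue) = 0"
    unfolding energy_def nn_integral_completion by simp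
  then show ?thesis
    by (subst (asm) nn_integral_0_iff_AE) (auto simp: ennreal_eq_0_iff)
qed

text \<open>The set where the functions differ is open and null, hence empty.\<close>

lemma continuous_AE_eq:
  fixes G H :: "real \<Rightarrow> complex"
  assumes "AE x in lebesgue. G x = H x" "continuous_on UNIV G" "continuous_on UNIV H"
  shows "G = H"
proof -
  have N: "negligible {x. G x \<noteq> H x}"
    using assms(1) unfolding eventually_ae_filter_negligible by (blast intro: negligible_subset)
  have "open ((\<lambda>x. G x - H x) -` (- {0}))"
    using assms(2,3) by (intro open_vimage continuous_intros) auto
  then have "open {x. G x \<noteq> H x}" by (simp add: vimage_def)
  with N have "{x. G x \<noteq> H x} = {}" using open_not_negligible by blast
  then show ?thesis by auto
qed

text \<open>Resolves the definite description inside \<open>dist_infty\<close>: two candidates agree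
  almost everywhere as limits in the mean, hence everywhere by continuity.\<close>

lemma fourier_L2_bcont_eqI:
  assumes "has_fourier_L2 f H" "H \<in> bcontfun"
  shows "fourier_L2_bcont f = H"
  unfolding fourier_L2_bcont_def
proof (rule the_equality)
  fix G assume G: "has_fourier_L2 f G \<and> G \<in> bcontfun"
  have "AE x in lebesgue. G x = H x"
    using G assms by (intro tendsto_L2_unique[where F="at_top :: real filter"])
      (auto simp: has_fourier_L2_def square_integrable_def)
  then show "G = H"
    using G assms by (intro continuous_AE_eq) (auto simp: bcontfun_def)
qed (use assms in auto)

section \<open>Indefinite integrals of square integrable functions\<close>

text \<open>The integrated form of "the derivative of \<phi> is \<psi>", which survives mean-square
  limits. Integrability is part of it because the integral of a non-integrable function is 0 by
  default.\<close>

definition indef_integral :: "(real \<Rightarrow> complex) \<Rightarrow> (real \<Rightarrow> complex) \<Rightarrow> bool" where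
  "indef_integral \<phi> \<psi> \<longleftrightarrow> (\<forall>a b. a \<le> b \<longrightarrow>
     integrable lborel (\<lambda>x. indicator {a..b} x * \<psi> x) \<and>
     \<phi> b - \<phi> a = (LINT x|lborel. indicator {a..b} x * \<psi> x))"

text \<open>One estimate for two purposes: c = 0 yields absolute continuity, and c = \<psi>(x)
  differentiability at x. Dropping the end points, a null set, matches the open intervals in
  \<open>abs_continuous_on\<close>.\<close>

lemma indef_integral_bound:
  assumes "indef_integral \<phi> \<psi>" and ab: "a \<le> b" and [measurable]: "\<psi> \<in> borel_measurable borel"
  shows "ennreal (cmod (\<phi> b - \<phi> a - complex_of_real (b - a) * c))
     \<le> (\<integral>\<^sup>+x. indicator {a<..<b} x * ennreal (cmod (\<psi> x - c)) \<partial>lborel)"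
proof -
  have i: "integrable lborel (\<lambda>x. indicator {a..b} x * \<psi> x)"
    and eq: "\<phi> b - \<phi> a = (LINT x|lborel. indicator {a..b} x * \<psi> x)"
    using assms by (auto simp: indef_integral_def)
  have ic: "has_bochner_integral lborel (\<lambda>x. complex_of_real (indicator {a..b} x) * c) (complex_of_real (b - a) * c)"
    using ab by (intro has_bochner_integral_mult_left has_bochner_integral_of_real)
      (auto simp: has_bochner_integral_iff emeasure_lborel_Icc_eq measure_def intro!: integrable_real_indicator)
  then have ic': "integrable lborel (\<lambda>x. indicator {a..b} x * c)" "(LINT x|lborel. indicator {a..b} x * c) = complex_of_real (b - a) * c"
    by (auto simp: has_bochner_integral_iff of_real_indicator)
  have "\<phi> b - \<phi> a - complex_of_real (b - a) * c = (LINT x|lborel. indicator {a..b} x * \<psi> x - indicator {a..b} x * c)"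
    unfolding eq ic'(2)[symmetric] by (rule Bochner_Integration.integral_diff[OF i ic'(1), symmetric])
  also have "ennreal (cmod \<dots>) \<le> (\<integral>\<^sup>+x. ennreal (cmod (indicator {a..b} x * \<psi> x - indicator {a..b} x * c)) \<partial>lborel)"
    using i ic' by (intro integral_norm_bound_ennreal) auto
  also have "\<dots> = (\<integral>\<^sup>+x. indicator {a<..<b} x * ennreal (cmod (\<psi> x - c)) \<partial>lborel)"
  proof (intro nn_integral_cong_AE)
    have "AE x in lborel. x \<noteq> a" "AE x in lborel. x \<noteq> b" by (rule AE_lborel_singleton)+
    then show "AE x in lborel. ennreal (cmod (indicator {a..b} x * \<psi> x - indicator {a..b} x * c))
        = indicator {a<..<b} x * ennreal (cmod (\<psi> x - c))"
      by eventually_elim (auto split: split_indicator)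
  qed
  finally show ?thesis .
qed

lemma indef_integral_has_vector_derivative:
  assumes \<phi>: "indef_integral \<phi> \<psi>" and m[measurable]: "\<psi> \<in> borel_measurable borel"
    and c: "\<And>\<eta>. 0 < \<eta> \<Longrightarrow> \<exists>d>0. \<forall>a b. a \<le> x \<longrightarrow> x \<le> b \<longrightarrow> a < b \<longrightarrow> b - a < d \<longrightarrow>
      (\<integral>\<^sup>+z. indicator {a<..<b} z * ennreal (cmod (\<psi> z - c)) \<partial>lborel) \<le> ennreal (\<eta> * (b - a))"
  shows "(\<phi> has_vector_derivative c) (at x)"
  unfolding has_vector_derivative_def has_derivative_at_alt
proof (intro conjI allI impI)
  show "bounded_linear (\<lambda>h. h *\<^sub>R c)" by (rule bounded_linear_scaleR_left)
  fix \<eta> :: real assume \<eta>: "0 < \<eta>"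
  from c[OF this] obtain d where d: "0 < d" "\<And>a b. a \<le> x \<Longrightarrow> x \<le> b \<Longrightarrow> a < b \<Longrightarrow> b - a < d \<Longrightarrow>
      (\<integral>\<^sup>+z. indicator {a<..<b} z * ennreal (cmod (\<psi> z - c)) \<partial>lborel) \<le> ennreal (\<eta> * (b - a))" by blast
  have *: "cmod (\<phi> b - \<phi> a - complex_of_real (b - a) * c) \<le> \<eta> * (b - a)"
    if "a \<le> x" "x \<le> b" "a < b" "b - a < d" for a b
  proof -
    have "ennreal (cmod (\<phi> b - \<phi> a - complex_of_real (b - a) * c)) \<le> ennreal (\<eta> * (b - a))"
      using indef_integral_bound[OF \<phi> less_imp_le[OF that(3)] m, of c] d(2)[OF that] by (rule order_trans)
    then show ?thesis using that \<eta> by (subst (asm) ennreal_le_iff) auto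
  qed
  show "\<exists>d>0. \<forall>y. norm (y - x) < d \<longrightarrow> cmod (\<phi> y - \<phi> x - (y - x) *\<^sub>R c) \<le> \<eta> * norm (y - x)"
  proof (intro exI conjI allI impI)
    fix y assume y: "norm (y - x) < d"
    show "cmod (\<phi> y - \<phi> x - (y - x) *\<^sub>R c) \<le> \<eta> * norm (y - x)"
    proof (cases x y rule: linorder_cases)
      case less
      then show ?thesis using *[of x y] y by (simp add: scaleR_conv_of_real)
    next
      case greater
      have "cmod (\<phi> y - \<phi> x - (y - x) *\<^sub>R c) = cmod (\<phi> x - \<phi> y - complex_of_real (x - y) * c)"
        by (subst norm_minus_cancel[symmetric]) (simp add: scaleR_conv_of_real algebra_simps)
      then show ?thesis using *[of y x] y greater by simp
    qed simp
  qed (use d in auto)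
qed

lemma indef_integral_deriv_continuous:
  assumes "indef_integral \<phi> \<psi>" "continuous_on UNIV \<psi>"
  shows "(\<phi> has_vector_derivative \<psi> x) (at x)"
proof (rule indef_integral_has_vector_derivative[OF assms(1)])
  fix \<eta> :: real assume "0 < \<eta>"
  then obtain d where d: "0 < d" "\<And>z. dist z x < d \<Longrightarrow> dist (\<psi> z) (\<psi> x) < \<eta>"
    using assms(2) unfolding continuous_on_iff by (metis UNIV_I)
  show "\<exists>d>0. \<forall>a b. a \<le> x \<longrightarrow> x \<le> b \<longrightarrow> a < b \<longrightarrow> b - a < d \<longrightarrow>
      (\<integral>\<^sup>+z. indicator {a<..<b} z * ennreal (cmod (\<psi> z - \<psi> x)) \<partial>lborel) \<le> ennreal (\<eta> * (b - a))"
  proof (intro exI[of _ d] conjI allI impI)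
    fix a b assume ab: "a \<le> x" "x \<le> b" "a < b" "b - a < d"
    have "(\<integral>\<^sup>+z. indicator {a<..<b} z * ennreal (cmod (\<psi> z - \<psi> x)) \<partial>lborel)
        \<le> (\<integral>\<^sup>+z. ennreal \<eta> * indicator {a<..<b} z \<partial>lborel)"
    proof (rule nn_integral_mono)
      fix z
      have "cmod (\<psi> z - \<psi> x) \<le> \<eta>" if "z \<in> {a<..<b}"
        using d(2)[of z] that ab by (auto simp: dist_norm abs_less_iff intro!: less_imp_le)
      then show "indicator {a<..<b} z * ennreal (cmod (\<psi> z - \<psi> x)) \<le> ennreal \<eta> * indicator {a<..<b} z"
        by (auto split: split_indicator intro: ennreal_leI)
    qed
    also have "\<dots> = ennreal (\<eta> * (b - a))"
      using ab \<open>0 < \<eta>\<close> by (simp add: nn_integral_cmult ennreal_mult)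
    finally show "(\<integral>\<^sup>+z. indicator {a<..<b} z * ennreal (cmod (\<psi> z - \<psi> x)) \<partial>lborel) \<le> ennreal (\<eta> * (b - a))" .
  qed (use d in auto)
qed (use assms in \<open>auto intro: borel_measurable_continuous_onI\<close>)

text \<open>By Young's inequality, \<open>cmod (\<psi> x)\<close> is at most l/2 times its square
  plus 1/(2l). Over disjoint intervals the first part adds up to at most l/2 times the total energy,
  however many intervals there are, and the second to their total length over 2l.\<close>

lemma indef_integral_locally_abs_continuous:
  assumes \<phi>: "indef_integral \<phi> \<psi>" and m[measurable]: "\<psi> \<in> borel_measurable borel" and fin: "energy \<psi> < \<infinity>"
  shows "locally_abs_continuous \<phi>"
  unfolding locally_abs_continuous_def abs_continuous_on_def
proof (intro allI impI)
  fix c d \<epsilon> :: real assume \<epsilon>: "0 < \<epsilon>"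
  obtain W where W: "0 \<le> W" "energy \<psi> = ennreal W" using fin by (cases "energy \<psi>") auto
  \<comment> \<open>With this \<open>l\<close> the energy part is at most \<epsilon>/2, and with
    \<delta> = l\<epsilon> the length part is below \<epsilon>/2. The added 1 covers W = 0.\<close>
  define l where "l = \<epsilon> / (W + 1)"
  have l: "0 < l" using \<epsilon> W by (simp add: l_def)
  define \<mu> where "\<mu> = density lborel (\<lambda>x. ennreal ((cmod (\<psi> x))\<^sup>2))"
  have \<mu>: "emeasure \<mu> A = (\<integral>\<^sup>+x. indicator A x * ennreal ((cmod (\<psi> x))\<^sup>2) \<partial>lborel)" if "A \<in> sets borel" for A
    unfolding \<mu>_def using that by (subst emeasure_density) (auto simp: mult.commute)
  have *: "ennreal (cmod (\<phi> b - \<phi> a)) \<le> ennreal (l / 2) * emeasure \<mu> {a<..<b} + ennreal ((b - a) / (2 * l))" if "a \<le> b" for a b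
  proof -
    have "ennreal (cmod (\<phi> b - \<phi> a)) \<le> (\<integral>\<^sup>+x. indicator {a<..<b} x * ennreal (cmod (\<psi> x)) \<partial>lborel)"
      using indef_integral_bound[OF \<phi> that m, of 0] by simp
    also have "\<dots> \<le> (\<integral>\<^sup>+x. ennreal (l / 2) * (indicator {a<..<b} x * ennreal ((cmod (\<psi> x))\<^sup>2)) + ennreal (1 / (2 * l)) * indicator {a<..<b} x \<partial>lborel)"
    proof (rule nn_integral_mono)
      fix x
      have "2 * (l * cmod (\<psi> x)) * 1 \<le> (l * cmod (\<psi> x))\<^sup>2 + 1\<^sup>2" by (rule sum_squares_bound)
      then have "cmod (\<psi> x) \<le> l / 2 * (cmod (\<psi> x))\<^sup>2 + 1 / (2 * l)"
        using l by (simp add: field_simps power2_eq_square)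
      then have "ennreal (cmod (\<psi> x)) \<le> ennreal (l / 2) * ennreal ((cmod (\<psi> x))\<^sup>2) + ennreal (1 / (2 * l))"
        using l by (simp flip: ennreal_mult ennreal_plus)
      then show "indicator {a<..<b} x * ennreal (cmod (\<psi> x)) \<le> ennreal (l / 2) * (indicator {a<..<b} x * ennreal ((cmod (\<psi> x))\<^sup>2)) + ennreal (1 / (2 * l)) * indicator {a<..<b} x"
        by (auto split: split_indicator)
    qed
    also have "\<dots> = ennreal (l / 2) * emeasure \<mu> {a<..<b} + ennreal (1 / (2 * l)) * ennreal (b - a)"
      using that by (subst nn_integral_add) (auto simp: nn_integral_cmult \<mu>)
    also have "ennreal (1 / (2 * l)) * ennreal (b - a) = ennreal ((b - a) / (2 * l))"
      using l that by (simp flip: ennreal_mult)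
    finally show ?thesis .
  qed
  show "\<exists>\<delta>>0. \<forall>n. \<forall>a b :: nat \<Rightarrow> real. (\<forall>i<n. c \<le> a i \<and> a i \<le> b i \<and> b i \<le> d) \<and>
        disjoint_family_on (\<lambda>i. {a i<..<b i}) {..<n} \<and> (\<Sum>i<n. b i - a i) < \<delta> \<longrightarrow>
        (\<Sum>i<n. cmod (\<phi> (b i) - \<phi> (a i))) < \<epsilon>"
  proof (intro exI[of _ "l * \<epsilon>"] conjI allI impI; (elim conjE)?)
    fix n and a b :: "nat \<Rightarrow> real"
    assume ab: "\<forall>i<n. c \<le> a i \<and> a i \<le> b i \<and> b i \<le> d"
      and disj: "disjoint_family_on (\<lambda>i. {a i<..<b i}) {..<n}" and small: "(\<Sum>i<n. b i - a i) < l * \<epsilon>"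
    have "ennreal (\<Sum>i<n. cmod (\<phi> (b i) - \<phi> (a i))) = (\<Sum>i<n. ennreal (cmod (\<phi> (b i) - \<phi> (a i))))"
      by (simp add: sum_ennreal)
    also have "\<dots> \<le> (\<Sum>i<n. ennreal (l / 2) * emeasure \<mu> {a i<..<b i} + ennreal ((b i - a i) / (2 * l)))"
      using ab by (intro sum_mono *) auto
    also have "\<dots> = ennreal (l / 2) * (\<Sum>i<n. emeasure \<mu> {a i<..<b i}) + (\<Sum>i<n. ennreal ((b i - a i) / (2 * l)))"
      by (simp add: sum.distrib sum_distrib_left)
    also have "(\<Sum>i<n. ennreal ((b i - a i) / (2 * l))) = ennreal (\<Sum>i<n. (b i - a i) / (2 * l))"
      using ab l by (intro sum_ennreal) auto
    also have "(\<Sum>i<n. emeasure \<mu> {a i<..<b i}) = emeasure \<mu> (\<Union>i<n. {a i<..<b i})"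
      using disj by (intro sum_emeasure) (auto simp: \<mu>_def)
    also have "\<dots> \<le> emeasure \<mu> (space \<mu>)" by (rule emeasure_space)
    also have "\<dots> = ennreal W" using \<mu>[of UNIV] W(2) by (simp add: \<mu>_def energy_def)
    also have "ennreal (l / 2) * ennreal W + ennreal (\<Sum>i<n. (b i - a i) / (2 * l))
        = ennreal (l / 2 * W + (\<Sum>i<n. (b i - a i) / (2 * l)))"
      using l W(1) ab by (auto simp flip: ennreal_mult ennreal_plus intro!: sum_nonneg ennreal_plus[symmetric])
    finally have "ennreal (\<Sum>i<n. cmod (\<phi> (b i) - \<phi> (a i))) \<le> ennreal (l / 2 * W + (\<Sum>i<n. (b i - a i) / (2 * l)))"
      by (simp add: mult_left_mono)
    then have "(\<Sum>i<n. cmod (\<phi> (b i) - \<phi> (a i))) \<le> l / 2 * W + (\<Sum>i<n. (b i - a i) / (2 * l))"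
      using l W(1) ab by (subst (asm) ennreal_le_iff) (auto intro!: add_nonneg_nonneg sum_nonneg)
    also have "(\<Sum>i<n. (b i - a i) / (2 * l)) = (\<Sum>i<n. b i - a i) / (2 * l)"
      by (simp add: sum_divide_distrib)
    also have "\<dots> < (l * \<epsilon>) / (2 * l)" using small l by (intro divide_strict_right_mono) auto
    also have "l / 2 * W + (l * \<epsilon>) / (2 * l) \<le> \<epsilon>"
    proof -
      have "l * W \<le> \<epsilon>" using W(1) \<epsilon> by (simp add: l_def field_simps)
      then show ?thesis using l by (simp add: field_simps)
    qed
    finally show "(\<Sum>i<n. cmod (\<phi> (b i) - \<phi> (a i))) < \<epsilon>" by simp
  qed (use l \<epsilon> in auto)
qed

subsection \<open>Lebesgue's differentiation theorem\<close>

text \<open>The weak-type bound for the Hardy-Littlewood maximal function, by Vitali covering: each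
  selected interval, enlarged five times, has length 10r, and tr lies below the mass of the original
  one. The conclusion gives a Borel superset \<open>M\<close>, which avoids any question about
  measurability of the exceptional set.\<close>

lemma weak_maximal_inequality:
  assumes [measurable]: "w \<in> borel_measurable borel" and fin: "(\<integral>\<^sup>+x. w x \<partial>lborel) < (\<infinity>::ennreal)" and t: "0 < t"
  obtains M where "M \<in> sets borel" "emeasure lborel M \<le> ennreal (10 / t) * (\<integral>\<^sup>+x. w x \<partial>lborel)"
    "\<And>x r. 0 < r \<Longrightarrow> ennreal (t * r) < (\<integral>\<^sup>+y. w y * indicator (ball x r) y \<partial>lborel) \<Longrightarrow> (x::real) \<in> M"
proof -
  define \<mu> where "\<mu> = density lborel w"
  have \<mu>: "emeasure \<mu> A = (\<integral>\<^sup>+y. w y * indicator A y \<partial>lborel)" if "A \<in> sets borel" for A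
    unfolding \<mu>_def using that by (subst emeasure_density) auto
  have \<mu>le: "emeasure \<mu> A \<le> (\<integral>\<^sup>+x. w x \<partial>lborel)" if "A \<in> sets borel" for A
    unfolding \<mu>[OF that] by (intro nn_integral_mono) (auto split: split_indicator)
  obtain W where W: "0 \<le> W" "(\<integral>\<^sup>+x. w x \<partial>lborel) = ennreal W" using fin by (cases "\<integral>\<^sup>+x. w x \<partial>lborel") auto
  define E where "E = {x. \<exists>r>0. ennreal (t * r) < emeasure \<mu> (ball x r)}"
  define r where "r x = (SOME r. 0 < r \<and> ennreal (t * r) < emeasure \<mu> (ball x r))" for x
  have r: "0 < r x" "ennreal (t * r x) < emeasure \<mu> (ball x (r x))" if "x \<in> E" for x
    using someI_ex[of "\<lambda>r. 0 < r \<and> ennreal (t * r) < emeasure \<mu> (ball x r)"] that unfolding r_def E_def by auto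
  \<comment> \<open>The covering lemma needs bounded radii; the finite total mass provides the
    bound.\<close>
  have rB: "r x \<le> W / t" if "x \<in> E" for x
  proof -
    have "ennreal (t * r x) < ennreal W"
      using r(2)[OF that] \<mu>le[of "ball x (r x)"] W(2) by simp
    then have "t * r x < W" using r(1)[OF that] t by (simp add: ennreal_less_iff)
    then show ?thesis using t by (simp add: field_simps)
  qed
  have "E \<subseteq> (\<Union>i\<in>E. ball (id i) (r i))" using r(1) by force
  moreover have "0 < r i \<and> r i \<le> W / t" if "i \<in> E" for i using r(1) rB that by auto
  ultimately obtain C where C: "countable C" "C \<subseteq> E"
    "pairwise (\<lambda>i j. disjnt (ball (id i) (r i)) (ball (id j) (r j))) C"
    "E \<subseteq> (\<Union>i\<in>C. ball (id i) (5 * r i))"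
    by (rule Vitali_covering_lemma_balls)
  \<comment> \<open>The countable family is laid out as a sequence, padded with empty sets, with one
    definition for both enlargement factors 1 and 5.\<close>
  define D where "D s n = (if n \<in> to_nat_on C ` C then ball (from_nat_into C n) (s * r (from_nat_into C n)) else {})" for s n
  have Dm: "D s n \<in> sets borel" for s n by (simp add: D_def)
  have UD: "(\<Union>n. D s n) = (\<Union>i\<in>C. ball i (s * r i))" for s
    unfolding D_def using C(1) by (auto split: if_splits)
  have disj: "disjoint_family (D 1)"
    unfolding disjoint_family_on_def
  proof (intro ballI impI)
    fix m n :: nat assume "m \<noteq> n"
    show "D 1 m \<inter> D 1 n = {}"
    proof (cases "m \<in> to_nat_on C ` C \<and> n \<in> to_nat_on C ` C")
      case True
      then obtain i j where ij: "i \<in> C" "j \<in> C" "m = to_nat_on C i" "n = to_nat_on C j" by auto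
      then have "i \<noteq> j" using \<open>m \<noteq> n\<close> by auto
      then show ?thesis using C(1,3) ij by (auto simp: D_def pairwise_def disjnt_def)
    qed (auto simp: D_def)
  qed
  have "emeasure lborel (\<Union>n. D 5 n) \<le> (\<Sum>n. emeasure lborel (D 5 n))"
    by (intro emeasure_subadditive_countably) (auto simp: Dm)
  also have "\<dots> \<le> (\<Sum>n. ennreal (10 / t) * emeasure \<mu> (D 1 n))"
  proof (rule suminf_le[OF _ summableI summableI])
    fix n
    show "emeasure lborel (D 5 n) \<le> ennreal (10 / t) * emeasure \<mu> (D 1 n)"
    proof (cases "n \<in> to_nat_on C ` C")
      case True
      define x where "x = from_nat_into C n"
      have x: "x \<in> E" using True C(1,2) unfolding x_def by auto
      have "emeasure lborel (D 5 n) = ennreal (10 / t * (t * r x))"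
        using True t r(1)[OF x] by (simp add: D_def x_def[symmetric] ball_eq_greaterThanLessThan)
      also have "\<dots> = ennreal (10 / t) * ennreal (t * r x)" using t by (intro ennreal_mult') auto
      also have "\<dots> \<le> ennreal (10 / t) * emeasure \<mu> (ball x (r x))"
        using r(2)[OF x] by (intro mult_left_mono) auto
      finally show ?thesis using True by (simp add: D_def x_def[symmetric])
    qed (simp add: D_def)
  qed
  also have "\<dots> = ennreal (10 / t) * (\<Sum>n. emeasure \<mu> (D 1 n))" by simp
  also have "(\<Sum>n. emeasure \<mu> (D 1 n)) = emeasure \<mu> (\<Union>n. D 1 n)"
    using disj Dm by (intro suminf_emeasure) (auto simp: \<mu>_def)
  also have "\<dots> \<le> (\<integral>\<^sup>+x. w x \<partial>lborel)" using Dm by (intro \<mu>le) auto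
  finally have "emeasure lborel (\<Union>n. D 5 n) \<le> ennreal (10 / t) * (\<integral>\<^sup>+x. w x \<partial>lborel)"
    by (simp add: mult_left_mono)
  moreover have "x \<in> (\<Union>n. D 5 n)" if "0 < r'" "ennreal (t * r') < (\<integral>\<^sup>+y. w y * indicator (ball x r') y \<partial>lborel)" for x r'
  proof -
    have "x \<in> E" unfolding E_def using that \<mu>[of "ball x r'"] by auto
    then show ?thesis unfolding UD using subsetD[OF C(4)] by simp
  qed
  ultimately show ?thesis using that[of "\<Union>n. D 5 n"] Dm by blast
qed

text \<open>Continuous functions approximate \<psi> only in the mean-square sense, so the maximal
  inequality is applied to the squared errors. Level 2^(-k) against energy 4^(-k) gives exceptional
  sets of measure at most 10 * 2^(-k); by Borel-Cantelli almost every x lies in only finitely many.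
  The squared errors at x itself also tend to 0, so x is a Lebesgue point.\<close>

theorem indef_integral_AE_deriv:
  assumes \<phi>: "indef_integral \<phi> \<psi>" and m[measurable]: "\<psi> \<in> borel_measurable borel"
    and X: "\<And>n. continuous_on UNIV (X n)" and lim: "(\<lambda>n. energy (\<lambda>x. X n x - \<psi> x)) \<longlonglongrightarrow> 0"
  shows "AE x in lborel. (\<phi> has_vector_derivative \<psi> x) (at x)"
proof -
  have [measurable]: "X n \<in> borel_measurable borel" for n
    using X by (rule borel_measurable_continuous_onI)
  obtain r where r: "\<And>k. energy (\<lambda>x. X (r k) x - \<psi> x) \<le> ennreal (1 / 4 ^ k)"
    using energy_subseq[OF lim] order_refl by metis
  define d where "d k x = ennreal ((cmod (X (r k) x - \<psi> x))\<^sup>2)" for k x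
  have [measurable]: "d k \<in> borel_measurable borel" for k unfolding d_def by measurable
  have de: "(\<integral>\<^sup>+x. d k x \<partial>lborel) = energy (\<lambda>x. X (r k) x - \<psi> x)" for k
    by (simp add: d_def energy_def)
  have "\<exists>M. M \<in> sets borel \<and> emeasure lborel M \<le> ennreal (10 / (1 / 2 ^ k)) * (\<integral>\<^sup>+x. d k x \<partial>lborel) \<and>
    (\<forall>x s. 0 < s \<longrightarrow> ennreal (1 / 2 ^ k * s) < (\<integral>\<^sup>+y. d k y * indicator (ball x s) y \<partial>lborel) \<longrightarrow> x \<in> M)" for k :: nat
  proof -
    have "(\<integral>\<^sup>+x. d k x \<partial>lborel) < \<infinity>" unfolding de using r[of k] by (rule order_le_less_trans) simp
    then show ?thesis using weak_maximal_inequality[of "d k" "1 / 2 ^ k"] by (metis (full_types) \<open>d k \<in> borel_measurable borel\<close> zero_less_divide_1_iff zero_less_numeral zero_less_power)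
  qed
  then obtain M where M: "\<And>k. M k \<in> sets borel"
    "\<And>k. emeasure lborel (M k) \<le> ennreal (10 / (1 / 2 ^ k)) * (\<integral>\<^sup>+x. d k x \<partial>lborel)"
    "\<And>k x s. 0 < s \<Longrightarrow> ennreal (1 / 2 ^ k * s) < (\<integral>\<^sup>+y. d k y * indicator (ball x s) y \<partial>lborel) \<Longrightarrow> x \<in> M k"
    by metis
  have Mle: "emeasure lborel (M k) \<le> ennreal (10 * (1 / 2) ^ k)" for k
  proof -
    have "emeasure lborel (M k) \<le> ennreal (10 / (1 / 2 ^ k)) * ennreal (1 / 4 ^ k)"
      using M(2)[of k] mult_left_mono[OF r[of k]] unfolding de by (meson order_trans zero_le)
    also have "\<dots> = ennreal (10 / (1 / 2 ^ k) * (1 / 4 ^ k))" by (rule ennreal_mult'[symmetric]) simp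
    also have "10 / (1 / 2 ^ k) * (1 / 4 ^ k) = 10 * (1 / 2 :: real) ^ k"
    proof -
      have "(4::real) ^ k = 2 ^ k * 2 ^ k" by (simp flip: power_mult_distrib)
      then show ?thesis by (simp add: power_one_over)
    qed
    finally show ?thesis .
  qed
  have "summable (\<lambda>k. measure lborel (M k))"
  proof (rule summable_comparison_test')
    show "summable (\<lambda>k. 10 * (1 / 2 :: real) ^ k)" by (intro summable_mult summable_geometric) auto
    show "norm (measure lborel (M k)) \<le> 10 * (1 / 2) ^ k" for k
      using enn2real_mono[OF Mle[of k]] by (simp add: measure_def)
  qed
  moreover have "emeasure lborel (M k) < \<infinity>" for k using Mle[of k] by (rule order_le_less_trans) simp
  ultimately have "AE x in lborel. \<forall>\<^sub>F k in sequentially. x \<in> space lborel - M k"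
    using M(1) by (intro borel_cantelli_AE1) auto
  moreover have "AE x in lborel. \<exists>D. \<forall>k. (cmod (X (r k) x - \<psi> x))\<^sup>2 \<le> D / 2 ^ k"
    by (rule AE_tendsto_of_energy[OF _ r]) auto
  ultimately show ?thesis
  proof eventually_elim
    case (elim x)
    then obtain D where D: "\<And>k. (cmod (X (r k) x - \<psi> x))\<^sup>2 \<le> D / 2 ^ k" by auto
    have p: "(\<lambda>k. c / 2 ^ k) \<longlonglongrightarrow> 0" for c :: real
    proof -
      have "(\<lambda>k. c * (1 / 2) ^ k) \<longlonglongrightarrow> 0" by (intro tendsto_mult_right_zero LIMSEQ_realpow_zero) auto
      then show ?thesis by (simp only: power_one_over times_divide_eq_right mult_1_right)
    qed
    show ?case
    proof (rule indef_integral_has_vector_derivative[OF \<phi> m])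
      fix \<eta>' :: real assume "0 < \<eta>'"
      \<comment> \<open>Of the five parts, two pay for the maximal bound and one each for the
        constant in Young's inequality, the continuity of \<open>X (r k)\<close> and its error at
        x.\<close>
      define \<eta> where "\<eta> = \<eta>' / 5"
      have \<eta>: "0 < \<eta>" using \<open>0 < \<eta>'\<close> by (simp add: \<eta>_def)
      have "\<forall>\<^sub>F k in sequentially. x \<notin> M k \<and> 1 / 2 ^ k < \<eta>\<^sup>2 \<and> D / 2 ^ k < \<eta>\<^sup>2"
      proof (intro eventually_conj)
        show "\<forall>\<^sub>F k in sequentially. x \<notin> M k" using elim(1) by (rule eventually_mono) auto
      qed (rule order_tendstoD(2)[OF p]; use \<eta> in simp)+
      from eventually_happens'[OF sequentially_bot this]
      obtain k where k: "x \<notin> M k" "1 / 2 ^ k < \<eta>\<^sup>2" "D / 2 ^ k < \<eta>\<^sup>2" by (elim exE conjE)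
      have Xx: "cmod (X (r k) x - \<psi> x) \<le> \<eta>"
        by (rule power2_le_imp_le[OF order_trans[OF D less_imp_le[OF k(3)]] less_imp_le[OF \<eta>]])
      obtain e where e: "0 < e" "\<And>z. dist z x < e \<Longrightarrow> dist (X (r k) z) (X (r k) x) < \<eta>"
        using X[of "r k"] \<eta> unfolding continuous_on_iff by (metis UNIV_I)
      show "\<exists>d>0. \<forall>a b. a \<le> x \<longrightarrow> x \<le> b \<longrightarrow> a < b \<longrightarrow> b - a < d \<longrightarrow>
          (\<integral>\<^sup>+z. indicator {a<..<b} z * ennreal (cmod (\<psi> z - \<psi> x)) \<partial>lborel) \<le> ennreal (\<eta>' * (b - a))"
      proof (intro exI[of _ e] conjI allI impI)
        fix a b assume ab: "a \<le> x" "x \<le> b" "a < b" "b - a < e"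
        have "(\<integral>\<^sup>+z. indicator {a<..<b} z * ennreal (cmod (\<psi> z - \<psi> x)) \<partial>lborel)
          \<le> (\<integral>\<^sup>+z. ennreal (1 / \<eta>) * (d k z * indicator (ball x (2 * (b - a))) z) + ennreal (3 * \<eta>) * indicator {a<..<b} z \<partial>lborel)"
        proof (rule nn_integral_mono)
          fix z
          show "indicator {a<..<b} z * ennreal (cmod (\<psi> z - \<psi> x))
             \<le> ennreal (1 / \<eta>) * (d k z * indicator (ball x (2 * (b - a))) z) + ennreal (3 * \<eta>) * indicator {a<..<b} z"
          proof (cases "z \<in> {a<..<b}")
            case True
            then have zb: "z \<in> ball x (2 * (b - a))" using ab by (auto simp: dist_norm)
            have "dist z x < e" using True ab by (auto simp: dist_norm)
            then have zz: "cmod (X (r k) z - X (r k) x) < \<eta>" using e(2) by (simp add: dist_norm)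
            define q where "q = cmod (X (r k) z - \<psi> z)"
            have "2 * q * \<eta> \<le> q\<^sup>2 + \<eta>\<^sup>2" by (rule sum_squares_bound)
            moreover have "0 \<le> q" by (simp add: q_def)
            then have "0 \<le> q * \<eta>" using \<eta> by simp
            ultimately have "q * \<eta> \<le> q\<^sup>2 + \<eta>\<^sup>2" by linarith
            then have "q \<le> 1 / \<eta> * q\<^sup>2 + \<eta>" using \<eta> by (simp add: field_simps power2_eq_square)
            moreover have "cmod (\<psi> z - \<psi> x) \<le> q + cmod (X (r k) z - X (r k) x) + cmod (X (r k) x - \<psi> x)"
            proof -
              have "cmod (\<psi> z - \<psi> x) \<le> cmod (\<psi> z - X (r k) z) + cmod (X (r k) z - \<psi> x)"
                by (rule norm_diff_triangle_le[OF order_refl order_refl])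
              moreover have "cmod (X (r k) z - \<psi> x) \<le> cmod (X (r k) z - X (r k) x) + cmod (X (r k) x - \<psi> x)"
                by (rule norm_diff_triangle_le[OF order_refl order_refl])
              ultimately show ?thesis
                unfolding q_def norm_minus_commute[of "X (r k) z" "\<psi> z"] by linarith
            qed
            ultimately have "cmod (\<psi> z - \<psi> x) \<le> 1 / \<eta> * q\<^sup>2 + 3 * \<eta>" using zz Xx by linarith
            then have "ennreal (cmod (\<psi> z - \<psi> x)) \<le> ennreal (1 / \<eta>) * d k z + ennreal (3 * \<eta>)"
              unfolding d_def q_def[symmetric] using \<eta>
              by (subst ennreal_mult[symmetric], simp, simp, subst ennreal_plus[symmetric], simp, simp, intro ennreal_leI)
            then show ?thesis using True zb by simp
          qed simp
        qed
        also have "\<dots> = ennreal (1 / \<eta>) * (\<integral>\<^sup>+z. d k z * indicator (ball x (2 * (b - a))) z \<partial>lborel) + ennreal (3 * \<eta>) * ennreal (b - a)"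
        proof -
          have [measurable]: "(\<lambda>z. d k z * indicator (ball x (2 * (b - a))) z) \<in> borel_measurable lborel"
            by (intro borel_measurable_times_ennreal borel_measurable_indicator) auto
          show ?thesis using ab by (subst nn_integral_add) (auto simp: nn_integral_cmult simp del: right_diff_distrib_numeral)
        qed
        also have "\<dots> \<le> ennreal (1 / \<eta>) * ennreal (1 / 2 ^ k * (2 * (b - a))) + ennreal (3 * \<eta>) * ennreal (b - a)"
          using M(3)[of "2 * (b - a)" k x] k(1) ab by (intro add_mono mult_left_mono) (auto simp: not_less[symmetric])
        also have "\<dots> = ennreal (1 / \<eta> * (1 / 2 ^ k * (2 * (b - a))) + 3 * \<eta> * (b - a))"
          using \<eta> ab by (simp flip: ennreal_mult ennreal_plus)
        also have "\<dots> \<le> ennreal (\<eta>' * (b - a))"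
        proof (rule ennreal_leI)
          have "1 / \<eta> * (1 / 2 ^ k * (2 * (b - a))) \<le> 1 / \<eta> * (\<eta>\<^sup>2 * (2 * (b - a)))"
            using k(2) ab \<eta> by (intro mult_left_mono mult_right_mono) auto
          also have "\<dots> = 2 * \<eta> * (b - a)" using \<eta> by (simp add: power2_eq_square)
          finally show "1 / \<eta> * (1 / 2 ^ k * (2 * (b - a))) + 3 * \<eta> * (b - a) \<le> \<eta>' * (b - a)"
            by (simp add: \<eta>_def field_simps)
        qed
        finally show "(\<integral>\<^sup>+z. indicator {a<..<b} z * ennreal (cmod (\<psi> z - \<psi> x)) \<partial>lborel) \<le> ennreal (\<eta>' * (b - a))" .
      qed (use e in auto)
    qed
  qed
qed

subsection \<open>Derivatives through the Fourier transform\<close>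

text \<open>Integrating the inverse transform of ivK over [a, b] and exchanging the integrals leaves
  the integral of an exponential over [a, b], which cancels the factor iv.\<close>

lemma indef_integral_ifourier:
  assumes K: "integrable lborel K" and vK: "integrable lborel (\<lambda>v. \<i> * complex_of_real v * K v)"
  shows "indef_integral (ifourier K) (ifourier (\<lambda>v. \<i> * complex_of_real v * K v))"
  unfolding indef_integral_def
proof (intro allI impI conjI)
  fix a b :: real assume ab: "a \<le> b"
  let ?H = "\<lambda>v. \<i> * complex_of_real v * K v"
  have [measurable]: "K \<in> borel_measurable borel" using K by auto
  have [measurable]: "ifourier ?H \<in> borel_measurable borel" using borel_measurable_ifourier[OF vK] .
  obtain B where B: "\<And>x. cmod (ifourier ?H x) \<le> B" using bcontfunE[OF bcontfun_ifourier[OF vK]] by metis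
  have ii: "integrable lborel (\<lambda>x. indicator {a..b} x :: complex)"
  proof -
    have "integrable lborel (\<lambda>x. complex_of_real (indicator {a..b} x))"
      by (intro integrable_of_real integrable_real_indicator) (auto simp: emeasure_lborel_Icc_eq)
    then show ?thesis by (simp add: of_real_indicator)
  qed
  show "integrable lborel (\<lambda>x. indicator {a..b} x * ifourier ?H x)"
    using ii B by (intro integrable_mult_bounded[where B=B]) auto
  \<comment> \<open>Stated as a product with iv and not as a quotient, so that v = 0 is no
    exception.\<close>
  have ftc: "(LINT x|lborel. indicator {a..b} x * cis (v * x)) * (\<i> * complex_of_real v) = cis (v * b) - cis (v * a)" for v
  proof -
    have "(LINT x|lborel. indicator {a..b} x *\<^sub>R (\<i> * complex_of_real v * cis (v * x))) = cis (v * b) - cis (v * a)"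
    proof (rule integral_FTC_atLeastAtMost[OF ab])
      show "((\<lambda>x. cis (v * x)) has_vector_derivative \<i> * complex_of_real v * cis (v * x)) (at x within {a..b})" for x
      proof -
        have "((\<lambda>x. exp (\<i> * complex_of_real v * complex_of_real x)) has_vector_derivative
            \<i> * complex_of_real v * exp (\<i> * complex_of_real v * complex_of_real x)) (at x within {a..b})"
          by (rule has_vector_derivative_real_field[where f="\<lambda>z. exp (\<i> * complex_of_real v * z)"])
            (auto intro!: derivative_eq_intros)
        then show ?thesis by (simp add: cis_conv_exp mult.assoc)
      qed
    qed (intro continuous_intros)
    then show ?thesis
      by (subst Bochner_Integration.integral_mult_left_zero[symmetric]) (simp add: scaleR_conv_of_real of_real_indicator mult_ac)
  qed
  have "(LINT x|lborel. indicator {a..b} x * (LINT v|lborel. ?H v * cis (snd (x, v) * fst (x, v))))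
     = (LINT v|lborel. ?H v * (LINT x|lborel. indicator {a..b} x * cis (snd (x, v) * fst (x, v))))"
    by (rule Fubini_bounded_kernel[OF ii vK, symmetric, where B=1 and c="\<lambda>p. cis (snd p * fst p)"]) auto
  also have "\<dots> = (LINT v|lborel. K v * cis (v * b) - K v * cis (v * a))"
  proof (intro Bochner_Integration.integral_cong refl)
    fix v
    have "?H v * (LINT x|lborel. indicator {a..b} x * cis (v * x))
       = K v * ((LINT x|lborel. indicator {a..b} x * cis (v * x)) * (\<i> * complex_of_real v))" by (simp add: mult_ac)
    also have "\<dots> = K v * cis (v * b) - K v * cis (v * a)" unfolding ftc by (simp add: right_diff_distrib)
    finally show "?H v * (LINT x|lborel. indicator {a..b} x * cis (snd (x, v) * fst (x, v))) = K v * cis (v * b) - K v * cis (v * a)"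
      by simp
  qed
  also have "\<dots> = (LINT v|lborel. K v * cis (v * b)) - (LINT v|lborel. K v * cis (v * a))"
    using K by (intro Bochner_Integration.integral_diff integrable_mult_cis) auto
  finally have "complex_of_real (1 / sqrt (2 * pi)) * (LINT x|lborel. indicator {a..b} x * (LINT v|lborel. ?H v * cis (v * x)))
    = ifourier K b - ifourier K a"
    by (simp add: ifourier_lborel right_diff_distrib)
  moreover have "(LINT x|lborel. indicator {a..b} x * ifourier ?H x)
     = (LINT x|lborel. complex_of_real (1 / sqrt (2 * pi)) * (indicator {a..b} x * (LINT v|lborel. ?H v * cis (v * x))))"
    by (intro Bochner_Integration.integral_cong refl) (simp add: ifourier_lborel)
  ultimately show "ifourier K b - ifourier K a = (LINT x|lborel. indicator {a..b} x * ifourier ?H x)"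
    by (simp only: Bochner_Integration.integral_mult_right_zero)
qed

lemma ifourier_gauss_cutoff_tendsto:
  assumes K: "integrable lborel K"
  shows "(\<lambda>n. ifourier (gauss_cutoff K n) x) \<longlonglongrightarrow> ifourier K x"
proof -
  have [measurable]: "K \<in> borel_measurable borel" using K by auto
  have "(\<lambda>n. LINT v|lborel. gauss_cutoff K n v * cis (v * x)) \<longlonglongrightarrow> (LINT v|lborel. K v * cis (v * x))"
  proof (rule integral_dominated_convergence[where w="\<lambda>v. cmod (K v)"])
    show "AE v in lborel. (\<lambda>n. gauss_cutoff K n v * cis (v * x)) \<longlonglongrightarrow> K v * cis (v * x)"
      by (intro AE_I2 tendsto_intros gauss_cutoff_tendsto)
  qed (use K in \<open>auto simp: norm_mult norm_gauss_cutoff_le\<close>)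
  from tendsto_mult_left[OF this, of "complex_of_real (1 / sqrt (2 * pi))"] show ?thesis
    by (simp add: ifourier_lborel)
qed

text \<open>Mean-square convergence controls integrals over a bounded interval, by Cauchy-Schwarz
  against its indicator.\<close>

lemma integral_tendsto_of_energy:
  assumes [measurable]: "\<And>n. X n \<in> borel_measurable borel" "\<psi> \<in> borel_measurable borel"
    and X: "\<And>n. integrable lborel (\<lambda>x. indicator {a..b} x * X n x)"
    and \<psi>: "integrable lborel (\<lambda>x. indicator {a..b} x * \<psi> x)"
    and lim: "(\<lambda>n. energy (\<lambda>x. X n x - \<psi> x)) \<longlonglongrightarrow> 0"
  shows "(\<lambda>n. LINT x|lborel. indicator {a..b} x * X n x) \<longlonglongrightarrow> (LINT x|lborel. indicator {a..b} x * \<psi> x)"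
proof -
  define D where "D n = (LINT x|lborel. indicator {a..b} x * X n x) - (LINT x|lborel. indicator {a..b} x * \<psi> x)" for n
  have le: "ennreal ((cmod (D n))\<^sup>2) \<le> emeasure lborel {a..b} * energy (\<lambda>x. X n x - \<psi> x)" for n
  proof -
    have "D n = (LINT x|lborel. indicator {a..b} x * X n x - indicator {a..b} x * \<psi> x)"
      unfolding D_def using X \<psi> by simp
    also have "ennreal (cmod \<dots>) \<le> (\<integral>\<^sup>+x. ennreal (cmod (indicator {a..b} x * X n x - indicator {a..b} x * \<psi> x)) \<partial>lborel)"
      using X \<psi> by (intro integral_norm_bound_ennreal) auto
    also have "\<dots> = (\<integral>\<^sup>+x. indicator {a..b} x * ennreal (cmod (X n x - \<psi> x)) \<partial>lborel)"
      by (intro nn_integral_cong) (auto split: split_indicator)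
    finally have "(ennreal (cmod (D n)))\<^sup>2 \<le> (\<integral>\<^sup>+x. indicator {a..b} x * ennreal (cmod (X n x - \<psi> x)) \<partial>lborel)\<^sup>2"
      by (intro power_mono) auto
    also have "\<dots> \<le> (\<integral>\<^sup>+x. (indicator {a..b} x)\<^sup>2 \<partial>lborel) * (\<integral>\<^sup>+x. (ennreal (cmod (X n x - \<psi> x)))\<^sup>2 \<partial>lborel)"
      by (rule Cauchy_Schwarz_nn_integral) measurable
    also have "(\<lambda>x. (indicator {a..b} x :: ennreal)\<^sup>2) = indicator {a..b}"
      by (auto split: split_indicator)
    finally show ?thesis by (simp add: energy_def ennreal_power)
  qed
  have "(\<lambda>n. emeasure lborel {a..b} * energy (\<lambda>x. X n x - \<psi> x)) \<longlonglongrightarrow> emeasure lborel {a..b} * 0"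
    by (intro ennreal_tendsto_cmult lim) (auto simp: emeasure_lborel_Icc_eq)
  then have "(\<lambda>n. ennreal ((cmod (D n))\<^sup>2)) \<longlonglongrightarrow> 0"
    using le by (intro ennreal_tendsto_0_le[where g="\<lambda>n. ennreal ((cmod (D n))\<^sup>2)"]) auto
  then have "(\<lambda>n. (cmod (D n))\<^sup>2) \<longlonglongrightarrow> 0"
    by (subst (asm) ennreal_0[symmetric], subst (asm) tendsto_ennreal_iff) auto
  then have "(\<lambda>n. sqrt ((cmod (D n))\<^sup>2)) \<longlonglongrightarrow> sqrt 0" by (rule tendsto_real_sqrt)
  then have "D \<longlonglongrightarrow> 0" by (simp add: tendsto_norm_zero_iff)
  then show ?thesis unfolding D_def by (simp add: LIM_zero_iff)
qed

text \<open>The top-order version, where ivK need not be integrable. The previous identity holds for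
  the Gaussian cutoffs; its left side converges pointwise because \<open>K\<close> is integrable,
  its right side because the inverse transforms of the cutoffs converge in the mean to
  \<psi>.\<close>

lemma indef_integral_ifourier_L2:
  assumes K: "integrable lborel K" "K \<in> bcontfun" and H: "H \<in> bcontfun" "\<And>v. H v = \<i> * complex_of_real v * K v"
    and \<psi>: "\<psi> \<in> borel_measurable borel" "energy \<psi> < \<infinity>"
    and lim: "(\<lambda>n. energy (\<lambda>x. ifourier (gauss_cutoff H n) x - \<psi> x)) \<longlonglongrightarrow> 0"
  shows "indef_integral (ifourier K) \<psi>"
  unfolding indef_integral_def
proof (intro allI impI conjI)
  fix a b :: real assume ab: "a \<le> b"
  show i: "integrable lborel (\<lambda>x. indicator {a..b} x * \<psi> x)" by (rule integrable_indicator_energy[OF \<psi>])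
  have HK: "gauss_cutoff H n = (\<lambda>v. \<i> * complex_of_real v * gauss_cutoff K n v)" for n
    by (auto simp: gauss_cutoff_def H(2))
  have ind: "indef_integral (ifourier (gauss_cutoff K n)) (ifourier (gauss_cutoff H n))" for n
    unfolding HK using integrable_gauss_cutoff[OF H(1), of n] unfolding HK
    by (rule indef_integral_ifourier[OF integrable_gauss_cutoff[OF K(2)]])
  have "(\<lambda>n. LINT x|lborel. indicator {a..b} x * ifourier (gauss_cutoff H n) x) \<longlonglongrightarrow> (LINT x|lborel. indicator {a..b} x * \<psi> x)"
    using ind ab
    by (intro integral_tendsto_of_energy[OF _ \<psi>(1) _ i lim] borel_measurable_ifourier integrable_gauss_cutoff H)
      (auto simp: indef_integral_def)
  moreover have "(LINT x|lborel. indicator {a..b} x * ifourier (gauss_cutoff H n) x)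
     = ifourier (gauss_cutoff K n) b - ifourier (gauss_cutoff K n) a" for n
    using ind ab by (simp add: indef_integral_def)
  ultimately have "(\<lambda>n. ifourier (gauss_cutoff K n) b - ifourier (gauss_cutoff K n) a) \<longlonglongrightarrow> (LINT x|lborel. indicator {a..b} x * \<psi> x)"
    by simp
  moreover have "(\<lambda>n. ifourier (gauss_cutoff K n) b - ifourier (gauss_cutoff K n) a) \<longlonglongrightarrow> ifourier K b - ifourier K a"
    by (intro tendsto_diff ifourier_gauss_cutoff_tendsto K)
  ultimately show "ifourier K b - ifourier K a = (LINT x|lborel. indicator {a..b} x * \<psi> x)"
    using LIMSEQ_unique by blast
qed

text \<open>The whole chain \<phi> is returned, not just the fact that a derivative exists, because
  it is later compared member by member with the chain of another version.\<close>

theorem has_L2_derivative_ifourier: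
  fixes s :: nat
  assumes s: "0 < s" and int: "\<And>k. k < s \<Longrightarrow> integrable lborel (\<lambda>v. (\<i> * complex_of_real v) ^ k * F v)"
    and bc: "\<And>k. k \<le> s \<Longrightarrow> (\<lambda>v. (\<i> * complex_of_real v) ^ k * F v) \<in> bcontfun"
    and H: "energy (\<lambda>v. (\<i> * complex_of_real v) ^ s * F v) < \<infinity>"
  obtains g \<phi> where "has_fourier_L2 g (\<lambda>v. (\<i> * complex_of_real v) ^ s * F v)"
    "\<phi> 0 = ifourier F" "g \<in> borel_measurable borel" "energy g < \<infinity>"
    "\<And>k. k < s \<Longrightarrow> locally_abs_continuous (\<phi> k)"
    "\<And>k x. Suc k < s \<Longrightarrow> (\<phi> k has_vector_derivative \<phi> (Suc k) x) (at x)"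
    "\<And>k. Suc k = s \<Longrightarrow> AE x in lebesgue. (\<phi> k has_vector_derivative \<phi> (Suc k) x) (at x)"
    "\<And>k. k \<le> s \<Longrightarrow> square_integrable (\<phi> k)" "\<phi> s = g"
proof -
  define K where "K k v = (\<i> * complex_of_real v) ^ k * F v" for k v
  have Keq: "K k = (\<lambda>v. (\<i> * complex_of_real v) ^ k * F v)" for k by (auto simp: K_def)
  note int' = int[folded Keq] and bc' = bc[folded Keq]
  have KS: "K (Suc k) = (\<lambda>v. \<i> * complex_of_real v * K k v)" for k by (auto simp: K_def mult_ac)
  obtain g where g: "g \<in> borel_measurable borel" "energy g < \<infinity>" "has_fourier_L2 g (K s)"
    "(\<lambda>n. energy (\<lambda>x. ifourier (gauss_cutoff (K s) n) x - g x)) \<longlonglongrightarrow> 0"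
    by (rule has_fourier_L2_exists[OF bc'[OF order_refl] H[folded Keq]]) (rule that)
  \<comment> \<open>Below order s the inverse transforms converge absolutely; at order s only the
    limit in the mean is available.\<close>
  define \<phi> where "\<phi> k = (if k < s then ifourier (K k) else g)" for k
  have en: "energy (\<phi> k) < \<infinity>" for k
  proof (cases "k < s")
    case True
    obtain B where B: "\<And>v. cmod (K k v) \<le> B" using bcontfunE[OF bc'[OF less_imp_le[OF True]]] by metis
    show ?thesis
      using True energy_ifourier[OF int'[OF True] bc'[OF less_imp_le[OF True]]] energy_finite_of_bounded[OF int'[OF True] B]
      by (simp add: \<phi>_def)
  qed (use g(2) in \<open>simp add: \<phi>_def\<close>)
  have m: "\<phi> k \<in> borel_measurable borel" for k
    using g borel_measurable_ifourier[OF int'] by (auto simp: \<phi>_def)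
  have ind: "indef_integral (\<phi> k) (\<phi> (Suc k))" if "k < s" for k
  proof (cases "Suc k < s")
    case True
    then show ?thesis using indef_integral_ifourier[OF int'[of k], folded KS, OF _ int'[of "Suc k"]] by (simp add: \<phi>_def)
  next
    case False
    then have "Suc k = s" using that by simp
    then show ?thesis
      using indef_integral_ifourier_L2[OF int'[of k] bc'[of k] bc'[of s] _ g(1,2,4)] KS[of k] by (auto simp: \<phi>_def)
  qed
  show ?thesis
  proof (rule that[of g \<phi>])
    show "has_fourier_L2 g (\<lambda>v. (\<i> * complex_of_real v) ^ s * F v)" using g(3) unfolding Keq .
    show "\<phi> 0 = ifourier F" using s by (simp add: \<phi>_def Keq)
    show "locally_abs_continuous (\<phi> k)" if "k < s" for k
      using indef_integral_locally_abs_continuous[OF ind[OF that] m en] .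
    show "(\<phi> k has_vector_derivative \<phi> (Suc k) x) (at x)" if "Suc k < s" for k x
    proof (rule indef_integral_deriv_continuous)
      show "indef_integral (\<phi> k) (\<phi> (Suc k))" using ind[of k] that by simp
      show "continuous_on UNIV (\<phi> (Suc k))"
        using bcontfun_ifourier[OF int'[OF that]] that by (simp add: \<phi>_def bcontfun_def)
    qed
    show "AE x in lebesgue. (\<phi> k has_vector_derivative \<phi> (Suc k) x) (at x)" if "Suc k = s" for k
    proof (rule AE_completion, rule indef_integral_AE_deriv)
      show "indef_integral (\<phi> k) (\<phi> (Suc k))" using ind[of k] that by simp
      show "continuous_on UNIV (ifourier (gauss_cutoff (K s) n))" for n
        using bcontfun_ifourier[OF integrable_gauss_cutoff[OF bc'[OF order_refl]]] by (simp add: bcontfun_def)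
      show "(\<lambda>n. energy (\<lambda>x. ifourier (gauss_cutoff (K s) n) x - \<phi> (Suc k) x)) \<longlonglongrightarrow> 0"
        using g(4) that by (simp add: \<phi>_def)
    qed (rule m)
    show "square_integrable (\<phi> k)" for k
      using m en by (auto simp: square_integrable_iff_energy intro: borel_imp_lebesgue)
  qed (use g(1,2) in \<open>simp_all add: \<phi>_def\<close>)
qed

text \<open>Below the top order the derivatives of two versions agree everywhere, because they exist
  everywhere; so no integration of an almost everywhere derivative is needed.\<close>

theorem has_L2_derivative_fourier:
  fixes s :: nat
  assumes s: "2 \<le> s" and int: "\<And>k. k < s \<Longrightarrow> integrable lborel (\<lambda>v. (\<i> * complex_of_real v) ^ k * F v)"
    and bc: "\<And>k. k \<le> s \<Longrightarrow> (\<lambda>v. (\<i> * complex_of_real v) ^ k * F v) \<in> bcontfun"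
    and H: "energy (\<lambda>v. (\<i> * complex_of_real v) ^ s * F v) < \<infinity>"
  shows "\<exists>g. has_L2_derivative s (ifourier F) g"
    and "\<And>g. has_L2_derivative s (ifourier F) g \<Longrightarrow> has_fourier_L2 g (\<lambda>v. (\<i> * complex_of_real v) ^ s * F v)"
proof -
  from s have "0 < s" by simp
  then obtain g \<phi> where g: "has_fourier_L2 g (\<lambda>v. (\<i> * complex_of_real v) ^ s * F v)"
    "\<phi> 0 = ifourier F" "g \<in> borel_measurable borel" "energy g < \<infinity>"
    "\<And>k. k < s \<Longrightarrow> locally_abs_continuous (\<phi> k)"
    "\<And>k x. Suc k < s \<Longrightarrow> (\<phi> k has_vector_derivative \<phi> (Suc k) x) (at x)"
    "\<And>k. Suc k = s \<Longrightarrow> AE x in lebesgue. (\<phi> k has_vector_derivative \<phi> (Suc k) x) (at x)"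
    "\<And>k. k \<le> s \<Longrightarrow> square_integrable (\<phi> k)" "\<phi> s = g"
    by (rule has_L2_derivative_ifourier[where F=F]) (erule int | erule bc | rule H | rule that)+
  have "has_L2_derivative s (ifourier F) g"
    unfolding has_L2_derivative_def
  proof (intro exI[of _ \<phi>] conjI allI impI)
    show "square_integrable g" using g(8)[of s] g(9) by simp
    show "AE x in lebesgue. ifourier F x = \<phi> 0 x" "AE x in lebesgue. g x = \<phi> s x" using g(2,9) by simp_all
  qed (rule g(5-8); assumption)+
  then show "\<exists>g. has_L2_derivative s (ifourier F) g" by blast
  fix g' assume "has_L2_derivative s (ifourier F) g'"
  then obtain \<Phi> where \<Phi>: "AE x in lebesgue. ifourier F x = \<Phi> 0 x"
    "\<And>k x. Suc k < s \<Longrightarrow> (\<Phi> k has_vector_derivative \<Phi> (Suc k) x) (at x)"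
    "\<And>k. Suc k = s \<Longrightarrow> AE x in lebesgue. (\<Phi> k has_vector_derivative \<Phi> (Suc k) x) (at x)"
    "square_integrable g'" "AE x in lebesgue. g' x = \<Phi> s x"
    unfolding has_L2_derivative_def by blast
  have eq: "k < s \<Longrightarrow> \<Phi> k = \<phi> k" for k
  proof (induction k)
    case 0
    \<comment> \<open>Here 2 \<le> s enters: \<Phi> 0 is differentiable everywhere, hence
      continuous, and so coincides with the inverse transform at every point.\<close>
    have "continuous_on UNIV (\<Phi> 0)"
      using \<Phi>(2)[of 0] s by (auto simp: continuous_on_eq_continuous_at intro!: has_vector_derivative_continuous)
    moreover have "continuous_on UNIV (ifourier F)"
      using bcontfun_ifourier[of F] int[of 0] s by (simp add: bcontfun_def)
    ultimately show ?case using continuous_AE_eq[OF \<Phi>(1)] g(2) by simp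
  next
    case (Suc k)
    then have "(\<phi> k has_vector_derivative \<Phi> (Suc k) x) (at x)" for x using \<Phi>(2)[of k x] by simp
    then show ?case using g(6)[OF Suc.prems] vector_derivative_unique_at by blast
  qed
  define k where "k = s - 1"
  have k: "Suc k = s" using s by (simp add: k_def)
  have "AE x in lebesgue. g' x = g x"
    using \<Phi>(3)[OF k] g(7)[OF k] \<Phi>(5)
  proof eventually_elim
    case (elim x)
    then have "\<Phi> s x = \<phi> s x" using eq[of k] k vector_derivative_unique_at by fastforce
    then show ?case using elim(3) g(9) by simp
  qed
  then show "has_fourier_L2 g' (\<lambda>v. (\<i> * complex_of_real v) ^ s * F v)"
    using has_fourier_L2_cong_AE[OF g(1) \<Phi>(4)] by simp
qed

section \<open>Strong Riesz derivatives\<close>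

lemma integrable_lborel_of_nonneg_integrable_on:
  fixes f :: "real \<Rightarrow> real"
  assumes "f integrable_on S" "\<And>x. x \<in> S \<Longrightarrow> 0 \<le> f x" "(\<lambda>x. indicator S x * f x) \<in> borel_measurable borel"
  shows "integrable lborel (\<lambda>x. indicator S x * f x)"
proof -
  have "f absolutely_integrable_on S" using assms(1,2) by (intro nonnegative_absolutely_integrable_1) auto
  then have "integrable lebesgue (\<lambda>x. indicator S x * f x)" by (simp add: set_integrable_def)
  then show ?thesis using assms(3) by (subst (asm) integrable_completion) auto
qed

lemma integrable_powr_tail:
  assumes "1 < \<beta>" "0 < \<epsilon>"
  shows "integrable lborel (\<lambda>u. indicator {\<epsilon><..} u / u powr \<beta> :: real)"
proof -
  have "integrable lborel (\<lambda>u. indicator {\<epsilon>..} u * u powr - \<beta> :: real)"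
    using has_integral_powr_to_inf[of "- \<beta>" \<epsilon>] assms
    by (intro integrable_lborel_of_nonneg_integrable_on) auto
  then show ?thesis
    by (rule Bochner_Integration.integrable_bound)
      (auto intro!: AE_I2 simp: powr_minus divide_inverse split: split_indicator)
qed

definition riesz_kernel :: "real \<Rightarrow> nat \<Rightarrow> real \<Rightarrow> real" where
  "riesz_kernel \<alpha> j w = indicator {0<..} w * (sin w ^ (2 * j) / w powr (1 + \<alpha>))"

lemma riesz_kernel_nonneg: "0 \<le> riesz_kernel \<alpha> j w"
  by (simp add: riesz_kernel_def)

lemma riesz_kernel_measurable [measurable]: "riesz_kernel \<alpha> j \<in> borel_measurable borel"
  unfolding riesz_kernel_def[abs_def] by measurable

text \<open>Near 0 the bound |sin w| \<le> w leaves the power 2j - 1 - \<alpha>, integrable because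
  \<alpha> < 2j; at infinity |sin w| \<le> 1 leaves -1 - \<alpha>, integrable because \<alpha> >
  0.\<close>

lemma riesz_kernel_integrable:
  assumes \<alpha>: "0 < \<alpha>" "\<alpha> < 2 * real j"
  shows "integrable lborel (riesz_kernel \<alpha> j)"
proof -
  have "integrable lborel (\<lambda>w. indicator {0..1} w * w powr (2 * real j - 1 - \<alpha>) :: real)"
    using integrable_on_powr_from_0[of "2 * real j - 1 - \<alpha>" 1] \<alpha>
    by (intro integrable_lborel_of_nonneg_integrable_on) auto
  moreover have "integrable lborel (\<lambda>u. indicator {1..} u * u powr (-1 - \<alpha>) :: real)"
    using has_integral_powr_to_inf[of "-1 - \<alpha>" 1] \<alpha>
    by (intro integrable_lborel_of_nonneg_integrable_on) auto
  ultimately have "integrable lborel (\<lambda>w. indicator {0..1} w * w powr (2 * real j - 1 - \<alpha>) + indicator {1..} w * w powr (-1 - \<alpha>) :: real)"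
    by (rule Bochner_Integration.integrable_add)
  then show ?thesis
  proof (rule Bochner_Integration.integrable_bound)
    have "riesz_kernel \<alpha> j w \<le> indicator {0..1} w * w powr (2 * real j - 1 - \<alpha>) + indicator {1..} w * w powr (-1 - \<alpha>)" for w
    proof (cases "0 < w \<and> w \<le> 1")
      case True
      have "\<bar>sin w\<bar> \<le> w" using abs_sin_x_le_abs_x[of w] True by simp
      then have "\<bar>sin w\<bar> ^ (2 * j) \<le> w ^ (2 * j)" by (intro power_mono) auto
      then have "sin w ^ (2 * j) / w powr (1 + \<alpha>) \<le> w powr (2 * real j) / w powr (1 + \<alpha>)"
        using True by (intro divide_right_mono) (auto simp: powr_realpow[symmetric] power_abs power_even_abs)
      also have "\<dots> = w powr (2 * real j - 1 - \<alpha>)" by (simp add: powr_diff[symmetric] algebra_simps)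
      finally show ?thesis using True by (auto simp: riesz_kernel_def split: split_indicator)
    next
      case False
      have "sin w ^ (2 * j) / w powr (1 + \<alpha>) \<le> w powr (-1 - \<alpha>)" if "1 < w"
      proof -
        have "\<bar>sin w\<bar> ^ (2 * j) \<le> 1" by (intro power_le_one) auto
        then have "sin w ^ (2 * j) / w powr (1 + \<alpha>) \<le> 1 / w powr (1 + \<alpha>)"
          by (intro divide_right_mono) (auto simp: power_abs power_even_abs)
        also have "\<dots> = w powr (-1 - \<alpha>)" using powr_minus_divide[of w "1 + \<alpha>"] by simp
        finally show ?thesis .
      qed
      then show ?thesis using False by (auto simp: riesz_kernel_def split: split_indicator)
    qed
    then show "AE w in lborel. norm (riesz_kernel \<alpha> j w) \<le> norm (indicator {0..1} w * w powr (2 * real j - 1 - \<alpha>) + indicator {1..} w * w powr (-1 - \<alpha>))"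
      using riesz_kernel_nonneg by (intro AE_I2) (simp add: abs_of_nonneg)
  qed measurable
qed

text \<open>After rescaling, the Riesz integral truncated at \<epsilon> acts on frequency v through
  the tail from \<epsilon>|v|/2; the full mass, at \<rho> = 0, is the integral in the Riesz
  constant.\<close>

definition riesz_tail :: "real \<Rightarrow> nat \<Rightarrow> real \<Rightarrow> real" where
  "riesz_tail \<alpha> j \<rho> = (LINT w|lborel. indicator {\<rho><..} w * riesz_kernel \<alpha> j w)"

lemma integrable_riesz_tail:
  assumes "0 < \<alpha>" "\<alpha> < 2 * real j"
  shows "integrable lborel (\<lambda>w. indicator {\<rho><..} w * riesz_kernel \<alpha> j w)"
  by (rule Bochner_Integration.integrable_bound[OF riesz_kernel_integrable[OF assms]]) (auto split: split_indicator)

lemma riesz_tail_mono: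
  assumes "0 < \<alpha>" "\<alpha> < 2 * real j" "0 \<le> \<rho>"
  shows "0 \<le> riesz_tail \<alpha> j \<rho>" "riesz_tail \<alpha> j \<rho> \<le> riesz_tail \<alpha> j 0"
  unfolding riesz_tail_def using assms riesz_kernel_nonneg
  by (auto intro!: integral_nonneg_AE integral_mono integrable_riesz_tail split: split_indicator)

lemma riesz_tail_tendsto:
  assumes \<alpha>: "0 < \<alpha>" "\<alpha> < 2 * real j" and \<rho>: "\<rho> \<longlonglongrightarrow> 0" "\<And>n. 0 \<le> \<rho> n"
  shows "(\<lambda>n. riesz_tail \<alpha> j (\<rho> n)) \<longlonglongrightarrow> riesz_tail \<alpha> j 0"
  unfolding riesz_tail_def
proof (rule integral_dominated_convergence[where w="riesz_kernel \<alpha> j"])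
  have "(\<lambda>n. indicator {\<rho> n<..} w * riesz_kernel \<alpha> j w) \<longlonglongrightarrow> indicator {0<..} w * riesz_kernel \<alpha> j w" for w
  proof (cases "0 < w")
    case True
    have "\<forall>\<^sub>F n in sequentially. \<rho> n < w" using order_tendstoD(2)[OF \<rho>(1) True] .
    then show ?thesis
      by (intro tendsto_eventually) (auto elim!: eventually_mono simp: True split: split_indicator)
  next
    case False
    then have "\<not> \<rho> n < w" for n using \<rho>(2)[of n] by linarith
    with False show ?thesis by simp
  qed
  then show "AE w in lborel. (\<lambda>n. indicator {\<rho> n<..} w * riesz_kernel \<alpha> j w) \<longlonglongrightarrow> indicator {0<..} w * riesz_kernel \<alpha> j w"
    by simp
qed (use riesz_kernel_integrable[OF \<alpha>] riesz_kernel_nonneg in \<open>auto split: split_indicator\<close>)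

text \<open>The kernel is positive on ]0, \<pi>[, which is not a null set. This justifies division
  by the Riesz constant.\<close>

lemma riesz_tail_0_pos:
  assumes \<alpha>: "0 < \<alpha>" "\<alpha> < 2 * real j"
  shows "0 < riesz_tail \<alpha> j 0"
proof (rule ccontr)
  assume "\<not> 0 < riesz_tail \<alpha> j 0"
  then have "(LINT w|lborel. indicator {0<..} w * riesz_kernel \<alpha> j w) = 0"
    using riesz_tail_mono(1)[OF \<alpha>, of 0] by (simp add: riesz_tail_def)
  then have "AE w in lborel. indicator {0<..} w * riesz_kernel \<alpha> j w = 0"
    using integrable_riesz_tail[OF \<alpha>] riesz_kernel_nonneg by (subst (asm) integral_nonneg_eq_0_iff_AE) auto
  then have "AE w in lebesgue. indicator {0<..} w * riesz_kernel \<alpha> j w = 0" by (rule AE_completion)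
  then obtain N where N: "negligible N" "{w. indicator {0<..} w * riesz_kernel \<alpha> j w \<noteq> 0} \<subseteq> N"
    unfolding eventually_ae_filter_negligible by blast
  have "{0<..<pi} \<subseteq> N"
  proof
    fix w :: real assume "w \<in> {0<..<pi}"
    then have "sin w > 0" by (simp add: sin_gt_zero)
    with \<open>w \<in> {0<..<pi}\<close> show "w \<in> N" using N(2) by (auto simp: riesz_kernel_def)
  qed
  then have "negligible {0<..<pi}" using N(1) negligible_subset by blast
  then show False using open_not_negligible[of "{0<..<pi}"] pi_gt_zero by force
qed

lemma riesz_constant_eq:
  "riesz_constant \<alpha> j = (-1) ^ j * 2 powr (2 * real j - \<alpha>) * riesz_tail \<alpha> j 0"
proof -
  have "(LINT u:{0<..}|lebesgue. sin u ^ (2 * j) / u powr (1 + \<alpha>)) = (LINT u|lebesgue. riesz_kernel \<alpha> j u)"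
    unfolding set_lebesgue_integral_def riesz_kernel_def by simp
  also have "\<dots> = (LINT u|lborel. riesz_kernel \<alpha> j u)" by (rule integral_completion) measurable
  also have "\<dots> = riesz_tail \<alpha> j 0"
    unfolding riesz_tail_def by (intro Bochner_Integration.integral_cong) (auto simp: riesz_kernel_def split: split_indicator)
  finally show ?thesis by (simp add: riesz_constant_def)
qed

section \<open>Fourier multipliers of central differences and truncated Riesz integrals\<close>

definition diff_symbol :: "nat \<Rightarrow> real \<Rightarrow> real" where
  "diff_symbol j t = (-1) ^ j * 4 ^ j * sin (t / 2) ^ (2 * j)"

lemma diff_symbol_measurable [measurable]: "diff_symbol j \<in> borel_measurable borel"
  unfolding diff_symbol_def[abs_def] by measurable

lemma continuous_diff_symbol: "continuous_on UNIV (diff_symbol j)"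
  unfolding diff_symbol_def[abs_def] by (intro continuous_intros) auto

lemma abs_diff_symbol_le: "\<bar>diff_symbol j t\<bar> \<le> 4 ^ j"
proof -
  have "\<bar>sin (t / 2)\<bar> ^ (2 * j) \<le> 1" by (intro power_le_one) auto
  then show ?thesis by (simp add: diff_symbol_def abs_mult power_abs)
qed

text \<open>This is the binomial theorem for \<open>(cis (t/2) - cis (-t/2)) ^ (2j)\<close>.\<close>

lemma sum_binomial_cis:
  "(\<Sum>k = 0..2 * j. (-1) ^ k * of_nat ((2 * j) choose k) * cis ((real j - real k) * t)) = complex_of_real (diff_symbol j t)"
proof -
  have "complex_of_real (diff_symbol j t) = (2 * \<i> * complex_of_real (sin (t / 2))) ^ (2 * j)"
    by (simp add: diff_symbol_def power_mult power_mult_distrib) (simp flip: power_mult_distrib)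
  also have "2 * \<i> * complex_of_real (sin (t / 2)) = - cis (- (t / 2)) + cis (t / 2)"
    by (simp add: complex_eq_iff)
  also have "\<dots> ^ (2 * j) = (\<Sum>k\<le>2 * j. of_nat ((2 * j) choose k) * (- cis (- (t / 2))) ^ k * cis (t / 2) ^ (2 * j - k))"
    by (rule binomial_ring)
  also have "\<dots> = (\<Sum>k\<le>2 * j. (-1) ^ k * of_nat ((2 * j) choose k) * cis ((real j - real k) * t))"
  proof (intro sum.cong refl)
    fix k assume "k \<in> {..2 * j}"
    then have r: "real (2 * j - k) = 2 * real j - real k" by (simp add: of_nat_diff)
    have "real k * - (t / 2) + real (2 * j - k) * (t / 2) = (real j - real k) * t"
      unfolding r by (simp add: field_simps)
    then have "cis (- (t / 2)) ^ k * cis (t / 2) ^ (2 * j - k) = cis ((real j - real k) * t)"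
      by (simp only: Complex.DeMoivre cis_mult)
    moreover have "(- cis (- (t / 2))) ^ k = (-1) ^ k * cis (- (t / 2)) ^ k" by (rule power_minus)
    ultimately show "of_nat ((2 * j) choose k) * (- cis (- (t / 2))) ^ k * cis (t / 2) ^ (2 * j - k)
      = (-1) ^ k * of_nat ((2 * j) choose k) * cis ((real j - real k) * t)"
      by (simp add: mult_ac)
  qed
  finally show ?thesis by (simp add: atLeast0AtMost)
qed

lemma central_difference_ifourier:
  assumes F: "integrable lborel F"
  shows "central_difference j u (ifourier F) x
     = complex_of_real (1 / sqrt (2 * pi)) * (LINT v|lborel. (F v * cis (v * x)) * complex_of_real (diff_symbol j (u * v)))"
proof -
  have [measurable]: "F \<in> borel_measurable borel" using F by auto
  let ?c = "\<lambda>k. (-1) ^ k * of_nat ((2 * j) choose k) :: complex"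
  have gen: "c * (d * (LINT v|lborel. g v)) = d * (LINT v|lborel. c * g v)" for c d and g :: "real \<Rightarrow> complex"
    by simp
  have "central_difference j u (ifourier F) x
     = (\<Sum>k = 0..2 * j. ?c k * (complex_of_real (1 / sqrt (2 * pi)) * (LINT v|lborel. F v * cis (v * (x + (real j - real k) * u)))))"
    unfolding central_difference_def by (simp add: ifourier_lborel)
  also have "\<dots> = complex_of_real (1 / sqrt (2 * pi)) * (\<Sum>k = 0..2 * j. (LINT v|lborel. ?c k * (F v * cis (v * (x + (real j - real k) * u)))))"
    unfolding gen sum_distrib_left ..
  also have "(\<Sum>k = 0..2 * j. (LINT v|lborel. ?c k * (F v * cis (v * (x + (real j - real k) * u)))))
     = (LINT v|lborel. (\<Sum>k = 0..2 * j. ?c k * (F v * cis (v * (x + (real j - real k) * u)))))"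
    using F by (intro Bochner_Integration.integral_sum[symmetric] integrable_mult_right integrable_mult_cis) auto
  also have "(\<lambda>v. (\<Sum>k = 0..2 * j. ?c k * (F v * cis (v * (x + (real j - real k) * u)))))
      = (\<lambda>v. (F v * cis (v * x)) * complex_of_real (diff_symbol j (u * v)))"
  proof
    fix v
    show "(\<Sum>k = 0..2 * j. ?c k * (F v * cis (v * (x + (real j - real k) * u))))
      = (F v * cis (v * x)) * complex_of_real (diff_symbol j (u * v))"
      unfolding sum_binomial_cis[symmetric] sum_distrib_left
    proof (intro sum.cong refl)
      fix k
      have "cis (v * (x + (real j - real k) * u)) = cis (v * x) * cis ((real j - real k) * (u * v))"
        by (simp add: cis_mult algebra_simps)
      then show "?c k * (F v * cis (v * (x + (real j - real k) * u))) = F v * cis (v * x) * (?c k * cis ((real j - real k) * (u * v)))"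
        by (simp add: mult_ac)
    qed
  qed
  finally show ?thesis .
qed

text \<open>The multiplier by which the Riesz integral truncated at \<epsilon> acts on the
  transform; it should tend to |v|^\<alpha>.\<close>

definition riesz_symbol :: "real \<Rightarrow> nat \<Rightarrow> real \<Rightarrow> real \<Rightarrow> real" where
  "riesz_symbol \<alpha> j \<epsilon> v =
     (LINT u|lborel. indicator {\<epsilon><..} u / u powr (1 + \<alpha>) * diff_symbol j (u * v)) / riesz_constant \<alpha> j"

text \<open>Substitute u = 2w/|v|. The even power absorbs the sign of v, and the powers of 2 are
  exactly those in the Riesz constant. What remains is |v|^\<alpha> times a fraction of the kernel's
  mass, so \<open>j\<close> disappears in the limit.\<close>

lemma riesz_symbol_eq:
  assumes \<alpha>: "0 < \<alpha>" "\<alpha> < 2 * real j" and \<epsilon>: "0 < \<epsilon>"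
  shows "riesz_symbol \<alpha> j \<epsilon> v = \<bar>v\<bar> powr \<alpha> * (riesz_tail \<alpha> j (\<epsilon> * \<bar>v\<bar> / 2) / riesz_tail \<alpha> j 0)"
proof (cases "v = 0")
  case True
  have "0 < j" using \<alpha> by (cases j) auto
  then have "diff_symbol j 0 = 0" by (simp add: diff_symbol_def)
  then show ?thesis using True by (simp add: riesz_symbol_def)
next
  case False
  let ?c = "2 / \<bar>v\<bar>"
  have c: "?c > 0" using False by simp
  have "(LINT u|lborel. indicator {\<epsilon><..} u / u powr (1 + \<alpha>) * diff_symbol j (u * v))
    = \<bar>?c\<bar> *\<^sub>R (LINT w|lborel. indicator {\<epsilon><..} (0 + ?c * w) / (0 + ?c * w) powr (1 + \<alpha>) * diff_symbol j ((0 + ?c * w) * v))"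
    using c by (intro lborel_integral_real_affine) auto
  also have "\<dots> = (LINT w|lborel. ((-1) ^ j * 2 powr (2 * real j - \<alpha>) * \<bar>v\<bar> powr \<alpha>) * (indicator {\<epsilon> * \<bar>v\<bar> / 2<..} w * riesz_kernel \<alpha> j w))"
    unfolding integral_scaleR_right[symmetric]
  proof (intro Bochner_Integration.integral_cong refl)
    fix w
    have iff: "\<epsilon> < ?c * w \<longleftrightarrow> \<epsilon> * \<bar>v\<bar> / 2 < w" using False by (simp add: field_simps)
    show "\<bar>?c\<bar> *\<^sub>R (indicator {\<epsilon><..} (0 + ?c * w) / (0 + ?c * w) powr (1 + \<alpha>) * diff_symbol j ((0 + ?c * w) * v))
      = ((-1) ^ j * 2 powr (2 * real j - \<alpha>) * \<bar>v\<bar> powr \<alpha>) * (indicator {\<epsilon> * \<bar>v\<bar> / 2<..} w * riesz_kernel \<alpha> j w)"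
    proof (cases "\<epsilon> * \<bar>v\<bar> / 2 < w")
      case True
      then have w: "0 < w" using \<epsilon> by (meson abs_ge_zero divide_nonneg_pos less_le_trans less_imp_le linorder_not_le mult_nonneg_nonneg zero_less_numeral order_le_less_trans)
      have sgn: "?c * w * v / 2 = sgn v * w" using False by (cases "0 < v") (simp_all add: sgn_if)
      have s: "sin (?c * w * v / 2) ^ (2 * j) = sin w ^ (2 * j)"
        unfolding sgn using False by (auto simp: sgn_if power_mult)
      have E: "?c / (?c * w) powr (1 + \<alpha>) * 4 ^ j = 2 powr (2 * real j - \<alpha>) * \<bar>v\<bar> powr \<alpha> / w powr (1 + \<alpha>)"
      proof -
        have "(4::real) ^ j = 2 powr (2 * real j)" by (simp add: powr_powr[symmetric] powr_realpow)
        moreover have "(?c * w) powr (1 + \<alpha>) = ?c powr (1 + \<alpha>) * w powr (1 + \<alpha>)" by (rule powr_mult)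
        moreover have "?c powr (1 + \<alpha>) = ?c * (2 powr \<alpha> / \<bar>v\<bar> powr \<alpha>)"
          using c by (simp add: powr_add powr_divide)
        ultimately show ?thesis using False w c by (simp add: powr_diff field_simps)
      qed
      have "\<bar>?c\<bar> *\<^sub>R (indicator {\<epsilon><..} (0 + ?c * w) / (0 + ?c * w) powr (1 + \<alpha>) * diff_symbol j ((0 + ?c * w) * v))
        = ?c * (1 / (?c * w) powr (1 + \<alpha>) * ((-1) ^ j * 4 ^ j * sin (?c * w * v / 2) ^ (2 * j)))"
        using True iff by (simp add: diff_symbol_def)
      also have "\<dots> = (-1) ^ j * sin w ^ (2 * j) * (?c / (?c * w) powr (1 + \<alpha>) * 4 ^ j)"
        unfolding s by simp
      also have "\<dots> = ((-1) ^ j * 2 powr (2 * real j - \<alpha>) * \<bar>v\<bar> powr \<alpha>) * (indicator {\<epsilon> * \<bar>v\<bar> / 2<..} w * riesz_kernel \<alpha> j w)"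
        unfolding E using True w by (simp add: riesz_kernel_def)
      finally show ?thesis .
    qed (use iff in simp)
  qed
  also have "\<dots> = (-1) ^ j * 2 powr (2 * real j - \<alpha>) * \<bar>v\<bar> powr \<alpha> * riesz_tail \<alpha> j (\<epsilon> * \<bar>v\<bar> / 2)"
    by (simp add: riesz_tail_def)
  finally show ?thesis
    using riesz_tail_0_pos[OF \<alpha>] by (simp add: riesz_symbol_def riesz_constant_eq)
qed

text \<open>A fraction of a mass lies in [0, 1]. The resulting bound, uniform in \<epsilon>, is what
  makes the transform of the derivative itself a majorant.\<close>

lemma riesz_symbol_bounds:
  assumes \<alpha>: "0 < \<alpha>" "\<alpha> < 2 * real j" and \<epsilon>: "0 < \<epsilon>"
  shows "0 \<le> riesz_symbol \<alpha> j \<epsilon> v" "riesz_symbol \<alpha> j \<epsilon> v \<le> \<bar>v\<bar> powr \<alpha>"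
proof -
  have b: "0 \<le> riesz_tail \<alpha> j (\<epsilon> * \<bar>v\<bar> / 2) / riesz_tail \<alpha> j 0" "riesz_tail \<alpha> j (\<epsilon> * \<bar>v\<bar> / 2) / riesz_tail \<alpha> j 0 \<le> 1"
    using riesz_tail_0_pos[OF \<alpha>] riesz_tail_mono[OF \<alpha>, of "\<epsilon> * \<bar>v\<bar> / 2"] \<epsilon> by auto
  show "0 \<le> riesz_symbol \<alpha> j \<epsilon> v"
    unfolding riesz_symbol_eq[OF assms] by (rule mult_nonneg_nonneg[OF powr_ge_zero b(1)])
  show "riesz_symbol \<alpha> j \<epsilon> v \<le> \<bar>v\<bar> powr \<alpha>"
    unfolding riesz_symbol_eq[OF assms] by (rule mult_left_le[OF b(2) powr_ge_zero])
qed

lemma riesz_symbol_tendsto: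
  assumes \<alpha>: "0 < \<alpha>" "\<alpha> < 2 * real j" and \<epsilon>: "\<epsilon> \<longlonglongrightarrow> 0" "\<And>n. 0 < \<epsilon> n"
  shows "(\<lambda>n. riesz_symbol \<alpha> j (\<epsilon> n) v) \<longlonglongrightarrow> \<bar>v\<bar> powr \<alpha>"
proof -
  have "(\<lambda>n. \<epsilon> n * \<bar>v\<bar> / 2) \<longlonglongrightarrow> 0 * \<bar>v\<bar> / 2" by (intro tendsto_intros \<epsilon>) simp
  then have "(\<lambda>n. riesz_tail \<alpha> j (\<epsilon> n * \<bar>v\<bar> / 2)) \<longlonglongrightarrow> riesz_tail \<alpha> j 0"
    using \<epsilon>(2)[THEN less_imp_le] by (intro riesz_tail_tendsto[OF \<alpha>]) auto
  then have "(\<lambda>n. \<bar>v\<bar> powr \<alpha> * (riesz_tail \<alpha> j (\<epsilon> n * \<bar>v\<bar> / 2) / riesz_tail \<alpha> j 0))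
      \<longlonglongrightarrow> \<bar>v\<bar> powr \<alpha> * (riesz_tail \<alpha> j 0 / riesz_tail \<alpha> j 0)"
    using riesz_tail_0_pos[OF \<alpha>] by (intro tendsto_intros) auto
  then show ?thesis using riesz_tail_0_pos[OF \<alpha>] by (simp add: riesz_symbol_eq[OF \<alpha> \<epsilon>(2)])
qed

lemma tail_weight_diff_symbol_le:
  "norm (indicator {\<epsilon><..} u / u powr \<beta> * diff_symbol j t) \<le> indicator {\<epsilon><..} u / u powr \<beta> * 4 ^ j"
proof -
  have w: "0 \<le> indicator {\<epsilon><..} u / u powr \<beta>" by simp
  show ?thesis
    unfolding real_norm_def abs_mult abs_of_nonneg[OF w] by (intro mult_left_mono abs_diff_symbol_le w)
qed

lemma continuous_riesz_symbol:
  assumes \<alpha>: "0 < \<alpha>" and \<epsilon>: "0 < \<epsilon>"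
  shows "continuous_on UNIV (riesz_symbol \<alpha> j \<epsilon>)"
proof -
  have i: "integrable lborel (\<lambda>u. indicator {\<epsilon><..} u / u powr (1 + \<alpha>) :: real)"
    using integrable_powr_tail[of "1 + \<alpha>" \<epsilon>] \<alpha> \<epsilon> by simp
  have "isCont (\<lambda>v. LINT u|lborel. indicator {\<epsilon><..} u / u powr (1 + \<alpha>) * diff_symbol j (u * v)) v" for v
    unfolding continuous_at_sequentially
  proof (intro allI impI)
    fix X :: "nat \<Rightarrow> real" assume X: "X \<longlonglongrightarrow> v"
    have "isCont (diff_symbol j) t" for t
      using continuous_diff_symbol by (simp add: continuous_on_eq_continuous_at)
    then have "(\<lambda>n. diff_symbol j (u * X n)) \<longlonglongrightarrow> diff_symbol j (u * v)" for u
      by (intro isCont_tendsto_compose[of _ "diff_symbol j"] tendsto_intros X)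
    then have "AE u in lborel. (\<lambda>n. indicator {\<epsilon><..} u / u powr (1 + \<alpha>) * diff_symbol j (u * X n)) \<longlonglongrightarrow> indicator {\<epsilon><..} u / u powr (1 + \<alpha>) * diff_symbol j (u * v)"
      by (intro AE_I2 tendsto_mult_left)
    then have "(\<lambda>n. LINT u|lborel. indicator {\<epsilon><..} u / u powr (1 + \<alpha>) * diff_symbol j (u * X n))
       \<longlonglongrightarrow> (LINT u|lborel. indicator {\<epsilon><..} u / u powr (1 + \<alpha>) * diff_symbol j (u * v))"
    proof (rule integral_dominated_convergence[where w="\<lambda>u. indicator {\<epsilon><..} u / u powr (1 + \<alpha>) * 4 ^ j", rotated 3])
      show "AE u in lborel. norm (indicator {\<epsilon><..} u / u powr (1 + \<alpha>) * diff_symbol j (u * X n)) \<le> indicator {\<epsilon><..} u / u powr (1 + \<alpha>) * 4 ^ j" for n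
        by (intro AE_I2 tail_weight_diff_symbol_le)
      show "integrable lborel (\<lambda>u. indicator {\<epsilon><..} u / u powr (1 + \<alpha>) * 4 ^ j :: real)"
        by (rule integrable_mult_left, rule i)
    qed auto
    then show "((\<lambda>v. LINT u|lborel. indicator {\<epsilon><..} u / u powr (1 + \<alpha>) * diff_symbol j (u * v)) \<circ> X)
       \<longlonglongrightarrow> (LINT u|lborel. indicator {\<epsilon><..} u / u powr (1 + \<alpha>) * diff_symbol j (u * v))" by (simp add: o_def)
  qed
  then have "continuous_on UNIV (\<lambda>v. LINT u|lborel. indicator {\<epsilon><..} u / u powr (1 + \<alpha>) * diff_symbol j (u * v))"
    by (simp add: continuous_on_eq_continuous_at)
  then show ?thesis unfolding riesz_symbol_def[abs_def] divide_inverse by (intro continuous_intros)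
qed

abbreviation riesz_quotient :: "real \<Rightarrow> nat \<Rightarrow> (real \<Rightarrow> complex) \<Rightarrow> real \<Rightarrow> real \<Rightarrow> complex" where
  "riesz_quotient \<alpha> j f \<epsilon> x \<equiv> complex_of_real (1 / riesz_constant \<alpha> j) *
     (LINT u:{\<epsilon><..}|lebesgue. central_difference j u f x / complex_of_real (u powr (1 + \<alpha>)))"

text \<open>Truncation at \<epsilon> > 0 makes the weight integrable and the difference symbol is
  bounded, so Fubini applies and the identity holds at every x.\<close>

lemma riesz_integral_ifourier:
  assumes F: "integrable lborel F" "F \<in> bcontfun" and \<alpha>: "0 < \<alpha>" and \<epsilon>: "0 < \<epsilon>"
  shows "riesz_quotient \<alpha> j (ifourier F) \<epsilon> x
    = ifourier (\<lambda>v. F v * complex_of_real (riesz_symbol \<alpha> j \<epsilon> v)) x"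
proof -
  have [measurable]: "F \<in> borel_measurable borel" using F by auto
  have [measurable]: "riesz_symbol \<alpha> j \<epsilon> \<in> borel_measurable borel"
    by (rule borel_measurable_continuous_onI[OF continuous_riesz_symbol[OF \<alpha> \<epsilon>]])
  let ?k = "\<lambda>u. complex_of_real (indicator {\<epsilon><..} u / u powr (1 + \<alpha>))"
  let ?S = "\<lambda>u v. complex_of_real (diff_symbol j (u * v))"
  have k: "integrable lborel ?k"
    using integrable_powr_tail[of "1 + \<alpha>" \<epsilon>] \<alpha> \<epsilon> by (intro integrable_of_real) auto
  have Fc: "integrable lborel (\<lambda>v. F v * cis (v * x))" using F by (intro integrable_mult_cis) auto
  have F1: "(LINT u|lborel. ?k u * (LINT v|lborel. (F v * cis (v * x)) * ?S u v))
     = (LINT v|lborel. (F v * cis (v * x)) * (LINT u|lborel. ?k u * ?S u v))"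
    using Fubini_bounded_kernel[OF k Fc, of "\<lambda>p. complex_of_real (diff_symbol j (fst p * snd p))" "4 ^ j"] abs_diff_symbol_le
    by simp
  have "(LINT u:{\<epsilon><..}|lebesgue. central_difference j u (ifourier F) x / complex_of_real (u powr (1 + \<alpha>)))
     = (LINT u|lebesgue. complex_of_real (1 / sqrt (2 * pi)) * (?k u * (LINT v|lborel. (F v * cis (v * x)) * ?S u v)))"
    unfolding set_lebesgue_integral_def central_difference_ifourier[OF F(1)]
    by (intro Bochner_Integration.integral_cong refl) (auto simp: scaleR_conv_of_real split: split_indicator)
  also have "\<dots> = (LINT u|lborel. complex_of_real (1 / sqrt (2 * pi)) * (?k u * (LINT v|lborel. (F v * cis (v * x)) * ?S u v)))"
    by (rule integral_completion) measurable
  also have "\<dots> = complex_of_real (1 / sqrt (2 * pi)) * (LINT v|lborel. (F v * cis (v * x)) * (LINT u|lborel. ?k u * ?S u v))"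
    unfolding F1[symmetric] by (rule integral_mult_right_zero)
  also have "(\<lambda>v. (F v * cis (v * x)) * (LINT u|lborel. ?k u * ?S u v))
     = (\<lambda>v. (F v * cis (v * x)) * complex_of_real (LINT u|lborel. indicator {\<epsilon><..} u / u powr (1 + \<alpha>) * diff_symbol j (u * v)))"
    unfolding of_real_mult[symmetric] integral_complex_of_real ..
  finally have *: "(LINT u:{\<epsilon><..}|lebesgue. central_difference j u (ifourier F) x / complex_of_real (u powr (1 + \<alpha>)))
    = complex_of_real (1 / sqrt (2 * pi)) * (LINT v|lborel. (F v * cis (v * x)) * complex_of_real (LINT u|lborel. indicator {\<epsilon><..} u / u powr (1 + \<alpha>) * diff_symbol j (u * v)))" .
  have eq: "complex_of_real (1 / r) * (c * (LINT v|lborel. a v * complex_of_real (b v))) = c * (LINT v|lborel. a v * complex_of_real (b v / r))"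
    for r c and a :: "real \<Rightarrow> complex" and b
    by (simp add: divide_inverse mult_ac flip: integral_mult_right_zero)
  have "riesz_quotient \<alpha> j (ifourier F) \<epsilon> x
    = complex_of_real (1 / sqrt (2 * pi)) * (LINT v|lborel. (F v * cis (v * x)) * complex_of_real (riesz_symbol \<alpha> j \<epsilon> v))"
    unfolding * eq riesz_symbol_def ..
  also have "\<dots> = ifourier (\<lambda>v. F v * complex_of_real (riesz_symbol \<alpha> j \<epsilon> v)) x"
    by (subst ifourier_lborel) (simp_all add: mult_ac)
  finally show ?thesis .
qed

text \<open>Plancherel's identity against a limit in the mean, up to a factor: pass through the n-th
  cutoff on both sides and let n grow. The factor 4 comes from using the triangle inequality for
  energies twice.\<close>

lemma energy_ifourier_diff_L2:
  assumes K: "integrable lborel K" "K \<in> bcontfun" and H: "H \<in> bcontfun" "energy H < \<infinity>" and [measurable]: "\<psi> \<in> borel_measurable borel"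
    and lim: "(\<lambda>n. energy (\<lambda>x. ifourier (gauss_cutoff H n) x - \<psi> x)) \<longlonglongrightarrow> 0"
  shows "energy (\<lambda>x. ifourier K x - \<psi> x) \<le> 4 * energy (\<lambda>v. K v - H v)"
proof -
  note ig = integrable_gauss_cutoff[OF H(1)] and bg = gauss_cutoff_bcontfun[OF H(1)]
  have [measurable]: "K \<in> borel_measurable borel" "H \<in> borel_measurable borel" "ifourier K \<in> borel_measurable borel"
    "\<And>n. ifourier (gauss_cutoff H n) \<in> borel_measurable borel"
    using K bcontfun_borel[OF H(1)] borel_measurable_ifourier[OF K(1)] borel_measurable_ifourier[OF ig] by auto
  have "energy (\<lambda>x. ifourier K x - \<psi> x) \<le> 4 * energy (\<lambda>v. K v - H v) +
     (4 * energy (\<lambda>v. gauss_cutoff H n v - H v) + 2 * energy (\<lambda>x. ifourier (gauss_cutoff H n) x - \<psi> x))" for n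
  proof -
    have "energy (\<lambda>x. ifourier K x - \<psi> x)
       \<le> 2 * energy (\<lambda>x. ifourier K x - ifourier (gauss_cutoff H n) x) + 2 * energy (\<lambda>x. ifourier (gauss_cutoff H n) x - \<psi> x)"
      by (rule energy_triangle) (auto intro!: borel_imp_lebesgue)
    also have "energy (\<lambda>x. ifourier K x - ifourier (gauss_cutoff H n) x) = energy (\<lambda>v. K v - gauss_cutoff H n v)"
      by (rule energy_ifourier_diff[OF K ig bg])
    also have "\<dots> \<le> 2 * energy (\<lambda>v. K v - H v) + 2 * energy (\<lambda>v. H v - gauss_cutoff H n v)"
      by (rule energy_triangle) (auto intro!: borel_imp_lebesgue)
    finally show ?thesis
      unfolding energy_minus_commute[of H] by (simp add: distrib_left mult.assoc[symmetric] add_ac mult_left_mono add_mono)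
  qed
  moreover have "(\<lambda>n. 4 * energy (\<lambda>v. K v - H v) +
     (4 * energy (\<lambda>v. gauss_cutoff H n v - H v) + 2 * energy (\<lambda>x. ifourier (gauss_cutoff H n) x - \<psi> x)))
     \<longlonglongrightarrow> 4 * energy (\<lambda>v. K v - H v) + (0 + 0)"
    using H(2) by (intro tendsto_intros ennreal_mult_tendsto_0 energy_gauss_cutoff_tendsto lim) auto
  ultimately show ?thesis
    using LIMSEQ_le_const[where a="energy (\<lambda>x. ifourier K x - \<psi> x)"] by fastforce
qed

text \<open>The same \<open>g\<close> works for every admissible \<open>j\<close> because it is
  built from \<open>H\<close> alone; \<open>j\<close> enters only through the approximating
  multipliers.\<close>

theorem has_strong_riesz_derivative_fourier:
  assumes F: "integrable lborel F" "F \<in> bcontfun" and \<alpha>0: "0 < \<alpha>"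
    and Hdef: "H = (\<lambda>v. complex_of_real (\<bar>v\<bar> powr \<alpha>) * F v)" and H: "H \<in> bcontfun" "energy H < \<infinity>"
  shows "\<exists>g. \<forall>j. \<alpha> < 2 * real j \<longrightarrow> has_strong_riesz_derivative j \<alpha> (ifourier F) g"
    and "\<And>g j. has_strong_riesz_derivative j \<alpha> (ifourier F) g \<Longrightarrow> has_fourier_L2 g H"
proof -
  obtain g where g: "g \<in> borel_measurable borel" "energy g < \<infinity>" "has_fourier_L2 g H"
    "(\<lambda>n. energy (\<lambda>x. ifourier (gauss_cutoff H n) x - g x)) \<longlonglongrightarrow> 0"
    by (rule has_fourier_L2_exists[OF H]) (rule that)
  have [measurable]: "g \<in> borel_measurable borel" "H \<in> borel_measurable borel" "F \<in> borel_measurable borel"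
    using g(1) bcontfun_borel[OF H(1)] F by auto
  obtain BH where BH: "\<And>v. cmod (H v) \<le> BH" using bcontfunE[OF H(1)] by metis
  obtain BF where BF: "\<And>v. cmod (F v) \<le> BF" using bcontfunE[OF F(2)] by metis
  have "square_integrable (ifourier F)"
    unfolding square_integrable_iff_energy energy_ifourier[OF F]
    using energy_finite_of_bounded[OF F(1) BF] borel_measurable_ifourier[OF F(1)] borel_imp_lebesgue by auto
  moreover have sg: "square_integrable g"
    using g(2) borel_imp_lebesgue[OF g(1)] by (auto simp: square_integrable_iff_energy)
  moreover have "tendsto_L2 (riesz_quotient \<alpha> j (ifourier F))
       g (at_right 0)" if j: "\<alpha> < 2 * real j" for j
  proof -
    define K where "K \<epsilon> v = F v * complex_of_real (riesz_symbol \<alpha> j \<epsilon> v)" for \<epsilon> v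
    have eq: "riesz_quotient \<alpha> j (ifourier F) \<epsilon> = ifourier (K \<epsilon>)" if "0 < \<epsilon>" for \<epsilon>
      unfolding K_def using riesz_integral_ifourier[OF F \<alpha>0 that] by auto
    have rm[measurable]: "riesz_symbol \<alpha> j \<epsilon> \<in> borel_measurable borel" if "0 < \<epsilon>" for \<epsilon>
      by (rule borel_measurable_continuous_onI[OF continuous_riesz_symbol[OF \<alpha>0 that]])
    have Kle: "cmod (K \<epsilon> v) \<le> cmod (H v)" if "0 < \<epsilon>" for \<epsilon> v
      using riesz_symbol_bounds[OF \<alpha>0 j that, of v]
      by (simp add: K_def Hdef norm_mult mult.commute[of "cmod (F v)"] mult_right_mono)
    have Kb: "K \<epsilon> \<in> bcontfun" if "0 < \<epsilon>" for \<epsilon>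
    proof (rule bcontfun_normI)
      show "continuous_on UNIV (K \<epsilon>)"
        unfolding K_def[abs_def] using F(2) continuous_riesz_symbol[OF \<alpha>0 that] by (intro continuous_intros) (auto simp: bcontfun_def)
      show "cmod (K \<epsilon> v) \<le> BH" for v using Kle[OF that, of v] BH[of v] by linarith
    qed
    \<comment> \<open>The bound by \<open>H\<close> gives only square integrability. For fixed
      \<epsilon> the symbol is also bounded, by a constant that blows up as \<epsilon> tends to 0
      but suffices here.\<close>
    have Ki: "integrable lborel (K \<epsilon>)" if "0 < \<epsilon>" for \<epsilon>
    proof -
      let ?C = "(LINT u|lborel. indicator {\<epsilon><..} u / u powr (1 + \<alpha>) * 4 ^ j) / \<bar>riesz_constant \<alpha> j\<bar>"
      have i: "integrable lborel (\<lambda>u. indicator {\<epsilon><..} u / u powr (1 + \<alpha>) :: real)"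
        using integrable_powr_tail[of "1 + \<alpha>" \<epsilon>] \<alpha>0 that by simp
      have "\<bar>riesz_symbol \<alpha> j \<epsilon> v\<bar> \<le> ?C" for v
      proof -
        have "\<bar>LINT u|lborel. indicator {\<epsilon><..} u / u powr (1 + \<alpha>) * diff_symbol j (u * v)\<bar>
          \<le> (LINT u|lborel. \<bar>indicator {\<epsilon><..} u / u powr (1 + \<alpha>) * diff_symbol j (u * v)\<bar>)"
          by (rule integral_abs_bound)
        also have "\<dots> \<le> (LINT u|lborel. indicator {\<epsilon><..} u / u powr (1 + \<alpha>) * 4 ^ j)"
        proof (rule integral_mono_AE')
          show "integrable lborel (\<lambda>u. indicator {\<epsilon><..} u / u powr (1 + \<alpha>) * 4 ^ j :: real)"
            by (rule integrable_mult_left, rule i)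
        qed (use tail_weight_diff_symbol_le in \<open>auto simp del: times_divide_eq_left\<close>)
        finally show ?thesis unfolding riesz_symbol_def abs_divide by (rule divide_right_mono) simp
      qed
      then show ?thesis
        unfolding K_def[abs_def] using rm[OF that] by (intro integrable_mult_bounded[OF F(1), where B="?C"]) auto
    qed
    have lim: "((\<lambda>\<epsilon>. energy (\<lambda>v. K \<epsilon> v - H v)) \<longlongrightarrow> 0) (at_right 0)"
      unfolding tendsto_at_iff_sequentially
    proof (intro allI impI)
      fix X :: "nat \<Rightarrow> real" assume "\<forall>i. X i \<in> {0<..} - {0}" and X0: "X \<longlonglongrightarrow> 0"
      then have Xp: "0 < X n" for n by auto
      have "(\<lambda>n. energy (\<lambda>v. K (X n) v - H v)) \<longlonglongrightarrow> 0"
      proof (rule energy_dominated_convergence[OF _ _ H(2) Kle[OF Xp]])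
        have "(\<lambda>n. K (X n) v) \<longlonglongrightarrow> F v * complex_of_real (\<bar>v\<bar> powr \<alpha>)" for v
          unfolding K_def by (intro tendsto_intros riesz_symbol_tendsto \<alpha>0 j X0 Xp)
        then show "(\<lambda>n. K (X n) v) \<longlonglongrightarrow> H v" for v by (simp add: Hdef mult.commute)
      qed (use bcontfun_borel[OF Kb[OF Xp]] in auto)
      then show "((\<lambda>\<epsilon>. energy (\<lambda>v. K \<epsilon> v - H v)) \<circ> X) \<longlonglongrightarrow> 0" by (simp add: o_def)
    qed
    have le: "energy (\<lambda>x. ifourier (K \<epsilon>) x - g x) \<le> 4 * energy (\<lambda>v. K \<epsilon> v - H v)" if "0 < \<epsilon>" for \<epsilon>
      by (rule energy_ifourier_diff_L2[OF Ki[OF that] Kb[OF that] H g(1,4)])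
    have pos: "\<forall>\<^sub>F \<epsilon> in at_right (0::real). 0 < \<epsilon>" by (simp add: eventually_at_right_less)
    show ?thesis
    proof (subst tendsto_L2_iff_energy)
      show "\<forall>\<^sub>F \<epsilon> in at_right 0. (\<lambda>x. riesz_quotient \<alpha> j (ifourier F) \<epsilon> x - g x) \<in> borel_measurable lebesgue"
        using pos
      proof eventually_elim
        case (elim \<epsilon>)
        have "(\<lambda>x. ifourier (K \<epsilon>) x - g x) \<in> borel_measurable lebesgue"
          by (intro borel_imp_lebesgue borel_measurable_diff g(1) borel_measurable_ifourier Ki elim)
        then show ?case using eq[OF elim, THEN fun_cong] by simp
      qed
      have "((\<lambda>\<epsilon>. 4 * energy (\<lambda>v. K \<epsilon> v - H v)) \<longlongrightarrow> 0) (at_right 0)"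
        by (rule ennreal_mult_tendsto_0[OF lim])
      then have "((\<lambda>\<epsilon>. energy (\<lambda>x. ifourier (K \<epsilon>) x - g x)) \<longlongrightarrow> 0) (at_right 0)"
        using tendsto_sandwich[OF _ eventually_mono[OF pos le] tendsto_const] by simp
      then show "((\<lambda>\<epsilon>. energy (\<lambda>x. riesz_quotient \<alpha> j (ifourier F) \<epsilon> x - g x)) \<longlongrightarrow> 0) (at_right 0)"
        by (rule Lim_transform_eventually) (use pos in eventually_elim, simp only: eq[THEN fun_cong])
    qed
  qed
  ultimately have *: "has_strong_riesz_derivative j \<alpha> (ifourier F) g" if "\<alpha> < 2 * real j" for j
    using that \<alpha>0 by (simp add: has_strong_riesz_derivative_def)
  then show "\<exists>g. \<forall>j. \<alpha> < 2 * real j \<longrightarrow> has_strong_riesz_derivative j \<alpha> (ifourier F) g" by blast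
  fix g' j assume g': "has_strong_riesz_derivative j \<alpha> (ifourier F) g'"
  then have "\<alpha> < 2 * real j" by (simp add: has_strong_riesz_derivative_def)
  from *[OF this] g' have "AE x in lebesgue. g' x = g x"
    by (intro tendsto_L2_unique[where F="at_right 0"]) (auto simp: has_strong_riesz_derivative_def square_integrable_def)
  then show "has_fourier_L2 g' H"
    using has_fourier_L2_cong_AE[OF g(3)] g' by (simp add: has_strong_riesz_derivative_def)
qed

section \<open>The Poisson summation formula\<close>

subsection \<open>A Tauberian theorem for arithmetic means\<close>

text \<open>Schmidt's condition, over blocks from n to (1 + \<delta>)n. It covers both alternatives
  of the quadrature class: absolutely convergent sums, and sums with terms O(1/k).\<close>

definition slowly_oscillating :: "(nat \<Rightarrow> complex) \<Rightarrow> bool" where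
  "slowly_oscillating S \<longleftrightarrow> (\<forall>\<epsilon>>0. \<exists>\<delta>>0. \<exists>N. \<forall>n m. N \<le> n \<longrightarrow> n \<le> m \<longrightarrow> real m \<le> (1 + \<delta>) * real n \<longrightarrow>
     cmod (S m - S n) \<le> \<epsilon>)"

text \<open>The sum of T over the block from n to n + d, with d about \<delta>n, is a difference of
  two initial sums, hence o(n); slow oscillation keeps every term of the block close to
  T(n).\<close>

theorem tauberian_means:
  assumes mean: "(\<lambda>N. (\<Sum>n<N. S n) / of_nat N) \<longlonglongrightarrow> L" and osc: "slowly_oscillating S"
  shows "S \<longlonglongrightarrow> L"
proof -
  define T where "T n = S n - L" for n
  define e where "e N = (\<Sum>n<N. T n) / of_nat N" for N
  have e: "e \<longlonglongrightarrow> 0"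
  proof -
    have "(\<lambda>N. (\<Sum>n<N. S n) / of_nat N - L) \<longlonglongrightarrow> L - L" by (intro tendsto_intros mean)
    then have "(\<lambda>N. (\<Sum>n<N. S n) / of_nat N - L) \<longlonglongrightarrow> 0" by simp
    moreover have "\<forall>\<^sub>F N in sequentially. (\<Sum>n<N. S n) / of_nat N - L = e N"
      using eventually_gt_at_top[of 0]
      by eventually_elim (simp add: e_def T_def sum_subtractf field_simps)
    ultimately show ?thesis by (rule Lim_transform_eventually)
  qed
  have eN: "(\<Sum>n<N. T n) = of_nat N * e N" for N by (cases "N = 0") (auto simp: e_def)
  have "T \<longlonglongrightarrow> 0"
  proof (rule LIMSEQ_I)
    fix r :: real assume "0 < r"
    define \<epsilon> where "\<epsilon> = r / 3"
    have \<epsilon>: "0 < \<epsilon>" using \<open>0 < r\<close> by (simp add: \<epsilon>_def)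
    obtain \<delta> N1 where \<delta>: "0 < \<delta>" and N1: "\<And>n m. N1 \<le> n \<Longrightarrow> n \<le> m \<Longrightarrow> real m \<le> (1 + \<delta>) * real n \<Longrightarrow> cmod (S m - S n) \<le> \<epsilon>"
      using osc \<epsilon> unfolding slowly_oscillating_def by meson
    \<comment> \<open>Chosen so that the two initial sums together contribute at most (2 +
      \<delta>)n\<eta> = \<delta>n\<epsilon>/2, which is at most d\<epsilon>.\<close>
    define \<eta> where "\<eta> = \<epsilon> * \<delta> / (2 * (2 + \<delta>))"
    have \<eta>: "0 < \<eta>" using \<epsilon> \<delta> by (simp add: \<eta>_def)
    obtain N2 where N2: "\<And>n. N2 \<le> n \<Longrightarrow> cmod (e n) < \<eta>"
      using LIMSEQ_D[OF e \<eta>] by auto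
    \<comment> \<open>The term 2/\<delta> ensures \<delta>n \<ge> 2, so that rounding down to
      \<open>d\<close> loses at most half.\<close>
    define N0 where "N0 = max (max N1 N2) (nat \<lceil>2 / \<delta>\<rceil>)"
    show "\<exists>no. \<forall>n\<ge>no. cmod (T n - 0) < r"
    proof (intro exI allI impI)
      fix n assume n: "Suc N0 \<le> n"
      have n\<delta>: "2 / \<delta> \<le> real n" using n unfolding N0_def by linarith
      then have n\<delta>': "2 \<le> \<delta> * real n" using \<delta> by (simp add: field_simps)
      define d where "d = nat \<lfloor>\<delta> * real n\<rfloor>"
      have d: "real d \<le> \<delta> * real n" "\<delta> * real n < real d + 1"
        using n\<delta>' by (simp_all add: d_def)
      then have dhalf: "\<delta> * real n / 2 \<le> real d" and dpos: "0 < real d" using n\<delta>' by linarith+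
      define m where "m = n + d"
      have m: "n \<le> m" "real m \<le> (1 + \<delta>) * real n" using d by (auto simp: m_def algebra_simps)
      have "of_nat d * T n = (\<Sum>i=n..<m. T n)" by (simp add: m_def)
      also have "\<dots> = (\<Sum>i=n..<m. T i) - (\<Sum>i=n..<m. T i - T n)" by (simp add: sum_subtractf)
      also have "(\<Sum>i=n..<m. T i) = (\<Sum>i<m. T i) - (\<Sum>i<n. T i)"
        using sum_diff_nat_ivl[of 0 n m T] m(1) by (simp add: lessThan_atLeast0)
      also have "\<dots> = of_nat m * e m - of_nat n * e n" unfolding eN ..
      finally have "real d * cmod (T n) = cmod (of_nat m * e m - of_nat n * e n - (\<Sum>i=n..<m. T i - T n))"
        by (metis norm_mult norm_of_nat)
      also have "\<dots> \<le> cmod (of_nat m * e m) + cmod (of_nat n * e n) + cmod (\<Sum>i=n..<m. T i - T n)"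
        using norm_triangle_ineq4[of "of_nat m * e m - of_nat n * e n" "\<Sum>i=n..<m. T i - T n"]
          norm_triangle_ineq4[of "of_nat m * e m" "of_nat n * e n"] by linarith
      also have "cmod (of_nat m * e m) \<le> (1 + \<delta>) * real n * \<eta>"
      proof -
        have "cmod (e m) \<le> \<eta>" using n m(1) by (intro less_imp_le[OF N2]) (auto simp: N0_def)
        then have "real m * cmod (e m) \<le> (1 + \<delta>) * real n * \<eta>" using m(2) \<delta> by (intro mult_mono) auto
        then show ?thesis by (simp add: norm_mult)
      qed
      also have "cmod (of_nat n * e n) \<le> real n * \<eta>"
      proof -
        have "cmod (e n) \<le> \<eta>" using n by (intro less_imp_le[OF N2]) (auto simp: N0_def)
        then show ?thesis by (simp add: norm_mult mult_left_mono)
      qed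
      also have "cmod (\<Sum>i=n..<m. T i - T n) \<le> (\<Sum>i=n..<m. \<epsilon>)"
      proof (rule sum_norm_le)
        fix i assume i: "i \<in> {n..<m}"
        have "cmod (S i - S n) \<le> \<epsilon>" using i n m(2) by (intro N1) (auto simp: N0_def)
        then show "cmod (T i - T n) \<le> \<epsilon>" by (simp add: T_def)
      qed
      also have "(\<Sum>i=n..<m. \<epsilon>) = real d * \<epsilon>" by (simp add: m_def)
      also have "(1 + \<delta>) * real n * \<eta> + real n * \<eta> = \<delta> * real n / 2 * \<epsilon>"
      proof -
        have "\<epsilon> * \<delta> / (2 * q) * q = \<epsilon> * \<delta> / 2" if "q \<noteq> 0" for q using that by simp
        then have q: "\<eta> * (2 + \<delta>) = \<epsilon> * \<delta> / 2" using \<delta> by (simp only: \<eta>_def)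
        have "(1 + \<delta>) * real n * \<eta> + real n * \<eta> = real n * (\<eta> * (2 + \<delta>))" by (simp add: algebra_simps)
        then show ?thesis unfolding q by simp
      qed
      also have "\<delta> * real n / 2 * \<epsilon> \<le> real d * \<epsilon>" using dhalf \<epsilon> by (intro mult_right_mono) auto
      finally have "real d * cmod (T n) \<le> real d * (2 * \<epsilon>)" by (simp add: mult_ac)
      then have "cmod (T n) \<le> 2 * \<epsilon>" using dpos by simp
      then show "cmod (T n - 0) < r" using \<epsilon> by (simp add: \<epsilon>_def)
    qed
  qed
  then show ?thesis unfolding T_def by (simp add: LIM_zero_iff)
qed

lemma slowly_oscillating_convergent:
  assumes "convergent S"
  shows "slowly_oscillating S"
  unfolding slowly_oscillating_def
proof (intro allI impI)
  fix \<epsilon> :: real assume "0 < \<epsilon>"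
  then obtain N where "\<And>m n. N \<le> m \<Longrightarrow> N \<le> n \<Longrightarrow> cmod (S m - S n) < \<epsilon>"
    using CauchyD[OF convergent_Cauchy[OF assms]] by metis
  then show "\<exists>\<delta>>0. \<exists>N. \<forall>n m. N \<le> n \<longrightarrow> n \<le> m \<longrightarrow> real m \<le> (1 + \<delta>) * real n \<longrightarrow> cmod (S m - S n) \<le> \<epsilon>"
    by (intro exI[of _ 1] conjI exI[of _ N]) (auto intro: less_imp_le order_trans)
qed

text \<open>A block from n to (1 + \<delta>)n has at most \<delta>n terms, each at most C/n; take
  \<delta> = \<epsilon>/C.\<close>

lemma slowly_oscillating_partial_sums:
  assumes b: "\<And>k. 0 < k \<Longrightarrow> cmod (b k) \<le> C / real k" and C: "0 < C"
  shows "slowly_oscillating (\<lambda>n. \<Sum>k\<le>n. b k)"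
  unfolding slowly_oscillating_def
proof (intro allI impI)
  fix \<epsilon> :: real assume \<epsilon>: "0 < \<epsilon>"
  show "\<exists>\<delta>>0. \<exists>N. \<forall>n m. N \<le> n \<longrightarrow> n \<le> m \<longrightarrow> real m \<le> (1 + \<delta>) * real n \<longrightarrow> cmod ((\<Sum>k\<le>m. b k) - (\<Sum>k\<le>n. b k)) \<le> \<epsilon>"
  proof (intro exI[of _ "\<epsilon> / C"] conjI exI[of _ 1] allI impI)
    fix n m :: nat assume nm: "1 \<le> n" "n \<le> m" "real m \<le> (1 + \<epsilon> / C) * real n"
    have "{..m} = {..n} \<union> {n<..m}" "{..n} \<inter> {n<..m} = {}" using nm by auto
    then have "(\<Sum>k\<le>m. b k) - (\<Sum>k\<le>n. b k) = (\<Sum>k\<in>{n<..m}. b k)"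
      by (simp add: sum.union_disjoint)
    also have "cmod \<dots> \<le> (\<Sum>k\<in>{n<..m}. C / real n)"
    proof (rule sum_norm_le)
      fix k assume "k \<in> {n<..m}"
      then show "cmod (b k) \<le> C / real n"
        using b[of k] nm C by (auto intro!: order_trans[OF b] divide_left_mono mult_pos_pos)
    qed
    also have "\<dots> = (real m - real n) * (C / real n)" using nm by (simp add: of_nat_diff)
    also have "\<dots> \<le> (\<epsilon> / C * real n) * (C / real n)"
      using nm C by (intro mult_right_mono) (auto simp: algebra_simps)
    also have "\<dots> = \<epsilon>" using nm C by simp
    finally show "cmod ((\<Sum>k\<le>m. b k) - (\<Sum>k\<le>n. b k)) \<le> \<epsilon>" .
  qed (use \<epsilon> C in auto)
qed

subsection \<open>Fejer's kernel\<close>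

definition dirichlet_kernel :: "nat \<Rightarrow> real \<Rightarrow> real" where
  "dirichlet_kernel n t = 1 + 2 * (\<Sum>k=1..n. cos (real k * t))"

definition fejer_kernel :: "nat \<Rightarrow> real \<Rightarrow> real" where
  "fejer_kernel N t = (\<Sum>n<N. dirichlet_kernel n t) / real N"

lemma dirichlet_kernel_measurable [measurable]: "dirichlet_kernel n \<in> borel_measurable borel"
  unfolding dirichlet_kernel_def[abs_def] by measurable

lemma fejer_kernel_measurable [measurable]: "fejer_kernel n \<in> borel_measurable borel"
  unfolding fejer_kernel_def[abs_def] by measurable

text \<open>Adding the next exponential to the geometric sum changes the squared modulus by one
  Dirichlet kernel. The closed form gives both positivity and the decay away from 0.\<close>

lemma fejer_sum_square: "(\<Sum>n<N. dirichlet_kernel n t) = (cmod (\<Sum>n<N. cis (real n * t)))\<^sup>2"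
proof (induction N)
  case (Suc N)
  define P where "P = (\<Sum>n<N. cis (real n * t))"
  have "(cmod (P + cis (real N * t)))\<^sup>2 = (cmod P)\<^sup>2 + 1 + 2 * Re (cnj P * cis (real N * t))"
    by (simp add: cmod_power2 power2_sum algebra_simps)
  also have "cnj P * cis (real N * t) = (\<Sum>n<N. cis (real (N - n) * t))"
    unfolding P_def cnj_sum sum_distrib_right
    by (intro sum.cong refl) (auto simp: cis_cnj cis_mult of_nat_diff algebra_simps)
  also have "Re \<dots> = (\<Sum>n<N. cos (real (N - n) * t))" by (simp add: Re_sum)
  also have "(\<Sum>n<N. cos (real (N - n) * t)) = (\<Sum>k=1..N. cos (real k * t))"
    by (rule sum.reindex_bij_witness[of _ "\<lambda>k. N - k" "\<lambda>k. N - k"]) auto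
  finally show ?case using Suc by (simp add: P_def dirichlet_kernel_def)
qed simp

lemma fejer_kernel_nonneg: "0 \<le> fejer_kernel N t"
  unfolding fejer_kernel_def fejer_sum_square by simp

text \<open>The geometric sum is a quotient with numerator of modulus at most 2 and denominator 1 -
  cis t, whose squared modulus is 2 - 2 cos t.\<close>

lemma fejer_kernel_le:
  assumes "0 < \<delta>" "\<delta> \<le> \<bar>t\<bar>" "\<bar>t\<bar> \<le> pi"
  shows "fejer_kernel N t \<le> (4 / (2 - 2 * cos \<delta>)) / real N"
proof -
  have c: "cos t \<le> cos \<delta>" "cos \<delta> < 1"
  proof -
    have "cos \<bar>t\<bar> \<le> cos \<delta>" using assms by (intro cos_monotone_0_pi_le) auto
    then show "cos t \<le> cos \<delta>" by (simp add: abs_if split: if_splits)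
    have "cos \<delta> < cos 0" using assms by (intro cos_monotone_0_pi) auto
    then show "cos \<delta> < 1" by simp
  qed
  have "(\<Sum>n<N. cis (real n * t)) = (\<Sum>n<N. cis t ^ n)" by (simp add: Complex.DeMoivre)
  then have "(\<Sum>n<N. cis (real n * t)) * (1 - cis t) = 1 - cis t ^ N"
    using one_diff_power_eq[of "cis t" N] by (simp add: mult.commute)
  then have "cmod (\<Sum>n<N. cis (real n * t)) * cmod (1 - cis t) = cmod (1 - cis t ^ N)"
    by (metis norm_mult)
  also have "\<dots> \<le> 2"
    using norm_triangle_ineq4[of 1 "cis t ^ N"] by (simp add: norm_power)
  finally have "(cmod (\<Sum>n<N. cis (real n * t)) * cmod (1 - cis t))\<^sup>2 \<le> 2\<^sup>2"
    by (intro power_mono) auto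
  moreover have "(cmod (1 - cis t))\<^sup>2 = 2 - 2 * cos t"
  proof -
    have "(cmod (1 - cis t))\<^sup>2 = (1 - cos t)\<^sup>2 + (sin t)\<^sup>2" by (simp add: cmod_power2)
    then show ?thesis using sin_cos_squared_add[of t] by (simp add: power2_diff)
  qed
  ultimately have *: "(\<Sum>n<N. dirichlet_kernel n t) * (2 - 2 * cos t) \<le> 4"
    unfolding fejer_sum_square by (simp add: power_mult_distrib)
  have "0 \<le> (\<Sum>n<N. dirichlet_kernel n t)" unfolding fejer_sum_square by simp
  then have "(\<Sum>n<N. dirichlet_kernel n t) * (2 - 2 * cos \<delta>) \<le> (\<Sum>n<N. dirichlet_kernel n t) * (2 - 2 * cos t)"
    using c by (intro mult_left_mono) auto
  with * have "(\<Sum>n<N. dirichlet_kernel n t) \<le> 4 / (2 - 2 * cos \<delta>)"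
    using c by (simp add: pos_le_divide_eq)
  then show ?thesis unfolding fejer_kernel_def by (rule divide_right_mono) simp
qed

lemma dirichlet_kernel_le: "\<bar>dirichlet_kernel n t\<bar> \<le> 1 + 2 * real n"
proof -
  have "\<bar>\<Sum>k=1..n. cos (real k * t)\<bar> \<le> (\<Sum>k=1..n. 1)"
    by (rule order_trans[OF sum_abs sum_mono]) auto
  then show ?thesis unfolding dirichlet_kernel_def by simp
qed

lemma fejer_kernel_bounded: "fejer_kernel N t \<le> 2 * real N + 1"
proof (cases "N = 0")
  case False
  have "(\<Sum>n<N. dirichlet_kernel n t) \<le> (\<Sum>n<N. 2 * real N + 1)"
  proof (rule sum_mono)
    fix n assume "n \<in> {..<N}"
    then show "dirichlet_kernel n t \<le> 2 * real N + 1" using dirichlet_kernel_le[of n t] by simp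
  qed
  then show ?thesis using False unfolding fejer_kernel_def by (simp add: field_simps)
qed (simp add: fejer_kernel_def)

lemma fejer_kernel_periodic: "fejer_kernel N (t + 2 * pi * of_int m) = fejer_kernel N t"
proof -
  have "cos (real k * (t + 2 * pi * of_int m)) = cos (real k * t)" for k
  proof -
    have "real k * (t + 2 * pi * of_int m) = real k * t + 2 * pi * of_int (int k * m)" by (simp add: algebra_simps)
    then show ?thesis by (simp only: cos_add cos_int_2pin sin_int_2pin)
  qed
  then show ?thesis unfolding fejer_kernel_def dirichlet_kernel_def by simp
qed

text \<open>The cosines integrate to sines that vanish at both end points. The interval is half-open
  so that its translates tile the line.\<close>

lemma integral_fejer_kernel:
  assumes "0 < N"
  shows "has_bochner_integral lborel (\<lambda>t. indicator {-pi<..pi} t * fejer_kernel N t) (2 * pi)"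
proof -
  have "has_bochner_integral lborel (\<lambda>t. indicator {-pi..pi} t *\<^sub>R dirichlet_kernel n t)
     ((pi + 2 * (\<Sum>k=1..n. sin (real k * pi) / real k)) - (- pi + 2 * (\<Sum>k=1..n. sin (real k * - pi) / real k)))" for n
  proof (rule has_bochner_integral_FTC_Icc)
    fix t
    have "((\<lambda>t. t + 2 * (\<Sum>k=1..n. sin (real k * t) / real k)) has_real_derivative 1 + 2 * (\<Sum>k=1..n. cos (real k * t))) (at t within {-pi..pi})"
      by (auto intro!: derivative_eq_intros DERIV_sum sum.cong simp: field_simps)
    then show "((\<lambda>t. t + 2 * (\<Sum>k=1..n. sin (real k * t) / real k)) has_vector_derivative dirichlet_kernel n t) (at t within {-pi..pi})"
      unfolding dirichlet_kernel_def by (simp add: has_real_derivative_iff_has_vector_derivative)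
    show "continuous_on {-pi..pi} (dirichlet_kernel n)"
      unfolding dirichlet_kernel_def by (intro continuous_intros)
  qed simp
  then have "has_bochner_integral lborel (\<lambda>t. indicator {-pi..pi} t *\<^sub>R dirichlet_kernel n t) (2 * pi)" for n
    by (simp add: sin_npi)
  then have "has_bochner_integral lborel (\<lambda>t. (\<Sum>n<N. indicator {-pi..pi} t *\<^sub>R dirichlet_kernel n t) / real N) ((\<Sum>n<N. 2 * pi) / real N)"
    by (intro has_bochner_integral_divide_zero has_bochner_integral_sum)
  moreover have "(\<Sum>n<N. indicator {-pi..pi} t *\<^sub>R dirichlet_kernel n t) / real N = indicator {-pi..pi} t * fejer_kernel N t" for t
    by (simp add: fejer_kernel_def sum_distrib_left)
  ultimately have "has_bochner_integral lborel (\<lambda>t. indicator {-pi..pi} t * fejer_kernel N t) (2 * pi)"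
    using assms by simp
  moreover have "AE t in lborel. indicator {-pi..pi} t * fejer_kernel N t = indicator {-pi<..pi} t * fejer_kernel N t"
    using AE_lborel_singleton[of "-pi"] by eventually_elim (auto split: split_indicator)
  ultimately show ?thesis
    by (subst has_bochner_integral_cong_AE[symmetric]) auto
qed

abbreviation fejer_integrand :: "nat \<Rightarrow> (real \<Rightarrow> complex) \<Rightarrow> real \<Rightarrow> complex" where
  "fejer_integrand N G t \<equiv> indicator {-pi<..pi} t * (G t * complex_of_real (fejer_kernel N t))"

text \<open>The bound is uniform in \<open>N\<close>, including N = 0, where the kernel is 0; this
  is what a majorant independent of \<open>N\<close> needs.\<close>

lemma integrable_fejer_mult:
  fixes G :: "real \<Rightarrow> complex"
  assumes [measurable]: "G \<in> borel_measurable borel" and B: "\<And>t. t \<in> {-pi<..pi} \<Longrightarrow> cmod (G t) \<le> B"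
  shows "integrable lborel (fejer_integrand N G)"
    and "cmod (LINT t|lborel. fejer_integrand N G t) \<le> 2 * pi * B"
proof -
  have B0: "0 \<le> B" by (rule order_trans[OF norm_ge_zero B[of 0]]) simp
  have "integrable lborel (\<lambda>t. indicator {-pi<..pi} t * fejer_kernel N t) \<and> (LINT t|lborel. indicator {-pi<..pi} t * fejer_kernel N t) \<le> 2 * pi"
  proof (cases "N = 0")
    case False
    then show ?thesis using integral_fejer_kernel[of N] by (simp add: has_bochner_integral_iff)
  qed (simp add: fejer_kernel_def)
  then have i: "integrable lborel (\<lambda>t. B * (indicator {-pi<..pi} t * fejer_kernel N t))"
    and le: "(LINT t|lborel. indicator {-pi<..pi} t * fejer_kernel N t) \<le> 2 * pi" by auto
  have pt: "cmod (fejer_integrand N G t) \<le> B * (indicator {-pi<..pi} t * fejer_kernel N t)" for t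
    using B[of t] fejer_kernel_nonneg[of N t] by (auto simp: norm_mult intro!: mult_right_mono split: split_indicator)
  show ii: "integrable lborel (fejer_integrand N G)"
    by (rule Bochner_Integration.integrable_bound[OF i]) (use order_trans[OF pt abs_ge_self] in auto)
  have "cmod (LINT t|lborel. fejer_integrand N G t)
     \<le> (LINT t|lborel. cmod (fejer_integrand N G t))"
    by (rule integral_norm_bound)
  also have "\<dots> \<le> (LINT t|lborel. B * (indicator {-pi<..pi} t * fejer_kernel N t))"
    by (intro integral_mono integrable_norm ii i pt)
  also have "\<dots> \<le> B * (2 * pi)" using le B0 by (simp add: mult_left_mono)
  finally show "cmod (LINT t|lborel. fejer_integrand N G t) \<le> 2 * pi * B"
    by (simp add: mult_ac)
qed

text \<open>\<open>G\<close> need not be periodic: only its values on one period enter, so the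
  theorem can be applied to every translate of a function on the line.\<close>

theorem fejer:
  fixes G :: "real \<Rightarrow> complex"
  assumes G: "continuous_on UNIV G"
  shows "(\<lambda>N. LINT t|lborel. fejer_integrand N G t) \<longlonglongrightarrow> complex_of_real (2 * pi) * G 0"
proof -
  have [measurable]: "G \<in> borel_measurable borel" using G by (rule borel_measurable_continuous_onI)
  have "bounded (G ` {-pi..pi})"
    using G by (intro compact_imp_bounded compact_continuous_image) (auto intro: continuous_on_subset)
  then obtain B where B: "0 < B" "\<And>t. t \<in> {-pi..pi} \<Longrightarrow> cmod (G t) \<le> B"
    by (auto simp: bounded_pos)
  define I where "I N = (LINT t|lborel. fejer_integrand N G t)" for N
  have "I \<longlonglongrightarrow> complex_of_real (2 * pi) * G 0"
  proof (rule LIMSEQ_I)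
    fix r :: real assume "0 < r"
    \<comment> \<open>Near 0 the error is at most \<epsilon> times the mass 2\<pi>, that is r/2;
      \<open>N0\<close> makes the remaining part smaller than r/2.\<close>
    define \<epsilon> where "\<epsilon> = r / (4 * pi)"
    have \<epsilon>: "0 < \<epsilon>" using \<open>0 < r\<close> by (simp add: \<epsilon>_def)
    obtain d where d: "0 < d" "\<And>t. dist t 0 < d \<Longrightarrow> dist (G t) (G 0) < \<epsilon>"
      using G \<epsilon> unfolding continuous_on_iff by (metis UNIV_I)
    define \<delta> where "\<delta> = min d pi"
    have \<delta>: "0 < \<delta>" "\<delta> \<le> pi" "\<delta> \<le> d" using d by (auto simp: \<delta>_def)
    define K where "K = 4 / (2 - 2 * cos \<delta>)"
    have "cos \<delta> < cos 0" using \<delta> by (intro cos_monotone_0_pi) auto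
    then have K: "0 < K" by (simp add: K_def)
    obtain N0 :: nat where N0: "real N0 > 2 * B * K * (2 * pi) / (r / 2)" using reals_Archimedean2 by blast
    show "\<exists>no. \<forall>N\<ge>no. cmod (I N - complex_of_real (2 * pi) * G 0) < r"
    proof (intro exI allI impI)
      fix N assume N: "Suc N0 \<le> N"
      then have N': "0 < N" by simp
      note hb = integral_fejer_kernel[OF N']
      have i0: "integrable lborel (\<lambda>t. indicator {-pi<..pi} t * fejer_kernel N t)"
        and e0: "(LINT t|lborel. indicator {-pi<..pi} t * fejer_kernel N t) = 2 * pi"
        using hb by (auto simp: has_bochner_integral_iff)
      have iG: "integrable lborel (fejer_integrand N G)"
        using B by (intro integrable_fejer_mult[where B=B]) auto
      have ic: "integrable lborel (fejer_integrand N (\<lambda>_. G 0))"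
        by (intro integrable_fejer_mult[where B="cmod (G 0)"]) auto
      have "complex_of_real (2 * pi) * G 0 = (LINT t|lborel. complex_of_real (indicator {-pi<..pi} t * fejer_kernel N t) * G 0)"
        unfolding e0[symmetric] integral_complex_of_real[symmetric] by simp
      also have "\<dots> = (LINT t|lborel. fejer_integrand N (\<lambda>_. G 0) t)"
        by (simp add: mult_ac of_real_indicator)
      finally have c0: "complex_of_real (2 * pi) * G 0 = (LINT t|lborel. fejer_integrand N (\<lambda>_. G 0) t)" .
      have diff: "I N - complex_of_real (2 * pi) * G 0
         = (LINT t|lborel. fejer_integrand N G t - fejer_integrand N (\<lambda>_. G 0) t)"
        unfolding I_def c0 by (rule Bochner_Integration.integral_diff[OF iG ic, symmetric])
      have "cmod (I N - complex_of_real (2 * pi) * G 0) \<le> (LINT t|lborel. cmod (fejer_integrand N G t - fejer_integrand N (\<lambda>_. G 0) t))"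
        unfolding diff by (rule integral_norm_bound)
      also have "\<dots> \<le> (LINT t|lborel. \<epsilon> * (indicator {-pi<..pi} t * fejer_kernel N t) + (2 * B * (K / real N)) * indicator {-pi<..pi} t)"
      proof (rule integral_mono)
        show "integrable lborel (\<lambda>t. cmod (fejer_integrand N G t - fejer_integrand N (\<lambda>_. G 0) t))"
          using iG ic by (intro integrable_norm Bochner_Integration.integrable_diff)
        show "integrable lborel (\<lambda>t. \<epsilon> * (indicator {-pi<..pi} t * fejer_kernel N t) + (2 * B * (K / real N)) * indicator {-pi<..pi} t)"
          using i0 by (intro Bochner_Integration.integrable_add integrable_mult_right integrable_real_indicator) auto
        fix t
        show "cmod (fejer_integrand N G t - fejer_integrand N (\<lambda>_. G 0) t)
          \<le> \<epsilon> * (indicator {-pi<..pi} t * fejer_kernel N t) + (2 * B * (K / real N)) * indicator {-pi<..pi} t"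
        proof (cases "t \<in> {-pi<..pi}")
          case True
          have "cmod (G t - G 0) * fejer_kernel N t \<le> \<epsilon> * fejer_kernel N t + 2 * B * (K / real N)"
          proof (cases "\<bar>t\<bar> < \<delta>")
            case small: True
            then have "cmod (G t - G 0) \<le> \<epsilon>" using d(2)[of t] \<delta> by (auto simp: dist_norm)
            then have "cmod (G t - G 0) * fejer_kernel N t \<le> \<epsilon> * fejer_kernel N t"
              using fejer_kernel_nonneg by (rule mult_right_mono)
            moreover have "0 \<le> 2 * B * (K / real N)" using B K by simp
            ultimately show ?thesis by linarith
          next
            case False
            have "cmod (G t - G 0) \<le> 2 * B"
              using norm_triangle_ineq4[of "G t" "G 0"] B(2)[of t] B(2)[of 0] True by auto
            moreover have "fejer_kernel N t \<le> K / real N"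
              unfolding K_def using False True \<delta> by (intro fejer_kernel_le) auto
            ultimately have "cmod (G t - G 0) * fejer_kernel N t \<le> 2 * B * (K / real N)"
              using fejer_kernel_nonneg B by (intro mult_mono) auto
            moreover have "0 \<le> \<epsilon> * fejer_kernel N t" using \<epsilon> fejer_kernel_nonneg by simp
            ultimately show ?thesis by linarith
          qed
          moreover have "cmod (G t * complex_of_real (fejer_kernel N t) - G 0 * complex_of_real (fejer_kernel N t)) = cmod (G t - G 0) * fejer_kernel N t"
            using fejer_kernel_nonneg[of N t] by (simp add: left_diff_distrib[symmetric] norm_mult)
          ultimately show ?thesis using True by simp
        qed simp
      qed
      also have "\<dots> = \<epsilon> * (2 * pi) + 2 * B * (K / real N) * (2 * pi)"
      proof -
        have "(LINT t|lborel. indicator {-pi<..pi} t) = 2 * pi" by simp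
        then show ?thesis using i0 e0
          by (subst Bochner_Integration.integral_add) (auto intro!: integrable_mult_right integrable_real_indicator)
      qed
      also have "\<dots> < r"
      proof -
        have "\<epsilon> * (2 * pi) = r / 2" by (simp add: \<epsilon>_def)
        moreover have "2 * B * K * (2 * pi) / (r / 2) < real N" using N N0 by simp
        then have "2 * B * K * (2 * pi) < r / 2 * real N" using \<open>0 < r\<close> by (simp add: field_simps)
        then have "2 * B * (K / real N) * (2 * pi) < r / 2" using N' by (simp add: field_simps)
        ultimately show ?thesis by linarith
      qed
      finally show "cmod (I N - complex_of_real (2 * pi) * G 0) < r" .
    qed
  qed
  then show ?thesis by (simp add: I_def[abs_def])
qed

subsection \<open>Functions of bounded variation\<close>

lemma bounded_variation_grid:
  assumes "bounded_variation g"
  obtains V where "0 \<le> V" "\<And>x \<tau> \<tau>' n. 0 \<le> \<tau>' \<Longrightarrow> \<tau>' \<le> \<tau> \<Longrightarrow>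
    (\<Sum>i<n. cmod (g (x + real i * \<tau> + \<tau>') - g (x + real i * \<tau>))) \<le> V"
proof -
  obtain V where V: "\<And>n (p :: nat \<Rightarrow> real). (\<And>i. i < n \<Longrightarrow> p i \<le> p (Suc i)) \<Longrightarrow> (\<Sum>i<n. cmod (g (p (Suc i)) - g (p i))) \<le> V"
    using assms unfolding bounded_variation_def by metis
  have "0 \<le> V" using V[of 0] by simp
  moreover have "(\<Sum>i<n. cmod (g (x + real i * \<tau> + \<tau>') - g (x + real i * \<tau>))) \<le> V" if \<tau>: "0 \<le> \<tau>'" "\<tau>' \<le> \<tau>" for x \<tau> \<tau>' n
  proof -
    \<comment> \<open>Even indices give the grid points and odd ones the shifted points; since
      \<tau>' \<le> \<tau> they interleave monotonically, and the increments starting at odd indices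
      are discarded.\<close>
    define p where "p i = x + real (i div 2) * \<tau> + (if even i then 0 else \<tau>')" for i
    have "(\<Sum>i<n. cmod (g (x + real i * \<tau> + \<tau>') - g (x + real i * \<tau>))) \<le> (\<Sum>i<2 * n. cmod (g (p (Suc i)) - g (p i)))"
    proof (induction n)
      case (Suc n)
      have "p (Suc (2 * n)) = x + real n * \<tau> + \<tau>'" "p (2 * n) = x + real n * \<tau>" by (simp_all add: p_def)
      then show ?case using Suc.IH by (simp add: add_increasing2)
    qed simp
    also have "\<dots> \<le> V"
    proof (rule V)
      fix i
      show "p i \<le> p (Suc i)"
      proof (cases "even i")
        case True
        then show ?thesis using \<tau> by (simp add: p_def)
      next
        case False
        then have "Suc i div 2 = Suc (i div 2)" by (auto elim: oddE)
        then show ?thesis using False \<tau> by (simp add: p_def algebra_simps)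
      qed
    qed
    finally show ?thesis .
  qed
  ultimately show ?thesis using that by blast
qed

lemma integral_translates:
  fixes E :: "real \<Rightarrow> real"
  assumes E: "integrable lborel E" and \<tau>: "0 \<le> \<tau>"
  shows "(LINT v|lborel. indicator {x<..x + real n * \<tau>} v * E v)
    = (LINT u|lborel. indicator {0<..\<tau>} u * (\<Sum>i<n. E (x + real i * \<tau> + u)))"
proof (induction n)
  case (Suc n)
  have [measurable]: "E \<in> borel_measurable borel" using E by auto
  have iE: "integrable lborel (\<lambda>v. indicator {a<..b} v * E v)" for a b
    by (rule Bochner_Integration.integrable_bound[OF E]) (auto split: split_indicator)
  have iT: "integrable lborel (\<lambda>u. indicator {0<..\<tau>} u * E (y + u))" for y
  proof -
    have "integrable lborel (\<lambda>u. E (y + 1 * u))" using E by (intro lborel_integrable_real_affine) auto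
    then show ?thesis
      by (rule Bochner_Integration.integrable_bound) (auto split: split_indicator)
  qed
  have "(LINT v|lborel. indicator {x + real n * \<tau><..x + real (Suc n) * \<tau>} v * E v)
      = \<bar>1\<bar> *\<^sub>R (LINT u|lborel. indicator {x + real n * \<tau><..x + real (Suc n) * \<tau>} ((x + real n * \<tau>) + 1 * u) * E ((x + real n * \<tau>) + 1 * u))"
    by (rule lborel_integral_real_affine) simp
  also have "\<dots> = (LINT u|lborel. indicator {0<..\<tau>} u * E (x + real n * \<tau> + u))"
    by (auto simp: algebra_simps intro!: Bochner_Integration.integral_cong split: split_indicator)
  finally have step: "(LINT v|lborel. indicator {x + real n * \<tau><..x + real (Suc n) * \<tau>} v * E v)
     = (LINT u|lborel. indicator {0<..\<tau>} u * E (x + real n * \<tau> + u))" .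
  have n: "0 \<le> real n * \<tau>" using \<tau> by simp
  have "(LINT v|lborel. indicator {x<..x + real (Suc n) * \<tau>} v * E v)
     = (LINT v|lborel. indicator {x<..x + real n * \<tau>} v * E v + indicator {x + real n * \<tau><..x + real (Suc n) * \<tau>} v * E v)"
  proof -
    have "indicator {x<..x + (m + \<tau>)} v * E v = indicator {x<..x + m} v * E v + indicator {x + m<..x + (m + \<tau>)} v * E v"
      if "0 \<le> m" for m v
      using that \<tau> by (auto split: split_indicator)
    from this[OF n] show ?thesis by (simp add: algebra_simps)
  qed
  also have "\<dots> = (LINT u|lborel. indicator {0<..\<tau>} u * (\<Sum>i<n. E (x + real i * \<tau> + u))) + (LINT u|lborel. indicator {0<..\<tau>} u * E (x + real n * \<tau> + u))"
    using Bochner_Integration.integral_add[OF iE iE] Suc.IH step by simp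
  also have "\<dots> = (LINT u|lborel. indicator {0<..\<tau>} u * (\<Sum>i<n. E (x + real i * \<tau> + u)) + indicator {0<..\<tau>} u * E (x + real n * \<tau> + u))"
  proof (rule Bochner_Integration.integral_add[symmetric])
    show "integrable lborel (\<lambda>u. indicator {0<..\<tau>} u * (\<Sum>i<n. E (x + real i * \<tau> + u)))"
      unfolding sum_distrib_left by (intro Bochner_Integration.integrable_sum iT)
  qed (rule iT)
  also have "\<dots> = (LINT u|lborel. indicator {0<..\<tau>} u * (\<Sum>i<Suc n. E (x + real i * \<tau> + u)))"
    by (simp add: distrib_left)
  finally show ?case .
qed simp

text \<open>Integrating the grid sums over the offset within one cell recovers the integral over the
  line, and each sum is at most V.\<close>

lemma integral_le_of_sums_le:
  fixes E :: "real \<Rightarrow> real"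
  assumes E: "integrable lborel E" and \<tau>: "0 < \<tau>" and V: "\<And>x n. (\<Sum>i<n. E (x + real i * \<tau>)) \<le> V" "0 \<le> V"
  shows "(LINT v|lborel. E v) \<le> \<tau> * V"
proof -
  have [measurable]: "E \<in> borel_measurable borel" using E by auto
  have le: "(LINT v|lborel. indicator {x<..x + real n * \<tau>} v * E v) \<le> \<tau> * V" for x n
  proof -
    have "(LINT v|lborel. indicator {x<..x + real n * \<tau>} v * E v) = (LINT u|lborel. indicator {0<..\<tau>} u * (\<Sum>i<n. E (x + real i * \<tau> + u)))"
      by (rule integral_translates[OF E less_imp_le[OF \<tau>]])
    also have "\<dots> \<le> (LINT u|lborel. indicator {0<..\<tau>} u * V)"
    proof (rule integral_mono_AE')
      show "integrable lborel (\<lambda>u. indicator {0<..\<tau>} u * V)"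
        using \<tau> by (intro integrable_mult_left integrable_real_indicator) auto
      have "(\<Sum>i<n. E (x + real i * \<tau> + u)) \<le> V" for u using V(1)[of "x + u" n] by (simp add: add_ac)
      then show "AE u in lborel. indicator {0<..\<tau>} u * (\<Sum>i<n. E (x + real i * \<tau> + u)) \<le> indicator {0<..\<tau>} u * V"
        by (intro AE_I2) (auto split: split_indicator)
    qed (use V in auto)
    also have "\<dots> = \<tau> * V" using \<tau> by simp
    finally show ?thesis .
  qed
  have "(\<lambda>n. LINT v|lborel. indicator {- real n * \<tau><..- real n * \<tau> + real (2 * n) * \<tau>} v * E v) \<longlonglongrightarrow> (LINT v|lborel. E v)"
  proof (rule integral_dominated_convergence[where w="\<lambda>v. \<bar>E v\<bar>"])
    have "(\<lambda>n. indicator {- real n * \<tau><..- real n * \<tau> + real (2 * n) * \<tau>} v * E v) \<longlonglongrightarrow> E v" for v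
    proof (rule tendsto_eventually)
      obtain n0 :: nat where n0: "\<bar>v\<bar> / \<tau> < real n0" using reals_Archimedean2[of "\<bar>v\<bar> / \<tau>"] by (elim exE)
      show "\<forall>\<^sub>F n in sequentially. indicator {- real n * \<tau><..- real n * \<tau> + real (2 * n) * \<tau>} v * E v = E v"
        using eventually_ge_at_top[of n0]
      proof eventually_elim
        case (elim n)
        then have "\<bar>v\<bar> / \<tau> < real n" using n0 by linarith
        then have "\<bar>v\<bar> < real n * \<tau>" using \<tau> by (simp add: field_simps)
        then show ?case by (auto simp: indicator_def algebra_simps)
      qed
    qed
    then show "AE v in lborel. (\<lambda>n. indicator {- real n * \<tau><..- real n * \<tau> + real (2 * n) * \<tau>} v * E v) \<longlonglongrightarrow> E v" by simp
  qed (use E in \<open>auto split: split_indicator\<close>)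
  then show ?thesis by (rule LIMSEQ_le_const2) (use le in blast)
qed

text \<open>Shifting by half a period \<open>\<pi> / \<bar>x\<bar>\<close> changes the sign of the exponential.\<close>

lemma ifourier_bounded_variation_decay:
  assumes F: "integrable lborel F" and bv: "bounded_variation F"
  obtains C where "0 < C" "\<And>x. x \<noteq> 0 \<Longrightarrow> cmod (ifourier F x) \<le> C / \<bar>x\<bar>"
proof -
  have [measurable]: "F \<in> borel_measurable borel" using F by auto
  obtain V where V: "0 \<le> V" "\<And>x \<tau> \<tau>' n. 0 \<le> \<tau>' \<Longrightarrow> \<tau>' \<le> \<tau> \<Longrightarrow>
    (\<Sum>i<n. cmod (F (x + real i * \<tau> + \<tau>') - F (x + real i * \<tau>))) \<le> V"
    by (rule bounded_variation_grid[OF bv]) (rule that)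
  \<comment> \<open>The summand 1 keeps the constant positive when V = 0.\<close>
  have bound: "cmod (ifourier F x) \<le> (1 / sqrt (2 * pi) * (pi / 2 * V) + 1) / \<bar>x\<bar>" if x: "x \<noteq> 0" for x
  proof -
    define \<tau> where "\<tau> = pi / \<bar>x\<bar>"
    have \<tau>: "0 < \<tau>" using x by (simp add: \<tau>_def)
    have \<tau>x: "cis (\<tau> * x) = -1"
      using x by (cases "0 < x") (auto simp: \<tau>_def complex_eq_iff)
    have iF: "integrable lborel (\<lambda>v. F v * cis (v * x))" using F by (intro integrable_mult_cis) auto
    have iF': "integrable lborel (\<lambda>v. F (\<tau> + 1 * v))" using F by (intro lborel_integrable_real_affine) auto
    then have iF'': "integrable lborel (\<lambda>v. F (\<tau> + 1 * v) * cis (v * x))" by (intro integrable_mult_cis) auto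
    have "(LINT v|lborel. F v * cis (v * x)) = \<bar>1\<bar> *\<^sub>R (LINT v|lborel. F (\<tau> + 1 * v) * cis ((\<tau> + 1 * v) * x))"
      by (rule lborel_integral_real_affine) simp
    also have "\<dots> = (LINT v|lborel. - (F (\<tau> + 1 * v) * cis (v * x)))"
      by (simp add: distrib_right \<tau>x flip: cis_mult)
    finally have shift: "(LINT v|lborel. F v * cis (v * x)) = - (LINT v|lborel. F (\<tau> + 1 * v) * cis (v * x))" by simp
    have "2 * (LINT v|lborel. F v * cis (v * x)) = (LINT v|lborel. F v * cis (v * x)) - (LINT v|lborel. F (\<tau> + 1 * v) * cis (v * x))"
      using shift by simp
    also have "\<dots> = (LINT v|lborel. F v * cis (v * x) - F (\<tau> + 1 * v) * cis (v * x))"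
      by (rule Bochner_Integration.integral_diff[OF iF iF'', symmetric])
    finally have "2 * cmod (LINT v|lborel. F v * cis (v * x)) = cmod (LINT v|lborel. F v * cis (v * x) - F (\<tau> + 1 * v) * cis (v * x))"
      by (metis norm_mult norm_numeral)
    also have "\<dots> \<le> (LINT v|lborel. cmod (F v * cis (v * x) - F (\<tau> + 1 * v) * cis (v * x)))"
      by (rule integral_norm_bound)
    also have "\<dots> = (LINT v|lborel. cmod (F (\<tau> + v) - F v))"
      by (intro Bochner_Integration.integral_cong refl)
        (simp add: left_diff_distrib[symmetric] norm_mult norm_minus_commute)
    also have "\<dots> \<le> \<tau> * V"
    proof (rule integral_le_of_sums_le[OF _ \<tau> _ V(1)])
      show "integrable lborel (\<lambda>v. cmod (F (\<tau> + v) - F v))"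
        using Bochner_Integration.integrable_diff[OF iF' F] by simp
      show "(\<Sum>i<n. cmod (F (\<tau> + (y + real i * \<tau>)) - F (y + real i * \<tau>))) \<le> V" for y n
        using V(2)[of \<tau> \<tau> y n] \<tau> by (simp add: add_ac)
    qed
    finally have "cmod (LINT v|lborel. F v * cis (v * x)) \<le> \<tau> / 2 * V" by simp
    then have "1 / sqrt (2 * pi) * cmod (LINT v|lborel. F v * cis (v * x)) \<le> 1 / sqrt (2 * pi) * (\<tau> / 2 * V)"
      by (intro mult_left_mono) auto
    then have "cmod (ifourier F x) \<le> 1 / sqrt (2 * pi) * (\<tau> / 2 * V)"
      by (simp add: ifourier_lborel norm_mult norm_divide)
    also have "\<dots> = (1 / sqrt (2 * pi) * (pi / 2 * V)) / \<bar>x\<bar>" by (simp add: \<tau>_def)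
    also have "\<dots> \<le> (1 / sqrt (2 * pi) * (pi / 2 * V) + 1) / \<bar>x\<bar>" by (intro divide_right_mono) auto
    finally show ?thesis .
  qed
  show ?thesis
  proof (rule that[OF _ bound])
    have "0 \<le> 1 / sqrt (2 * pi) * (pi / 2 * V)" using V(1) by simp
    then show "0 < 1 / sqrt (2 * pi) * (pi / 2 * V) + 1" by linarith
  qed
qed

text \<open>Compare each grid value with the values in the cell to its right: the differences add up
  to at most the variation, and averaging over the cell turns the rest into the integral of |f|
  divided by h.\<close>

lemma grid_sum_bounded_variation:
  assumes f: "integrable lborel f" and bv: "bounded_variation f" and h: "0 < h"
  obtains K where "\<And>x n. (\<Sum>i<n. cmod (f (x + real i * h))) \<le> K"
proof -
  have [measurable]: "f \<in> borel_measurable borel" using f by auto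
  obtain V where V: "0 \<le> V" "\<And>x \<tau> \<tau>' n. 0 \<le> \<tau>' \<Longrightarrow> \<tau>' \<le> \<tau> \<Longrightarrow>
    (\<Sum>i<n. cmod (f (x + real i * \<tau> + \<tau>') - f (x + real i * \<tau>))) \<le> V"
    by (rule bounded_variation_grid[OF bv]) (rule that)
  define A where "A = (LINT v|lborel. cmod (f v))"
  have "(\<Sum>i<n. cmod (f (x + real i * h))) \<le> (A + h * V) / h" for x n
  proof -
    define S where "S = (\<Sum>i<n. cmod (f (x + real i * h)))"
    have i1: "integrable lborel (\<lambda>u. indicator {0<..h} u * (\<Sum>i<n. cmod (f (x + real i * h + u))))"
    proof -
      have "integrable lborel (\<lambda>u. cmod (f (x + real i * h + 1 * u)))" for i
        using f by (intro integrable_norm lborel_integrable_real_affine) auto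
      then have "integrable lborel (\<lambda>u. \<Sum>i<n. cmod (f (x + real i * h + u)))"
        by (intro Bochner_Integration.integrable_sum) simp
      then show ?thesis
        by (rule Bochner_Integration.integrable_bound) (auto split: split_indicator)
    qed
    have i2: "integrable lborel (\<lambda>u. indicator {0<..h} u * V)"
      by (intro integrable_mult_left integrable_real_indicator) (use h in auto)
    have pt: "S \<le> (\<Sum>i<n. cmod (f (x + real i * h + u))) + V" if "u \<in> {0<..h}" for u
    proof -
      have "S \<le> (\<Sum>i<n. cmod (f (x + real i * h + u)) + cmod (f (x + real i * h + u) - f (x + real i * h)))"
        unfolding S_def by (intro sum_mono) (metis norm_minus_commute norm_triangle_sub)
      also have "\<dots> \<le> (\<Sum>i<n. cmod (f (x + real i * h + u))) + V"
        unfolding sum.distrib using V(2)[of u h x n] that by simp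
      finally show ?thesis .
    qed
    have "h * S = (LINT u|lborel. indicator {0<..h} u * S)" using h by simp
    also have "\<dots> \<le> (LINT u|lborel. indicator {0<..h} u * (\<Sum>i<n. cmod (f (x + real i * h + u))) + indicator {0<..h} u * V)"
    proof (rule integral_mono)
      show "integrable lborel (\<lambda>u. indicator {0<..h} u * S)"
        by (intro integrable_mult_left integrable_real_indicator) (use h in auto)
      show "integrable lborel (\<lambda>u. indicator {0<..h} u * (\<Sum>i<n. cmod (f (x + real i * h + u))) + indicator {0<..h} u * V)"
        using i1 i2 by (rule Bochner_Integration.integrable_add)
      show "indicator {0<..h} u * S \<le> indicator {0<..h} u * (\<Sum>i<n. cmod (f (x + real i * h + u))) + indicator {0<..h} u * V" for u
        using pt[of u] by (auto split: split_indicator)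
    qed
    also have "\<dots> = (LINT u|lborel. indicator {0<..h} u * (\<Sum>i<n. cmod (f (x + real i * h + u)))) + h * V"
      using Bochner_Integration.integral_add[OF i1 i2] h by simp
    also have "(LINT u|lborel. indicator {0<..h} u * (\<Sum>i<n. cmod (f (x + real i * h + u))))
       = (LINT v|lborel. indicator {x<..x + real n * h} v * cmod (f v))"
      using f h by (intro integral_translates[symmetric]) auto
    also have "\<dots> \<le> A"
      unfolding A_def using f by (intro integral_mono_AE') (auto split: split_indicator)
    finally have "h * S \<le> A + h * V" by simp
    then show ?thesis using h unfolding S_def by (simp add: field_simps)
  qed
  then show ?thesis using that by blast
qed

subsection \<open>Convergence of the quadrature sums\<close>

definition decaying :: "real \<Rightarrow> real \<Rightarrow> (real \<Rightarrow> complex) \<Rightarrow> bool" where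
  "decaying \<alpha> C F \<longleftrightarrow> (\<forall>v. cmod (F v) \<le> C * (1 + \<bar>v\<bar>) powr - \<alpha>)"

lemma integrable_inverse_powr:
  assumes "1 < \<alpha>"
  shows "integrable lborel (\<lambda>v. (1 + \<bar>v\<bar>) powr - \<alpha> :: real)"
proof -
  have g: "integrable lborel (\<lambda>u. indicator {1..} u * u powr - \<alpha> :: real)"
    using has_integral_powr_to_inf[of "- \<alpha>" 1] assms
    by (intro integrable_lborel_of_nonneg_integrable_on) auto
  have "integrable lborel (\<lambda>v. indicator {1..} (1 + 1 * v) * (1 + 1 * v) powr - \<alpha> + indicator {1..} (1 + (-1) * v) * (1 + (-1) * v) powr - \<alpha> :: real)"
    using lborel_integrable_real_affine[OF g, of 1 1] lborel_integrable_real_affine[OF g, of "-1" 1]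
    by (intro Bochner_Integration.integrable_add) auto
  then show ?thesis
    by (rule Bochner_Integration.integrable_bound) (auto simp: abs_if split: split_indicator)
qed

lemma decaying_integrable:
  assumes "1 < \<alpha>" "decaying \<alpha> C F" and [measurable]: "F \<in> borel_measurable borel"
  shows "integrable lborel F"
proof -
  have "integrable lborel (\<lambda>v. C * (1 + \<bar>v\<bar>) powr - \<alpha>)"
    by (rule integrable_mult_right[OF integrable_inverse_powr[OF assms(1)]])
  then show ?thesis
    by (rule Bochner_Integration.integrable_bound)
      (use assms(2) order_trans[OF _ abs_ge_self] in \<open>auto simp: decaying_def\<close>)
qed

lemma summable_inverse_powr:
  assumes "1 < \<alpha>" "0 < c"
  shows "summable (\<lambda>k. (1 + real k * c) powr - \<alpha>)"
proof (rule summable_comparison_test')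
  show "summable (\<lambda>k. c powr - \<alpha> * real k powr - \<alpha>)"
    using assms by (intro summable_mult) (simp add: summable_real_powr_iff)
  show "norm ((1 + real k * c) powr - \<alpha>) \<le> c powr - \<alpha> * real k powr - \<alpha>" if "1 \<le> k" for k
  proof -
    have "(1 + real k * c) powr - \<alpha> \<le> (c * real k) powr - \<alpha>"
      using that assms by (intro powr_mono2') auto
    also have "\<dots> = c powr - \<alpha> * real k powr - \<alpha>" by (rule powr_mult)
    finally show ?thesis by simp
  qed
qed

text \<open>The bound on F is used for |v| \<le> 1, where 1 + |v| \<le> 2, and the weighted bound
  elsewhere, where 1 + |v| \<le> 2|v|; hence the factor 2^\<alpha>.\<close>

lemma decaying_of_bounded:
  assumes F: "\<And>v. cmod (F v) \<le> A" and H: "\<And>v. \<bar>v\<bar> powr \<alpha> * cmod (F v) \<le> B" and "0 < \<alpha>"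
  shows "decaying \<alpha> (2 powr \<alpha> * (A + B)) F"
  unfolding decaying_def
proof
  fix v
  have A0: "0 \<le> A" using F[of 0] norm_ge_zero order_trans by blast
  have B0: "0 \<le> B" by (rule order_trans[OF _ H[of 0]]) simp
  have "(1 + \<bar>v\<bar>) powr \<alpha> * cmod (F v) \<le> 2 powr \<alpha> * (A + B)"
  proof (cases "\<bar>v\<bar> \<le> 1")
    case True
    then have "(1 + \<bar>v\<bar>) powr \<alpha> \<le> 2 powr \<alpha>" using \<open>0 < \<alpha>\<close> by (intro powr_mono2) auto
    then have "(1 + \<bar>v\<bar>) powr \<alpha> * cmod (F v) \<le> 2 powr \<alpha> * A" using F[of v] by (intro mult_mono) auto
    also have "\<dots> \<le> 2 powr \<alpha> * (A + B)" using B0 by (intro mult_left_mono) auto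
    finally show ?thesis .
  next
    case False
    then have "(1 + \<bar>v\<bar>) powr \<alpha> \<le> (2 * \<bar>v\<bar>) powr \<alpha>" using \<open>0 < \<alpha>\<close> by (intro powr_mono2) auto
    also have "\<dots> = 2 powr \<alpha> * \<bar>v\<bar> powr \<alpha>" by (rule powr_mult)
    finally have "(1 + \<bar>v\<bar>) powr \<alpha> * cmod (F v) \<le> 2 powr \<alpha> * \<bar>v\<bar> powr \<alpha> * cmod (F v)" by (intro mult_right_mono) auto
    also have "\<dots> = 2 powr \<alpha> * (\<bar>v\<bar> powr \<alpha> * cmod (F v))" by simp
    also have "\<dots> \<le> 2 powr \<alpha> * (A + B)" using H[of v] A0 by (intro mult_left_mono) auto
    finally show ?thesis .
  qed
  then show "cmod (F v) \<le> 2 powr \<alpha> * (A + B) * (1 + \<bar>v\<bar>) powr - \<alpha>"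
    by (simp add: powr_minus field_simps)
qed

section \<open>Symmetric summation and periodized Fejer means\<close>

definition fold_pm :: "(int \<Rightarrow> 'a) \<Rightarrow> nat \<Rightarrow> 'a::comm_monoid_add" where
  "fold_pm c k = (if k = 0 then c 0 else c (int k) + c (- int k))"

lemma sum_fold_pm: "(\<Sum>k = - int N..int N. c k) = (\<Sum>k\<le>N. fold_pm c k)"
proof (induction N)
  case (Suc N)
  have "{- int (Suc N)..int (Suc N)} = insert (int (Suc N)) (insert (- int (Suc N)) {- int N..int N})" by auto
  then show ?case using Suc by (simp add: fold_pm_def add_ac)
qed (simp add: fold_pm_def)

text \<open>Cut the line into translates of one period and use the periodicity of the kernel; the
  symmetric union of the pieces exhausts the line.\<close>

lemma fejer_periodization:
  fixes G :: "real \<Rightarrow> complex" and N :: nat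
  assumes G: "integrable lborel G"
  defines "J \<equiv> \<lambda>m. LINT t|lborel. indicator {-pi<..pi} t * (G (t + 2 * pi * of_int m) * complex_of_real (fejer_kernel N t))"
  shows "fold_pm J sums (LINT t|lborel. G t * complex_of_real (fejer_kernel N t))"
proof -
  have [measurable]: "G \<in> borel_measurable borel" using G by auto
  let ?g = "\<lambda>t. G t * complex_of_real (fejer_kernel N t)"
  have g: "integrable lborel ?g"
    using G fejer_kernel_bounded[of N] fejer_kernel_nonneg[of N]
    by (intro integrable_mult_bounded[where B="2 * real N + 1"]) (auto simp: abs_of_nonneg)
  have ig: "integrable lborel (\<lambda>t. indicator {a<..b} t * ?g t)" for a b
    by (rule Bochner_Integration.integrable_bound[OF g]) (auto split: split_indicator)
  have J: "(LINT t|lborel. indicator {(2 * of_int m - 1) * pi<..(2 * of_int m + 1) * pi} t * ?g t) = J m" for m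
  proof -
    have "(LINT t|lborel. indicator {(2 * of_int m - 1) * pi<..(2 * of_int m + 1) * pi} t * ?g t)
      = \<bar>1\<bar> *\<^sub>R (LINT t|lborel. indicator {(2 * of_int m - 1) * pi<..(2 * of_int m + 1) * pi} (2 * pi * of_int m + 1 * t) * ?g (2 * pi * of_int m + 1 * t))"
      by (rule lborel_integral_real_affine) simp
    also have "\<dots> = J m"
      unfolding J_def using fejer_kernel_periodic[of N _ m]
      by (auto simp: add.commute[of "2 * pi * of_int m"] algebra_simps intro!: Bochner_Integration.integral_cong split: split_indicator)
    finally show ?thesis .
  qed
  have part: "(\<Sum>k\<le>M. fold_pm J k) = (LINT t|lborel. indicator {-(2 * real M + 1) * pi<..(2 * real M + 1) * pi} t * ?g t)" for M
  proof (induction M)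
    case 0
    then show ?case using J[of 0] by (simp add: fold_pm_def)
  next
    case (Suc M)
    let ?I = "\<lambda>a b t. indicator {a<..b} t * ?g t"
    have "?I (-(2 * real (Suc M) + 1) * pi) ((2 * real (Suc M) + 1) * pi) t = ?I (-(2 * real M + 1) * pi) ((2 * real M + 1) * pi) t
       + (?I ((2 * of_int (int (Suc M)) - 1) * pi) ((2 * of_int (int (Suc M)) + 1) * pi) t
       + ?I ((2 * of_int (- int (Suc M)) - 1) * pi) ((2 * of_int (- int (Suc M)) + 1) * pi) t)" for t
    proof -
      define p where "p = (2 * real M + 1) * pi"
      have p: "0 < p" by (simp add: p_def)
      have e: "-(2 * real (Suc M) + 1) * pi = - (p + 2 * pi)" "(2 * real (Suc M) + 1) * pi = p + 2 * pi" "-(2 * real M + 1) * pi = - p"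
        "(2 * of_int (int (Suc M)) - 1) * pi = p" "(2 * of_int (int (Suc M)) + 1) * pi = p + 2 * pi"
        "(2 * of_int (- int (Suc M)) - 1) * pi = - (p + 2 * pi)" "(2 * of_int (- int (Suc M)) + 1) * pi = - p"
        by (simp_all add: p_def algebra_simps)
      have "indicator {- (p + q)<..p + q} t = (indicator {- p<..p} t + (indicator {p<..p + q} t + indicator {- (p + q)<..- p} t) :: complex)"
        if "0 < q" for q using p that by (auto simp: indicator_def)
      then have "indicator {- (p + 2 * pi)<..p + 2 * pi} t = (indicator {- p<..p} t + (indicator {p<..p + 2 * pi} t + indicator {- (p + 2 * pi)<..- p} t) :: complex)"
        by simp
      then show ?thesis unfolding e p_def[symmetric] by (simp add: distrib_right)
    qed
    then have "(LINT t|lborel. ?I (-(2 * real (Suc M) + 1) * pi) ((2 * real (Suc M) + 1) * pi) t)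
      = (LINT t|lborel. ?I (-(2 * real M + 1) * pi) ((2 * real M + 1) * pi) t) + (J (int (Suc M)) + J (- int (Suc M)))"
      unfolding J[symmetric] using ig by (simp only: Bochner_Integration.integral_add Bochner_Integration.integrable_add)
    then show ?case using Suc by (simp add: fold_pm_def)
  qed
  have "(\<lambda>M. LINT t|lborel. indicator {-(2 * real M + 1) * pi<..(2 * real M + 1) * pi} t * ?g t) \<longlonglongrightarrow> (LINT t|lborel. ?g t)"
  proof (rule integral_dominated_convergence[where w="\<lambda>t. cmod (?g t)"])
    have "(\<lambda>M. indicator {-(2 * real M + 1) * pi<..(2 * real M + 1) * pi} t * ?g t) \<longlonglongrightarrow> ?g t" for t
    proof (rule tendsto_eventually)
      obtain n0 :: nat where n0: "\<bar>t\<bar> < real n0" using reals_Archimedean2[of "\<bar>t\<bar>"] by (elim exE)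
      show "\<forall>\<^sub>F M in sequentially. indicator {-(2 * real M + 1) * pi<..(2 * real M + 1) * pi} t * ?g t = ?g t"
        using eventually_ge_at_top[of n0]
      proof eventually_elim
        case (elim M)
        have "real n0 \<le> real M" using elim by simp
        with n0 have "\<bar>t\<bar> < real M" by (rule order_less_le_trans)
        also have "\<dots> \<le> (2 * real M + 1) * 1" by simp
        also have "\<dots> \<le> (2 * real M + 1) * pi" using pi_gt3 by (intro mult_left_mono) auto
        finally have "\<bar>t\<bar> < (2 * real M + 1) * pi" .
        then have "-(2 * real M + 1) * pi < t" "t \<le> (2 * real M + 1) * pi"
          unfolding mult_minus_left by linarith+
        then have "t \<in> {-(2 * real M + 1) * pi<..(2 * real M + 1) * pi}" by (simp only: greaterThanAtMost_iff simp_thms)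
        then show ?case by (simp only: indicator_simps mult_1_left)
      qed
    qed
    then show "AE t in lborel. (\<lambda>M. indicator {-(2 * real M + 1) * pi<..(2 * real M + 1) * pi} t * ?g t) \<longlonglongrightarrow> ?g t" by simp
    show "AE t in lborel. cmod (indicator {-(2 * real M + 1) * pi<..(2 * real M + 1) * pi} t * ?g t) \<le> cmod (?g t)" for M
      by (intro AE_I2) (simp split: split_indicator)
  qed (use g in auto)
  then show ?thesis unfolding sums_def_le part .
qed

text \<open>Fejer's theorem gives the limit on each period, and Tannery's theorem exchanges it with
  the sum over the periods. The decay of \<open>G\<close>, together with the uniform bound on each
  piece, supplies the summable majorant.\<close>

lemma fejer_periodization_tendsto:
  assumes G: "continuous_on UNIV G" "integrable lborel G" and c: "0 < c" and \<alpha>: "1 < \<alpha>"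
    and decay: "\<And>t. cmod (G t) \<le> C * (1 + c * \<bar>t\<bar>) powr - \<alpha>"
  defines "b \<equiv> fold_pm (\<lambda>m. complex_of_real (2 * pi) * G (2 * pi * of_int m))"
  shows "(\<lambda>N. LINT t|lborel. G t * complex_of_real (fejer_kernel N t)) \<longlonglongrightarrow> suminf b" and "summable b"
proof -
  have [measurable]: "G \<in> borel_measurable borel" using G by auto
  have C0: "0 \<le> C" using order_trans[OF norm_ge_zero decay[of 0]] by simp
  define J where "J N m = (LINT t|lborel. indicator {-pi<..pi} t * (G (t + 2 * pi * of_int m) * complex_of_real (fejer_kernel N t)))" for N m
  define M where "M k = 2 * (2 * pi * (C * (1 + real k * (c * pi)) powr - \<alpha>))" for k
  have Jb: "cmod (J N m) \<le> 2 * pi * (C * (1 + real (nat \<bar>m\<bar>) * (c * pi)) powr - \<alpha>)" for N m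
    unfolding J_def
  proof (rule integrable_fejer_mult(2))
    fix t assume t: "t \<in> {-pi<..pi}"
    \<comment> \<open>On the m-th period the argument has modulus at least 2\<pi>|m| - \<pi>, which
      is at least \<pi>|m| unless m = 0.\<close>
    have "real (nat \<bar>m\<bar>) * pi \<le> \<bar>t + 2 * pi * of_int m\<bar>"
    proof (cases "m = 0")
      case False
      then have m1: "1 \<le> real_of_int \<bar>m\<bar>" by linarith
      have "2 * pi * real_of_int \<bar>m\<bar> \<le> \<bar>t + 2 * pi * of_int m\<bar> + \<bar>t\<bar>"
        using abs_triangle_ineq4[of "t + 2 * pi * of_int m" t] by (simp add: abs_mult)
      moreover have "\<bar>t\<bar> \<le> pi" using t by auto
      moreover have "pi * 1 \<le> pi * real_of_int \<bar>m\<bar>" using m1 by (intro mult_left_mono) auto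
      ultimately have "pi * real_of_int \<bar>m\<bar> \<le> \<bar>t + 2 * pi * of_int m\<bar>" by linarith
      then show ?thesis by (simp add: mult.commute)
    qed simp
    then have "1 + real (nat \<bar>m\<bar>) * (c * pi) \<le> 1 + c * \<bar>t + 2 * pi * of_int m\<bar>"
      using mult_left_mono[of "real (nat \<bar>m\<bar>) * pi" _ c] c by (simp add: mult_ac)
    then have "(1 + c * \<bar>t + 2 * pi * of_int m\<bar>) powr - \<alpha> \<le> (1 + real (nat \<bar>m\<bar>) * (c * pi)) powr - \<alpha>"
      using \<alpha> c by (intro powr_mono2') (auto intro!: add_pos_nonneg)
    then show "cmod (G (t + 2 * pi * of_int m)) \<le> C * (1 + real (nat \<bar>m\<bar>) * (c * pi)) powr - \<alpha>"
      using decay[of "t + 2 * pi * of_int m"] mult_left_mono[OF _ C0] order_trans by blast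
  qed measurable
  have bound: "cmod (fold_pm (J N) k) \<le> M k" for N k
  proof (cases "k = 0")
    case True
    have "M 0 = 2 * (2 * pi * C)" "cmod (J N 0) \<le> 2 * pi * C" "0 \<le> 2 * pi * C"
      using Jb[of N 0] C0 by (simp_all add: M_def)
    then show ?thesis unfolding True fold_pm_def if_P[OF refl] by linarith
  next
    case False
    have "cmod (J N (int k) + J N (- int k)) \<le> cmod (J N (int k)) + cmod (J N (- int k))" by (rule norm_triangle_ineq)
    also have "\<dots> \<le> M k" using Jb[of N "int k"] Jb[of N "- int k"] by (simp add: M_def)
    finally show ?thesis using False by (simp add: fold_pm_def)
  qed
  have M: "summable M"
    unfolding M_def using summable_inverse_powr[OF \<alpha>, of "c * pi"] c by (intro summable_mult) auto
  have Jlim: "(\<lambda>N. J N m) \<longlonglongrightarrow> complex_of_real (2 * pi) * G (2 * pi * of_int m)" for m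
  proof -
    have "continuous_on UNIV (\<lambda>t. G (t + 2 * pi * of_int m))"
      by (rule continuous_on_compose2[OF G(1)]) (auto intro: continuous_intros)
    from fejer[OF this] show ?thesis unfolding J_def by simp
  qed
  have lim: "(\<lambda>N. fold_pm (J N) k) \<longlonglongrightarrow> b k" for k
  proof (cases "k = 0")
    case True
    then show ?thesis using Jlim[of 0] by (simp add: b_def fold_pm_def)
  next
    case False
    then show ?thesis using tendsto_add[OF Jlim[of "int k"] Jlim[of "- int k"]] by (simp add: b_def fold_pm_def)
  qed
  have T: "(\<forall>\<^sub>F N in sequentially. summable (\<lambda>k. norm (fold_pm (J N) k))) \<and> summable (\<lambda>k. norm (b k)) \<and>
     (\<lambda>N. suminf (\<lambda>k. fold_pm (J N) k)) \<longlonglongrightarrow> suminf b"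
    using bound by (intro tannerys_theorem[where M=M] lim M) (auto intro: always_eventually)
  have "suminf (\<lambda>k. fold_pm (J N) k) = (LINT t|lborel. G t * complex_of_real (fejer_kernel N t))" for N
    using fejer_periodization[OF G(2), of N] unfolding J_def[symmetric] by (simp add: sums_iff)
  then show "(\<lambda>N. LINT t|lborel. G t * complex_of_real (fejer_kernel N t)) \<longlonglongrightarrow> suminf b" using T by simp
  show "summable b" using T summable_norm_cancel by blast
qed

lemma dirichlet_kernel_alt: "dirichlet_kernel n t = (\<Sum>k\<le>n. if k = 0 then 1 else 2 * cos (real k * t))"
  unfolding dirichlet_kernel_def by (induction n) auto

text \<open>Pairing m with -m turns exponentials into cosines, so the quadrature sums of an inverse
  transform are integrals of \<open>F\<close> against Dirichlet kernels, and their means integrals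
  against Fejer kernels.\<close>

lemma sum_ifourier_dirichlet:
  assumes F: "integrable lborel F"
  shows "(\<Sum>k\<le>n. fold_pm (\<lambda>m. ifourier F (h * of_int m)) k)
    = complex_of_real (1 / sqrt (2 * pi)) * (LINT v|lborel. F v * complex_of_real (dirichlet_kernel n (h * v)))"
proof -
  have [measurable]: "F \<in> borel_measurable borel" using F by auto
  let ?c = "complex_of_real (1 / sqrt (2 * pi))"
  define d where "d k v = (if k = 0 then 1 else 2 * cos (real k * (h * v)))" for k :: nat and v
  have ic: "integrable lborel (\<lambda>v. F v * cis (v * x))" for x using F by (intro integrable_mult_cis) auto
  have id: "integrable lborel (\<lambda>v. F v * complex_of_real (d k v))" for k
    unfolding d_def using F by (intro integrable_mult_bounded[where B=2]) (auto simp: norm_mult abs_mult)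
  have "fold_pm (\<lambda>m. ifourier F (h * of_int m)) k = ?c * (LINT v|lborel. F v * complex_of_real (d k v))" for k
  proof (cases "k = 0")
    case False
    have "fold_pm (\<lambda>m. ifourier F (h * of_int m)) k
       = ?c * ((LINT v|lborel. F v * cis (v * (h * real k))) + (LINT v|lborel. F v * cis (v * (- (h * real k)))))"
      using False by (simp add: fold_pm_def ifourier_lborel distrib_left)
    also have "\<dots> = ?c * (LINT v|lborel. F v * cis (v * (h * real k)) + F v * cis (v * (- (h * real k))))"
      by (simp only: Bochner_Integration.integral_add[OF ic ic])
    also have "(\<lambda>v. F v * cis (v * (h * real k)) + F v * cis (v * (- (h * real k)))) = (\<lambda>v. F v * complex_of_real (d k v))"
    proof
      fix v
      have "cis (v * (h * real k)) + cis (v * (- (h * real k))) = complex_of_real (d k v)"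
        using False by (simp add: d_def complex_eq_iff mult_ac)
      then show "F v * cis (v * (h * real k)) + F v * cis (v * (- (h * real k))) = F v * complex_of_real (d k v)"
        by (simp only: distrib_left[symmetric])
    qed
    finally show ?thesis .
  qed (simp add: fold_pm_def d_def ifourier_lborel)
  then have "(\<Sum>k\<le>n. fold_pm (\<lambda>m. ifourier F (h * of_int m)) k) = ?c * (\<Sum>k\<le>n. (LINT v|lborel. F v * complex_of_real (d k v)))"
    by (simp only: sum_distrib_left)
  also have "(\<Sum>k\<le>n. (LINT v|lborel. F v * complex_of_real (d k v))) = (LINT v|lborel. (\<Sum>k\<le>n. F v * complex_of_real (d k v)))"
    by (intro Bochner_Integration.integral_sum[symmetric] id)
  also have "(\<lambda>v. (\<Sum>k\<le>n. F v * complex_of_real (d k v))) = (\<lambda>v. F v * complex_of_real (dirichlet_kernel n (h * v)))"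
    unfolding dirichlet_kernel_alt d_def by (simp add: sum_distrib_left)
  finally show ?thesis .
qed

text \<open>The rescaling t = hv moves the peaks of the kernel from 2\<pi>m to m\<sigma>. The factor
  is 2\<pi> from Fejer's theorem times 1/(\<surd>(2\<pi>) h), that is
  \<sigma>/\<surd>(2\<pi>).\<close>

theorem poisson_means:
  assumes F: "continuous_on UNIV F" "decaying \<alpha> C F" and \<alpha>: "1 < \<alpha>" and \<sigma>: "0 < \<sigma>" and h: "h = 2 * pi / \<sigma>"
  shows "(\<lambda>N. (\<Sum>n<N. \<Sum>k\<le>n. fold_pm (\<lambda>m. ifourier F (h * of_int m)) k) / of_nat N)
      \<longlonglongrightarrow> complex_of_real (\<sigma> / sqrt (2 * pi)) * suminf (fold_pm (\<lambda>m. F (of_int m * \<sigma>)))"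
    and "summable (fold_pm (\<lambda>m. F (of_int m * \<sigma>)))"
proof -
  have hp: "0 < h" using \<sigma> h by simp
  have m[measurable]: "F \<in> borel_measurable borel" using F by (auto intro: borel_measurable_continuous_onI)
  have Fi: "integrable lborel F" using decaying_integrable[OF \<alpha> F(2) m] .
  define G where "G t = F (0 + 1 / h * t)" for t
  have Gc: "continuous_on UNIV G"
    unfolding G_def[abs_def] using hp by (intro continuous_on_compose2[OF F(1)] continuous_intros) auto
  have Gi: "integrable lborel G"
    unfolding G_def[abs_def] using Fi hp by (intro lborel_integrable_real_affine) auto
  have Gd: "cmod (G t) \<le> C * (1 + 1 / h * \<bar>t\<bar>) powr - \<alpha>" for t
    using F(2) hp unfolding decaying_def G_def by (metis abs_mult abs_of_pos add_0 zero_less_divide_1_iff)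
  have int: "integrable lborel (\<lambda>v. F v * complex_of_real (dirichlet_kernel n (h * v)))" for n
    using Fi dirichlet_kernel_le by (intro integrable_mult_bounded[where B="1 + 2 * real n"]) auto
  have mean: "(\<Sum>n<N. \<Sum>k\<le>n. fold_pm (\<lambda>m. ifourier F (h * of_int m)) k) / of_nat N
     = complex_of_real (1 / (sqrt (2 * pi) * h)) * (LINT t|lborel. G t * complex_of_real (fejer_kernel N t))" for N
  proof -
    have "(\<Sum>n<N. \<Sum>k\<le>n. fold_pm (\<lambda>m. ifourier F (h * of_int m)) k) / of_nat N
      = complex_of_real (1 / sqrt (2 * pi)) * ((\<Sum>n<N. (LINT v|lborel. F v * complex_of_real (dirichlet_kernel n (h * v)))) / of_nat N)"
      unfolding sum_ifourier_dirichlet[OF Fi] by (simp add: sum_distrib_left)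
    also have "(\<Sum>n<N. (LINT v|lborel. F v * complex_of_real (dirichlet_kernel n (h * v)))) = (LINT v|lborel. (\<Sum>n<N. F v * complex_of_real (dirichlet_kernel n (h * v))))"
      by (intro Bochner_Integration.integral_sum[symmetric] int)
    also have "\<dots> / of_nat N = (LINT v|lborel. (\<Sum>n<N. F v * complex_of_real (dirichlet_kernel n (h * v))) / of_nat N)"
      by simp
    also have "(\<lambda>v. (\<Sum>n<N. F v * complex_of_real (dirichlet_kernel n (h * v))) / of_nat N) = (\<lambda>v. F v * complex_of_real (fejer_kernel N (h * v)))"
      by (simp add: fejer_kernel_def sum_distrib_left)
    also have "(LINT v|lborel. F v * complex_of_real (fejer_kernel N (h * v)))
       = \<bar>1 / h\<bar> *\<^sub>R (LINT t|lborel. F (0 + 1 / h * t) * complex_of_real (fejer_kernel N (h * (0 + 1 / h * t))))"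
      using hp by (intro lborel_integral_real_affine) auto
    also have "\<dots> = complex_of_real (1 / h) * (LINT t|lborel. G t * complex_of_real (fejer_kernel N t))"
      using hp by (simp add: G_def scaleR_conv_of_real)
    finally show ?thesis by (simp add: divide_inverse mult_ac)
  qed
  have b: "fold_pm (\<lambda>m. complex_of_real (2 * pi) * G (2 * pi * of_int m)) = (\<lambda>k. complex_of_real (2 * pi) * fold_pm (\<lambda>m. F (of_int m * \<sigma>)) k)"
  proof -
    have "G (2 * pi * of_int m) = F (of_int m * \<sigma>)" for m using \<sigma> by (simp add: G_def h mult_ac)
    then show ?thesis by (auto simp: fold_pm_def distrib_left)
  qed
  have c: "0 < 1 / h" using hp by simp
  note T = fejer_periodization_tendsto[OF Gc Gi c \<alpha> Gd, unfolded b]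
  show s: "summable (fold_pm (\<lambda>m. F (of_int m * \<sigma>)))"
    using T(2) by (simp add: summable_cmult_iff)
  have "(\<lambda>N. complex_of_real (1 / (sqrt (2 * pi) * h)) * (LINT t|lborel. G t * complex_of_real (fejer_kernel N t)))
     \<longlonglongrightarrow> complex_of_real (1 / (sqrt (2 * pi) * h)) * (\<Sum>k. complex_of_real (2 * pi) * fold_pm (\<lambda>m. F (of_int m * \<sigma>)) k)"
    by (intro tendsto_mult_left T(1))
  also have "(\<Sum>k. complex_of_real (2 * pi) * fold_pm (\<lambda>m. F (of_int m * \<sigma>)) k) = complex_of_real (2 * pi) * suminf (fold_pm (\<lambda>m. F (of_int m * \<sigma>)))"
    by (rule suminf_mult[OF s])
  also have "complex_of_real (1 / (sqrt (2 * pi) * h)) * (complex_of_real (2 * pi) * suminf (fold_pm (\<lambda>m. F (of_int m * \<sigma>))))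
     = complex_of_real (\<sigma> / sqrt (2 * pi)) * suminf (fold_pm (\<lambda>m. F (of_int m * \<sigma>)))"
  proof -
    have "1 / (sqrt (2 * pi) * h) * (2 * pi) = \<sigma> / sqrt (2 * pi)" using \<sigma> by (simp add: h)
    then show ?thesis by (metis mult.assoc of_real_mult)
  qed
  finally show "(\<lambda>N. (\<Sum>n<N. \<Sum>k\<le>n. fold_pm (\<lambda>m. ifourier F (h * of_int m)) k) / of_nat N)
      \<longlonglongrightarrow> complex_of_real (\<sigma> / sqrt (2 * pi)) * suminf (fold_pm (\<lambda>m. F (of_int m * \<sigma>)))"
    unfolding mean .
qed

lemma slowly_oscillating_quadrature_sums:
  assumes f: "integrable lborel f" and F: "integrable lborel F" and inv: "f = ifourier F"
    and bv: "bounded_variation f \<or> bounded_variation F" and h: "0 < h"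
  shows "slowly_oscillating (\<lambda>n. \<Sum>k\<le>n. fold_pm (\<lambda>m. f (h * of_int m)) k)"
  using bv
proof
  assume "bounded_variation f"
  then obtain K where K: "\<And>x n. (\<Sum>i<n. cmod (f (x + real i * h))) \<le> K"
    by (rule grid_sum_bounded_variation[OF f _ h]) (rule that)
  have "summable (\<lambda>k. cmod (f (h * real k)))"
    using K[of 0] by (intro summableI_nonneg_bounded[where x=K]) (auto simp: mult.commute)
  moreover have "summable (\<lambda>k. cmod (f (- (h * real k))))"
  proof (rule summableI_nonneg_bounded[where x=K])
    fix n
    \<comment> \<open>Reversing the order presents the left half as a grid running upwards from
      -(n-1)h; the bound \<open>K\<close> is uniform in the starting point.\<close>
    have "(\<Sum>i<n. cmod (f (- (h * real i)))) = (\<Sum>i<n. cmod (f (- (h * real (n - Suc i)))))"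
      by (rule sum.nat_diff_reindex[symmetric])
    also have "\<dots> = (\<Sum>i<n. cmod (f (- (real n - 1) * h + real i * h)))"
      by (intro sum.cong refl arg_cong[where f=cmod] arg_cong[where f=f]) (auto simp: of_nat_diff algebra_simps)
    also have "\<dots> \<le> K" by (rule K)
    finally show "(\<Sum>i<n. cmod (f (- (h * real i)))) \<le> K" .
  qed simp
  ultimately have "summable (\<lambda>k. cmod (f (h * real k)) + cmod (f (- (h * real k))))" by (rule summable_add)
  then have "summable (fold_pm (\<lambda>m. f (h * of_int m)))"
    by (rule summable_comparison_test'[where N=0]) (auto simp: fold_pm_def norm_triangle_ineq)
  then show ?thesis by (intro slowly_oscillating_convergent) (simp add: summable_iff_convergent')
next
  assume "bounded_variation F"
  then obtain C where C: "0 < C" "\<And>x. x \<noteq> 0 \<Longrightarrow> cmod (ifourier F x) \<le> C / \<bar>x\<bar>"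
    by (rule ifourier_bounded_variation_decay[OF F]) (rule that)
  show ?thesis
  proof (rule slowly_oscillating_partial_sums)
    fix k :: nat assume k: "0 < k"
    have "cmod (f (h * real k) + f (- (h * real k))) \<le> cmod (f (h * real k)) + cmod (f (- (h * real k)))" by (rule norm_triangle_ineq)
    also have "\<dots> \<le> C / \<bar>h * real k\<bar> + C / \<bar>- (h * real k)\<bar>"
      unfolding inv using k h by (intro add_mono C) auto
    also have "\<dots> = (2 * C / h) / real k" using h k by (simp add: abs_mult)
    finally show "cmod (fold_pm (\<lambda>m. f (h * of_int m)) k) \<le> (2 * C / h) / real k" using k by (simp add: fold_pm_def)
  qed (use C h in simp)
qed

section \<open>The quadrature error\<close>

lemma zeta_summable: "1 < \<alpha> \<Longrightarrow> summable (\<lambda>n. 1 / real (Suc n) powr \<alpha>)"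
  using summable_inverse_powr[of \<alpha> 1] by (simp add: powr_minus divide_inverse)

lemma zeta_pos: "1 < \<alpha> \<Longrightarrow> 0 < zeta \<alpha>"
  unfolding zeta_def by (intro suminf_pos zeta_summable) auto

text \<open>The frequency 0 drops out: the integral of f is \<surd>(2\<pi>) F(0), and h times the
  Poisson factor \<sigma>/\<surd>(2\<pi>) is also \<surd>(2\<pi>).\<close>

lemma quadrature_remainder_eq:
  assumes f: "f \<in> quadrature_class" and \<alpha>: "1 < \<alpha>" and decay: "decaying \<alpha> C (fourier f)" and \<sigma>: "0 < \<sigma>"
  shows "quadrature_remainder \<sigma> f = - complex_of_real (sqrt (2 * pi)) * (\<Sum>k. fourier f (real (Suc k) * \<sigma>) + fourier f (- (real (Suc k) * \<sigma>)))"
proof -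
  define F where "F = fourier f"
  define h where "h = 2 * pi / \<sigma>"
  have h: "0 < h" using \<sigma> by (simp add: h_def)
  have fb: "f \<in> bcontfun" and bv: "bounded_variation f \<or> bounded_variation F" and fl: "integrable lebesgue f"
    using f by (auto simp: quadrature_class_def F_def)
  have [measurable]: "f \<in> borel_measurable borel" using bcontfun_borel[OF fb] .
  have fi: "integrable lborel f" using fl by (subst (asm) integrable_completion) auto
  have Fc: "continuous_on UNIV F" unfolding F_def by (rule continuous_fourier[OF fi])
  have Fi: "integrable lborel F"
    using decaying_integrable[OF \<alpha> decay] borel_measurable_fourier[OF fi] by (simp add: F_def)
  have inv: "ifourier F = f" unfolding F_def using fourier_inversion[OF fi fb] Fi by (simp add: F_def)
  define B where "B = fold_pm (\<lambda>m. F (of_int m * \<sigma>))"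
  note P = poisson_means[OF Fc decay[folded F_def] \<alpha> \<sigma> h_def, unfolded inv, folded B_def]
  have "(\<lambda>n. \<Sum>k\<le>n. fold_pm (\<lambda>m. f (h * of_int m)) k) \<longlonglongrightarrow> complex_of_real (\<sigma> / sqrt (2 * pi)) * suminf B"
    by (rule tauberian_means[OF P(1) slowly_oscillating_quadrature_sums[OF fi Fi inv[symmetric] bv h]])
  then have lim: "lim (\<lambda>N. \<Sum>k = - int N..int N. f (h * real_of_int k)) = complex_of_real (\<sigma> / sqrt (2 * pi)) * suminf B"
    unfolding sum_fold_pm by (rule limI)
  have B: "B (Suc k) = fourier f (real (Suc k) * \<sigma>) + fourier f (- (real (Suc k) * \<sigma>))" for k
    by (simp add: B_def fold_pm_def F_def del: of_nat_Suc)
  have "suminf B = B 0 + (\<Sum>k. B (Suc k))" using suminf_split_head[OF P(2)] by (simp add: algebra_simps)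
  moreover have "B 0 = F 0" by (simp add: B_def fold_pm_def)
  moreover have "(LINT t|lebesgue. f t) = complex_of_real (sqrt (2 * pi)) * F 0"
    by (simp add: F_def fourier_def)
  moreover have "h * (\<sigma> / sqrt (2 * pi)) = sqrt (2 * pi)"
    using \<sigma> by (simp add: h_def real_div_sqrt)
  then have "complex_of_real h * (complex_of_real (\<sigma> / sqrt (2 * pi)) * suminf B) = complex_of_real (sqrt (2 * pi)) * suminf B"
    by (metis mult.assoc of_real_mult)
  ultimately have "quadrature_remainder \<sigma> f = - complex_of_real (sqrt (2 * pi)) * (\<Sum>k. B (Suc k))"
    unfolding quadrature_remainder_def Let_def h_def[symmetric] lim by (simp add: algebra_simps)
  then show "quadrature_remainder \<sigma> f = - complex_of_real (sqrt (2 * pi)) * (\<Sum>k. fourier f (real (Suc k) * \<sigma>) + fourier f (- (real (Suc k) * \<sigma>)))"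
    unfolding B .
qed

text \<open>At the nodes \<open>k \<sigma>\<close>, \<open>k \<noteq> 0\<close>, the transforms of functions in the Bernstein space vanish, so
  \<open>H (k \<sigma>)\<close> is bounded by the distance.\<close>

theorem quadrature_remainder_le:
  assumes f: "f \<in> quadrature_class" and \<alpha>: "1 < \<alpha>" and H: "H \<in> bcontfun" and HF: "\<And>v. cmod (H v) = \<bar>v\<bar> powr \<alpha> * cmod (fourier f v)"
    and g: "has_fourier_L2 g H" and \<sigma>: "0 < \<sigma>" and h: "h = 2 * pi / \<sigma>"
  shows "cmod (quadrature_remainder \<sigma> f) \<le> h powr \<alpha> * (2 * zeta \<alpha> / (2 * pi) powr (\<alpha> - 1 / 2)) * dist_infty g (bernstein_L1 \<sigma>)"
proof -
  have fl: "integrable lebesgue f" using f by (simp add: quadrature_class_def)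
  obtain BH where BH: "\<And>v. cmod (H v) \<le> BH" using bcontfunE[OF H] by metis
  have decay: "decaying \<alpha> (2 powr \<alpha> * (1 / sqrt (2 * pi) * (LINT u|lebesgue. cmod (f u)) + BH)) (fourier f)"
    using \<alpha> BH norm_fourier_le[OF fl] by (intro decaying_of_bounded) (auto simp flip: HF)
  define X where "X = h powr \<alpha> * (2 * zeta \<alpha> / (2 * pi) powr (\<alpha> - 1 / 2))"
  have X: "0 < X" using zeta_pos[OF \<alpha>] h \<sigma> by (simp add: X_def)
  have eqH: "fourier_L2_bcont g = H" using fourier_L2_bcont_eqI[OF g H] .
  have bound: "cmod (quadrature_remainder \<sigma> f) \<le> X * (SUP v. cmod (H v - fourier q v))" if q: "q \<in> bernstein_L1 \<sigma>" for q
  proof -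
    define D where "D = (SUP v. cmod (H v - fourier q v))"
    have ql: "integrable lebesgue q" using q by (simp add: bernstein_L1_def)
    have D: "cmod (H v - fourier q v) \<le> D" for v
      unfolding D_def
    proof (rule cSUP_upper)
      have "cmod (H v - fourier q v) \<le> BH + 1 / sqrt (2 * pi) * (LINT u|lebesgue. cmod (q u))" for v
        by (rule order_trans[OF norm_triangle_ineq4 add_mono[OF BH norm_fourier_le[OF ql]]])
      then show "bdd_above (range (\<lambda>v. cmod (H v - fourier q v)))" by (rule bdd_aboveI2)
    qed simp
    have Fle: "cmod (fourier f v) \<le> D / \<sigma> powr \<alpha> * (1 / real (Suc k) powr \<alpha>)" if v: "\<bar>v\<bar> = real (Suc k) * \<sigma>" for v k
    proof -
      \<comment> \<open>The first nodes are \<sigma> and -\<sigma> themselves; they count as outside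
        because the spectral interval is open.\<close>
      have "\<sigma> \<le> \<bar>v\<bar>" using v \<sigma> by simp
      then have "fourier q v = 0" using q by (auto simp: bernstein_L1_def abs_if split: if_splits)
      then have "\<bar>v\<bar> powr \<alpha> * cmod (fourier f v) \<le> D" using D[of v] HF[of v] by simp
      moreover have "0 < \<bar>v\<bar> powr \<alpha>" using v \<sigma> by simp
      ultimately have "cmod (fourier f v) \<le> D / \<bar>v\<bar> powr \<alpha>" by (simp add: pos_le_divide_eq mult.commute)
      also have "\<bar>v\<bar> powr \<alpha> = real (Suc k) powr \<alpha> * \<sigma> powr \<alpha>" unfolding v by (rule powr_mult)
      finally show ?thesis by (simp add: mult.commute)
    qed
    let ?b = "\<lambda>k. fourier f (real (Suc k) * \<sigma>) + fourier f (- (real (Suc k) * \<sigma>))"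
    have ble: "cmod (?b k) \<le> 2 * (D / \<sigma> powr \<alpha>) * (1 / real (Suc k) powr \<alpha>)" for k
      using norm_triangle_ineq[of "fourier f (real (Suc k) * \<sigma>)" "fourier f (- (real (Suc k) * \<sigma>))"]
        Fle[of "real (Suc k) * \<sigma>" k] Fle[of "- (real (Suc k) * \<sigma>)" k] \<sigma> by (simp del: of_nat_Suc)
    have "cmod (\<Sum>k. ?b k) \<le> (\<Sum>k. 2 * (D / \<sigma> powr \<alpha>) * (1 / real (Suc k) powr \<alpha>))"
      by (rule norm_suminf_le[OF ble summable_mult[OF zeta_summable[OF \<alpha>]]])
    also have "\<dots> = 2 * (D / \<sigma> powr \<alpha>) * zeta \<alpha>"
      unfolding zeta_def by (rule suminf_mult[OF zeta_summable[OF \<alpha>]])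
    finally have "cmod (\<Sum>k. ?b k) \<le> 2 * (D / \<sigma> powr \<alpha>) * zeta \<alpha>" .
    then have "sqrt (2 * pi) * cmod (\<Sum>k. ?b k) \<le> sqrt (2 * pi) * (2 * (D / \<sigma> powr \<alpha>) * zeta \<alpha>)"
      by (rule mult_left_mono) simp
    then have "cmod (quadrature_remainder \<sigma> f) \<le> sqrt (2 * pi) * (2 * (D / \<sigma> powr \<alpha>) * zeta \<alpha>)"
      unfolding quadrature_remainder_eq[OF f \<alpha> decay \<sigma>] by (simp add: norm_mult del: of_nat_Suc)
    also have "\<dots> = X * D"
    proof -
      have "h powr \<alpha> = (2 * pi) powr \<alpha> / \<sigma> powr \<alpha>" using \<sigma> by (simp add: h powr_divide)
      moreover define q where "q = (2 * pi) powr (\<alpha> - 1 / 2)"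
      moreover have "0 < q" by (simp add: q_def)
      moreover have "(2 * pi) powr \<alpha> = sqrt (2 * pi) * q" by (simp add: q_def powr_diff powr_half_sqrt)
      ultimately show ?thesis by (simp add: X_def)
    qed
    finally show ?thesis by (simp add: D_def)
  qed
  \<comment> \<open>Dividing by the positive constant first lets the infimum be bounded below
    function by function.\<close>
  have "cmod (quadrature_remainder \<sigma> f) / X \<le> dist_infty g (bernstein_L1 \<sigma>)"
    unfolding dist_infty_def eqH
  proof (rule cINF_greatest)
    have "(\<lambda>x. 0) \<in> bernstein_L1 \<sigma>" by (simp add: bernstein_L1_def fourier_def)
    then show "bernstein_L1 \<sigma> \<noteq> {}" by blast
    show "cmod (quadrature_remainder \<sigma> f) / X \<le> (SUP v. cmod (H v - fourier q v))" if "q \<in> bernstein_L1 \<sigma>" for q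
      using bound[OF that] X by (simp add: pos_divide_le_eq mult.commute)
  qed
  then have "cmod (quadrature_remainder \<sigma> f) \<le> X * dist_infty g (bernstein_L1 \<sigma>)"
    using X by (simp add: pos_divide_le_eq mult.commute)
  then show ?thesis unfolding X_def .
qed

text \<open>For k = s - 1, boundedness of v^s F would give only decay 1/|v|, which is not
  integrable. Instead v^s F and 1/|v| are both square integrable away from 0, and half the sum of
  the squares bounds their product.\<close>

lemma integrable_power_mult:
  assumes F: "integrable lborel F" and [measurable]: "F \<in> borel_measurable borel"
    and H: "energy (\<lambda>v. complex_of_real v ^ s * F v) < \<infinity>" and k: "k < s"
  shows "integrable lborel (\<lambda>v. complex_of_real v ^ k * F v)"
proof -
  have iH: "integrable lborel (\<lambda>v. (cmod (complex_of_real v ^ s * F v))\<^sup>2)"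
    by (rule energy_lborel(1)[OF _ H]) measurable
  have "integrable lborel (\<lambda>v. cmod (F v) + ((cmod (complex_of_real v ^ s * F v))\<^sup>2 + 4 * (1 + \<bar>v\<bar>) powr - 2) / 2)"
    using F iH integrable_inverse_powr[of 2] by auto
  then show ?thesis
  proof (rule Bochner_Integration.integrable_bound)
    have "cmod (complex_of_real v ^ k * F v) \<le> cmod (F v) + ((cmod (complex_of_real v ^ s * F v))\<^sup>2 + 4 * (1 + \<bar>v\<bar>) powr - 2) / 2" for v
    proof (cases "\<bar>v\<bar> \<le> 1")
      case True
      then have "\<bar>v\<bar> ^ k * cmod (F v) \<le> 1 * cmod (F v)" by (intro mult_right_mono power_le_one) auto
      moreover have "0 \<le> ((cmod (complex_of_real v ^ s * F v))\<^sup>2 + 4 * (1 + \<bar>v\<bar>) powr - 2) / 2" by simp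
      ultimately show ?thesis by (simp add: norm_mult norm_power add_increasing2)
    next
      case False
      define y where "y = cmod (complex_of_real v ^ s * F v)"
      have y: "y = \<bar>v\<bar> ^ s * cmod (F v)" by (simp add: y_def norm_mult norm_power)
      have "\<bar>v\<bar> ^ k \<le> \<bar>v\<bar> ^ (s - 1)" using False k by (intro power_increasing) auto
      then have "\<bar>v\<bar> ^ k * cmod (F v) \<le> \<bar>v\<bar> ^ (s - 1) * cmod (F v)" by (intro mult_right_mono) auto
      also have "\<bar>v\<bar> ^ (s - 1) * cmod (F v) = y * (1 / \<bar>v\<bar>)"
        using False k unfolding y by (cases s) auto
      also have "\<dots> \<le> y * (2 / (1 + \<bar>v\<bar>))"
        using False by (intro mult_left_mono) (auto simp: y_def field_simps)
      also have "\<dots> \<le> (y\<^sup>2 + (2 / (1 + \<bar>v\<bar>))\<^sup>2) / 2"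
        using sum_squares_bound[of y "2 / (1 + \<bar>v\<bar>)"] by simp
      also have "(2 / (1 + \<bar>v\<bar>))\<^sup>2 = 4 * (1 + \<bar>v\<bar>) powr - 2"
        by (simp add: power_divide powr_minus divide_inverse powr_numeral power_inverse)
      finally have fin: "\<bar>v\<bar> ^ k * cmod (F v) \<le> (y\<^sup>2 + 4 * (1 + \<bar>v\<bar>) powr - 2) / 2" .
      have e: "cmod (complex_of_real v ^ k * F v) = \<bar>v\<bar> ^ k * cmod (F v)" by (simp add: norm_mult norm_power)
      show ?thesis unfolding e y_def[symmetric] using add_increasing[OF norm_ge_zero fin] .
    qed
    then show "AE v in lborel. norm (complex_of_real v ^ k * F v) \<le> norm (cmod (F v) + ((cmod (complex_of_real v ^ s * F v))\<^sup>2 + 4 * (1 + \<bar>v\<bar>) powr - 2) / 2)"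
      by (intro AE_I2) (rule order_trans, assumption, simp)
  qed measurable
qed

lemma bcontfun_power_mult:
  assumes F: "F \<in> bcontfun" and H: "(\<lambda>v. complex_of_real v ^ s * F v) \<in> bcontfun" and k: "k \<le> s"
  shows "(\<lambda>v. complex_of_real v ^ k * F v) \<in> bcontfun"
proof -
  obtain A where A: "\<And>v. cmod (F v) \<le> A" using bcontfunE[OF F] by metis
  obtain B where B: "\<And>v. cmod (complex_of_real v ^ s * F v) \<le> B" using bcontfunE[OF H] by metis
  show ?thesis
  proof (rule bcontfun_normI)
    show "continuous_on UNIV (\<lambda>v. complex_of_real v ^ k * F v)"
      using F by (intro continuous_intros) (auto simp: bcontfun_def)
    show "cmod (complex_of_real v ^ k * F v) \<le> A + B" for v
    proof (cases "\<bar>v\<bar> \<le> 1")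
      case True
      then have "\<bar>v\<bar> ^ k * cmod (F v) \<le> 1 * cmod (F v)" by (intro mult_right_mono power_le_one) auto
      moreover have "0 \<le> B" using order_trans[OF norm_ge_zero B] .
      ultimately show ?thesis using A[of v] by (simp add: norm_mult norm_power)
    next
      case False
      then have "\<bar>v\<bar> ^ k * cmod (F v) \<le> \<bar>v\<bar> ^ s * cmod (F v)" using k by (intro mult_right_mono power_increasing) auto
      moreover have "0 \<le> A" using order_trans[OF norm_ge_zero A] .
      ultimately show ?thesis using B[of v] by (simp add: norm_mult norm_power)
    qed
  qed
qed

theorem theorem6p1:
  fixes f :: "real \<Rightarrow> complex"
  assumes "f \<in> quadrature_class"
  shows
    "(\<forall>s::nat. 2 \<le> s \<longrightarrow>
        square_integrable (\<lambda>v. complex_of_real v ^ s * fourier f v) \<longrightarrow>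
        (\<lambda>v. complex_of_real v ^ s * fourier f v) \<in> bcontfun \<longrightarrow>
        (\<exists>g. has_L2_derivative s f g) \<and>
        (\<forall>g. has_L2_derivative s f g \<longrightarrow>
          (\<forall>\<sigma>>0. \<forall>h. h = 2 * pi / \<sigma> \<longrightarrow>
            cmod (quadrature_remainder \<sigma> f)
              \<le> h ^ s * (2 * zeta (real s) / (2 * pi) powr (real s - 1 / 2))
                  * dist_infty g (bernstein_L1 \<sigma>)))) \<and>
     (\<forall>\<alpha>::real. 1 < \<alpha> \<longrightarrow>
        square_integrable (\<lambda>v. complex_of_real (\<bar>v\<bar> powr \<alpha>) * fourier f v) \<longrightarrow>
        (\<lambda>v. complex_of_real (\<bar>v\<bar> powr \<alpha>) * fourier f v) \<in> bcontfun \<longrightarrow>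
        (\<exists>g. \<forall>j::nat. \<alpha> < 2 * real j \<longrightarrow> has_strong_riesz_derivative j \<alpha> f g) \<and>
        (\<forall>g. \<forall>j::nat. has_strong_riesz_derivative j \<alpha> f g \<longrightarrow>
          (\<forall>\<sigma>>0. \<forall>h. h = 2 * pi / \<sigma> \<longrightarrow>
            cmod (quadrature_remainder \<sigma> f)
              \<le> h powr \<alpha> * (2 * zeta \<alpha> / (2 * pi) powr (\<alpha> - 1 / 2))
                  * dist_infty g (bernstein_L1 \<sigma>))))"
proof -
  define F where "F = fourier f"
  have fb: "f \<in> bcontfun" and fl: "integrable lebesgue f" using assms by (auto simp: quadrature_class_def)
  have fi: "integrable lborel f" using fl bcontfun_borel[OF fb] by (subst (asm) integrable_completion) auto
  have Fb: "F \<in> bcontfun" unfolding F_def by (rule bcontfun_fourier[OF fi])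
  note Fm = bcontfun_borel[OF Fb]
  \<comment> \<open>Only the modulus of \<open>H\<close> matters here, so one statement serves both
    (iv)^s F and |v|^\<alpha> F.\<close>
  have Fi: "integrable lborel F" and inv: "ifourier F = f"
    if \<alpha>: "1 < \<alpha>" and H: "H \<in> bcontfun" and HF: "\<And>v. cmod (H v) = \<bar>v\<bar> powr \<alpha> * cmod (F v)" for \<alpha> H
  proof -
    obtain A where A: "\<And>v. cmod (F v) \<le> A" using bcontfunE[OF Fb] by metis
    obtain B where B: "\<And>v. cmod (H v) \<le> B" using bcontfunE[OF H] by metis
    have "decaying \<alpha> (2 powr \<alpha> * (A + B)) F"
      using A B \<alpha> by (intro decaying_of_bounded) (auto simp flip: HF)
    then show i: "integrable lborel F" by (rule decaying_integrable[OF \<alpha> _ Fm])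
    show "ifourier F = f" using fourier_inversion[OF fi fb i[unfolded F_def]] by (simp add: F_def)
  qed
  show ?thesis
    unfolding F_def[symmetric]
  proof (intro conjI allI impI)
    fix s :: nat
    assume s: "2 \<le> s" and sq: "square_integrable (\<lambda>v. complex_of_real v ^ s * F v)"
      and bc: "(\<lambda>v. complex_of_real v ^ s * F v) \<in> bcontfun"
    \<comment> \<open>The factor i^s makes this the transform of the derivative; being unimodular,
      it leaves the hypotheses on v^s F intact.\<close>
    define H where "H v = (\<i> * complex_of_real v) ^ s * F v" for v
    have i_pow: "(\<lambda>v. (\<i> * complex_of_real v) ^ k * F v) = (\<lambda>v. \<i> ^ k * (complex_of_real v ^ k * F v))" for k
      by (simp add: power_mult_distrib mult.assoc)
    have en: "energy (\<lambda>v. complex_of_real v ^ s * F v) < \<infinity>" using sq by (simp add: square_integrable_iff_energy)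
    have HF: "cmod (H v) = \<bar>v\<bar> powr real s * cmod (F v)" for v
      using s by (cases "v = 0") (auto simp: H_def norm_mult norm_power powr_realpow)
    have bck: "(\<lambda>v. (\<i> * complex_of_real v) ^ k * F v) \<in> bcontfun" if "k \<le> s" for k
    proof -
      note b = bcontfun_power_mult[OF Fb bc that]
      obtain B where B: "\<And>v. cmod (complex_of_real v ^ k * F v) \<le> B" using bcontfunE[OF b] by metis
      show ?thesis
        unfolding i_pow
      proof (rule bcontfun_normI)
        show "continuous_on UNIV (\<lambda>v. \<i> ^ k * (complex_of_real v ^ k * F v))"
          using b by (intro continuous_on_mult_left) (auto simp: bcontfun_def)
      qed (use B in \<open>simp add: norm_mult norm_power\<close>)
    qed
    have Hb: "H \<in> bcontfun" using bck[of s] by (simp add: H_def[abs_def])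
    have s1: "1 < real s" using s by simp
    note Fi' = Fi[OF s1 Hb HF] and inv' = inv[OF s1 Hb HF]
    have int: "integrable lborel (\<lambda>v. (\<i> * complex_of_real v) ^ k * F v)" if "k < s" for k
      unfolding i_pow using integrable_power_mult[OF Fi' Fm en that] by (rule integrable_mult_right)
    have enH: "energy (\<lambda>v. (\<i> * complex_of_real v) ^ s * F v) < \<infinity>"
      using en unfolding energy_def i_pow by (simp add: norm_mult norm_power)
    have "\<exists>g. has_L2_derivative s (ifourier F) g" by (rule has_L2_derivative_fourier(1)[OF s int bck enH])
    then show "\<exists>g. has_L2_derivative s f g" unfolding inv' .
    have D: "has_fourier_L2 g H" if "has_L2_derivative s (ifourier F) g" for g
      unfolding H_def[abs_def] by (rule has_L2_derivative_fourier(2)[OF s int bck enH that])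
    fix g and \<sigma> h :: real
    assume g: "has_L2_derivative s f g" and \<sigma>: "0 < \<sigma>" and h: "h = 2 * pi / \<sigma>"
    have "h powr real s = h ^ s" using \<sigma> h by (intro powr_realpow) simp
    moreover have "has_fourier_L2 g H" using D g unfolding inv' .
    ultimately show "cmod (quadrature_remainder \<sigma> f)
       \<le> h ^ s * (2 * zeta (real s) / (2 * pi) powr (real s - 1 / 2)) * dist_infty g (bernstein_L1 \<sigma>)"
      using quadrature_remainder_le[OF assms s1 Hb HF[unfolded F_def] _ \<sigma> h] by metis
  next
    fix \<alpha> :: real
    assume \<alpha>: "1 < \<alpha>" and sq: "square_integrable (\<lambda>v. complex_of_real (\<bar>v\<bar> powr \<alpha>) * F v)"
      and bc: "(\<lambda>v. complex_of_real (\<bar>v\<bar> powr \<alpha>) * F v) \<in> bcontfun"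
    have HF: "cmod (complex_of_real (\<bar>v\<bar> powr \<alpha>) * F v) = \<bar>v\<bar> powr \<alpha> * cmod (F v)" for v
      by (simp add: norm_mult)
    have en: "energy (\<lambda>v. complex_of_real (\<bar>v\<bar> powr \<alpha>) * F v) < \<infinity>" using sq by (simp add: square_integrable_iff_energy)
    note Fi' = Fi[OF \<alpha> bc HF] and inv' = inv[OF \<alpha> bc HF]
    have "0 < \<alpha>" using \<alpha> by simp
    note D = has_strong_riesz_derivative_fourier[OF Fi' Fb this refl bc en, unfolded inv']
    show "\<exists>g. \<forall>j::nat. \<alpha> < 2 * real j \<longrightarrow> has_strong_riesz_derivative j \<alpha> f g" by (rule D(1))
    fix g and j :: nat and \<sigma> h :: real
    assume g: "has_strong_riesz_derivative j \<alpha> f g" and \<sigma>: "0 < \<sigma>" and h: "h = 2 * pi / \<sigma>"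
    show "cmod (quadrature_remainder \<sigma> f)
       \<le> h powr \<alpha> * (2 * zeta \<alpha> / (2 * pi) powr (\<alpha> - 1 / 2)) * dist_infty g (bernstein_L1 \<sigma>)"
      by (rule quadrature_remainder_le[OF assms \<alpha> bc _ D(2)[OF g] \<sigma> h]) (simp add: norm_mult F_def)
  qed
qed

end
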